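(* Let $R$ be a rational function without poles in $\overline{\mathbb{D}}$, of degree $N=N_1+N_2$, written as $$R(z)=P(z)+\sum_{l=1}^{r}\sum_{j=1}^{k_l}\frac{\alpha_{l,j}}{(z-\eta_l)^j},$$ where $P$ is a polynomial of degree $N_1$, $\alpha_{l,j}\in\mathbb{C}$, the points $\eta_1,\dots,\eta_r\in\mathbb{C}\setminus\overline{\mathbb{D}}$ are the distinct poles of $R$, of multiplicities $k_1,\dots,k_r$, and $N_2=\sum_{l=1}^r k_l$. Let $\varphi\in H^\infty$ and $$\Phi(z)=R\Big(\frac1z\Big)+\varphi(z).$$ Assume that $$\mathbb{D}\cap\big(\mathbb{C}\setminus\overline{\Phi(\mathbb{D})}\big)\neq\emptyset\quad\text{and}\quad \widehat{\mathbb{D}}\cap\big(\mathbb{C}\setminus\overline{\Phi(\mathbb{D})}\big)\neq\emptyset,$$ where $\widehat{\mathbb{D}}=\mathbb{C}\setminus\overline{\mathbb{D}}$, and that for every $\lambda\in\mathbb{C}\setminus\overline{\Phi(\mathbb{D})}$ the family $\{1,z,\dots,z^{N-1}\}$ is cyclic for the operator $T_{h_\lambda}$, where $h_\lambda(z)=\dfrac{1}{\Phi(z)-\lambda}$. Then the Toeplitz operator $T_\Phi$ is hypercyclic on $H^2$.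
   Context: $\mathbb{D}$ is the open unit disc and $\mathbb{T}$ the unit circle. $H^2$ is the Hardy space of functions analytic in $\mathbb{D}$ with square summable Taylor coefficients (identified with a closed subspace of $L^2(\mathbb{T})$ via boundary values), and $H^\infty$ is the space of bounded analytic functions in $\mathbb{D}$. For $\psi\in L^\infty(\mathbb{T})$ the Toeplitz operator $T_\psi:H^2\to H^2$ is $T_\psi f=P_+(\psi f)$, where $P_+$ is the orthogonal projection from $L^2(\mathbb{T})$ onto $H^2$; $T_\Phi$ is the Toeplitz operator whose symbol is the boundary function of $\Phi$ on $\mathbb{T}$. For $h\in H^\infty$, $T_h$ is multiplication by $h$. A continuous linear operator $T$ on a separable Banach space $X$ is hypercyclic if there is $x\in X$ such that $\{T^n x:n=0,1,2,\dots\}$ is dense in $X$. The cases $N_1=0$ ($P$ constant) and $N_2=0$ ($r=0$, $R=P$) are allowed. The function $\Phi$ is analytic in $\mathbb{D}$ except for a pole of order $N_1$ at $0$ (if $N_1\ge1$) and poles of multiplicity $k_l$ at $1/\eta_l$; $\Phi(\mathbb{D})$ is the set of finite values of $\Phi$ on $\mathbb{D}$, and closures are taken in $\mathbb{C}$. For $\lambda\in\mathbb{C}\setminus\overline{\Phi(\mathbb{D})}$ the function $h_\lambda$ (set equal to $0$ at the poles of $\Phi$) is analytic and bounded in $\mathbb{D}$. A finite or countable family $U\subset H^2$ is cyclic for $T_h$, $h\in H^\infty$, if $\{h^k u:u\in U,\ k\ge0\}$ is complete in $H^2$, i.e. its linear span is dense in $H^2$. *)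

theory Defs
  imports
    "HOL-Complex_Analysis.Complex_Analysis"
    "HOL-Probability.Probability"
    "HOL-Library.Function_Algebras"
begin

text \<open>
  Functions on the open unit disc are represented by functions \<open>complex \<Rightarrow> complex\<close>. Members of
  \<open>hardy2\<close> are normalised to vanish outside the disc, so that equality in \<open>hardy2\<close> is equality on
  the disc. Sums and differences of functions are pointwise.
\<close>

definition cfun_scale :: "complex \<Rightarrow> (complex \<Rightarrow> complex) \<Rightarrow> complex \<Rightarrow> complex" where
  "cfun_scale c f = (\<lambda>z. c * f z)"

interpretation cfun: vector_space cfun_scale
  by standard (auto simp: cfun_scale_def fun_eq_iff algebra_simps)

definition on_disc :: "(complex \<Rightarrow> complex) \<Rightarrow> complex \<Rightarrow> complex" where
  "on_disc f = (\<lambda>z. if z \<in> ball 0 1 then f z else 0)"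

definition taylor_coeff :: "(complex \<Rightarrow> complex) \<Rightarrow> nat \<Rightarrow> complex" where
  "taylor_coeff f n = (deriv ^^ n) f 0 / fact n"

definition hardy2 :: "(complex \<Rightarrow> complex) set" where
  "hardy2 = {f. f holomorphic_on ball 0 1 \<and> summable (\<lambda>n. (cmod (taylor_coeff f n))\<^sup>2) \<and>
                (\<forall>z. z \<notin> ball 0 1 \<longrightarrow> f z = 0)}"

definition hardy2_norm :: "(complex \<Rightarrow> complex) \<Rightarrow> real" where
  "hardy2_norm f = sqrt (\<Sum>n. (cmod (taylor_coeff f n))\<^sup>2)"

definition hardy_inf :: "(complex \<Rightarrow> complex) set" where
  "hardy_inf = {f. f holomorphic_on ball 0 1 \<and> bounded (f ` ball 0 1)}"

definition hardy2_dense :: "(complex \<Rightarrow> complex) set \<Rightarrow> bool" where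
  "hardy2_dense S \<longleftrightarrow> S \<subseteq> hardy2 \<and> (\<forall>g\<in>hardy2. \<forall>e>0. \<exists>f\<in>S. hardy2_norm (f - g) < e)"

text \<open>Normalised Lebesgue measure on the unit circle, as a complete measure on the plane.\<close>

definition circle_measure :: "complex measure" where
  "circle_measure = completion (distr (uniform_measure lborel {0..<2*pi}) borel cis)"

text \<open>
  Boundary function on the unit circle: the radial limit, which for the functions below exists at
  almost every point. The values at the remaining points are immaterial.
\<close>

definition boundary_fun :: "(complex \<Rightarrow> complex) \<Rightarrow> complex \<Rightarrow> complex" where
  "boundary_fun f \<zeta> = Lim (at_left 1) (\<lambda>\<rho>. f (complex_of_real \<rho> * \<zeta>))"

text \<open>
  Orthogonal projection of a square integrable function \<open>g\<close> on the circle onto \<open>hardy2\<close>, the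
  latter regarded as a subspace of the square integrable functions through \<open>boundary_fun\<close>.
\<close>

definition hardy_projection :: "(complex \<Rightarrow> complex) \<Rightarrow> complex \<Rightarrow> complex" where
  "hardy_projection g = (THE f. f \<in> hardy2 \<and>
     (\<forall>u\<in>hardy2. (LINT \<zeta>|circle_measure. (g \<zeta> - boundary_fun f \<zeta>) * cnj (boundary_fun u \<zeta>)) = 0))"

definition toeplitz ::
    "(complex \<Rightarrow> complex) \<Rightarrow> (complex \<Rightarrow> complex) \<Rightarrow> complex \<Rightarrow> complex" where
  "toeplitz \<psi> f = hardy_projection (\<lambda>\<zeta>. \<psi> \<zeta> * boundary_fun f \<zeta>)"

definition hardy2_bounded_operator ::
    "((complex \<Rightarrow> complex) \<Rightarrow> complex \<Rightarrow> complex) \<Rightarrow> bool" where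
  "hardy2_bounded_operator T \<longleftrightarrow>
     (\<forall>f\<in>hardy2. T f \<in> hardy2) \<and>
     (\<forall>f\<in>hardy2. \<forall>g\<in>hardy2. T (f + g) = T f + T g) \<and>
     (\<forall>c. \<forall>f\<in>hardy2. T (cfun_scale c f) = cfun_scale c (T f)) \<and>
     (\<exists>K. \<forall>f\<in>hardy2. hardy2_norm (T f) \<le> K * hardy2_norm f)"

definition hypercyclic_on_hardy2 ::
    "((complex \<Rightarrow> complex) \<Rightarrow> complex \<Rightarrow> complex) \<Rightarrow> bool" where
  "hypercyclic_on_hardy2 T \<longleftrightarrow>
     hardy2_bounded_operator T \<and> (\<exists>f\<in>hardy2. hardy2_dense (range (\<lambda>n. (T ^^ n) f)))"

text \<open>The family \<open>U\<close> is cyclic for the operator of multiplication by \<open>h\<close>.\<close>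

definition cyclic_for_mult :: "(complex \<Rightarrow> complex) \<Rightarrow> (complex \<Rightarrow> complex) set \<Rightarrow> bool" where
  "cyclic_for_mult h U \<longleftrightarrow>
     hardy2_dense (cfun.span {(\<lambda>z. h z ^ n * u z) | n u. u \<in> U})"

definition rational_fun ::
    "complex poly \<Rightarrow> nat \<Rightarrow> (nat \<Rightarrow> complex) \<Rightarrow> (nat \<Rightarrow> nat) \<Rightarrow> (nat \<Rightarrow> nat \<Rightarrow> complex)
      \<Rightarrow> complex \<Rightarrow> complex" where
  "rational_fun P r \<eta> k \<alpha> w = poly P w + (\<Sum>l=1..r. \<Sum>j=1..k l. \<alpha> l j / (w - \<eta> l) ^ j)"

text \<open>
  \<open>R(1/z) + \<phi>(z)\<close>. If \<open>P\<close> is constant, then \<open>R(1/z)\<close> has a removable singularity at \<open>0\<close> with value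
  \<open>coeff P 0\<close>, the value of \<open>R\<close> at infinity, which \<open>R (1 / 0) = R 0\<close> would miss. Otherwise \<open>0\<close> is
  a pole and the value there is never used.
\<close>

definition symbol_fun ::
    "complex poly \<Rightarrow> nat \<Rightarrow> (nat \<Rightarrow> complex) \<Rightarrow> (nat \<Rightarrow> nat) \<Rightarrow> (nat \<Rightarrow> nat \<Rightarrow> complex)
      \<Rightarrow> (complex \<Rightarrow> complex) \<Rightarrow> complex \<Rightarrow> complex" where
  "symbol_fun P r \<eta> k \<alpha> \<phi> z =
     (if z = 0 then coeff P 0 else rational_fun P r \<eta> k \<alpha> (1 / z)) + \<phi> z"

definition disc_values :: "(complex \<Rightarrow> complex) \<Rightarrow> complex set" where
  "disc_values \<Phi> = \<Phi> ` {z \<in> ball 0 1. \<not> is_pole \<Phi> z}"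

definition resolvent_fun :: "(complex \<Rightarrow> complex) \<Rightarrow> complex \<Rightarrow> complex \<Rightarrow> complex" where
  "resolvent_fun \<Phi> \<mu> = on_disc (\<lambda>z. if is_pole \<Phi> z then 0 else 1 / (\<Phi> z - \<mu>))"

end

theory Submission
  imports Defs
begin

text \<open>
  The operator has so many eigenvectors that it must be hypercyclic. Write \<open>\<Phi> = A / Q + \<phi>\<close> with
  polynomials \<open>A\<close> and \<open>Q\<close> that have no common zero, where \<open>Q\<close> has exactly \<open>N\<close> zeros, all in the open
  disc. For \<open>\<mu>\<close> outside the closure of the values of \<open>\<Phi>\<close> the function \<open>Q (\<Phi> - \<mu>)\<close> is bounded and
  bounded away from zero on the disc. Hence \<open>v = z ^ j / (Q (\<Phi> - \<mu>))\<close> lies in the Hardy space, and on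
  the circle \<open>(\<Phi> - \<mu>) v = z ^ j / Q\<close>. For \<open>j < N\<close> the right-hand side is the complex conjugate of a
  function that is analytic in the disc and vanishes at the origin, so the projection annihilates it,
  and \<open>v\<close> is an eigenvector with eigenvalue \<open>\<mu>\<close> (lemma \<open>eigenvec_eigenvector\<close>).
  
  Let \<open>h\<close> be the function \<open>1 / (\<Phi> - \<mu>)\<close>. The resolvent identity shows that the closed span of the
  eigenvectors with parameters near \<open>\<mu>\<close> contains every \<open>h ^ n v\<close>. These are the images of the
  functions \<open>h ^ n z ^ j\<close> under multiplication by \<open>1 / (Q (\<Phi> - \<mu>))\<close>, which is invertible on the Hardy
  space, so cyclicity makes the eigenvectors near \<open>\<mu>\<close> complete (lemma \<open>eigenvec_span_dense\<close>). For \<open>\<mu>\<close>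
  inside the disc they span vectors whose orbits tend to zero; for \<open>\<mu>\<close> outside they span vectors that
  have backward orbits tending to zero. When both sets are dense, a Baire category argument yields a
  dense orbit (theorem \<open>hypercyclicity_criterion\<close>, due to Kitai, Gethner and Shapiro; its use with
  eigenvectors is due to Godefroy and Shapiro).
  
  The analytic foundation is Fatou's theorem, because Toeplitz operators act on boundary values defined
  as radial limits. A Vitali covering argument and the monotonicity of the Poisson kernel give a weak
  type inequality for the radial maximal function, and approximation by polynomials then gives radial
  limits almost everywhere (theorem \<open>radial_limit_exists\<close>). It follows that the Fourier coefficients
  of a boundary function are the Taylor coefficients, and that the Taylor coefficients of \<open>T f\<close> are the
  Fourier coefficients of the symbol times the boundary function of \<open>f\<close>
  (theorem \<open>toeplitz_bounded_operator\<close>).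
\<close>

section \<open>The Hardy space as a space of square summable sequences\<close>

text \<open>
  Uniqueness of power series. Coefficients of functions given by a series are read off with it, which
  avoids iterated derivatives.
\<close>

lemma taylor_coeff_eqI:
  assumes "\<And>z. cmod z < 1 \<Longrightarrow> (\<lambda>n. a n * z ^ n) sums f z"
  shows "taylor_coeff f = a"
proof
  fix n
  define F where "F = Abs_fps a"
  have cr: "fps_conv_radius F \<ge> 1"
  proof -
    have "conv_radius a \<ge> ereal r" if "r < 1" for r
    proof (cases "r > 0")
      case True
      have "summable (\<lambda>n. a n * complex_of_real r ^ n)"
        using assms[of "complex_of_real r"] True that by (auto simp: sums_iff)
      from conv_radius_geI[OF this] True show ?thesis by simp
    next
      case False
      then show ?thesis using conv_radius_nonneg[of a]
        by (metis ereal_less_eq(3) not_less order_trans zero_ereal_def)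
    qed
    then have "1 \<le> conv_radius a"
      by (smt (verit) ereal_dense2 ereal_less(3) linorder_not_le one_ereal_def order_less_imp_le
          less_ereal.simps(1) ereal_less_eq(3) leD)
    then show ?thesis by (simp add: F_def fps_conv_radius_def)
  qed
  have "eval_fps F has_fps_expansion F"
    by (rule eval_fps_has_fps_expansion) (use cr in \<open>auto intro: less_le_trans[of 0 1]\<close>)
  moreover have "eventually (\<lambda>z. eval_fps F z = f z) (nhds 0)"
  proof -
    have "eventually (\<lambda>z::complex. z \<in> ball 0 1) (nhds 0)"
      by (rule eventually_nhds_in_open) auto
    then show ?thesis
      by eventually_elim (use assms in \<open>auto simp: eval_fps_def F_def sums_iff\<close>)
  qed
  ultimately have "f has_fps_expansion F"
    using has_fps_expansion_cong by blast
  then have "fps_expansion f 0 = F" by (rule fps_expansion_eqI)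
  then show "taylor_coeff f n = a n"
    by (simp add: fps_expansion_def F_def taylor_coeff_def fps_eq_iff)
qed

lemma taylor_sums:
  assumes "f holomorphic_on ball 0 1" "cmod z < 1"
  shows "(\<lambda>n. taylor_coeff f n * z ^ n) sums f z"
  using holomorphic_power_series[OF assms(1), of z] assms(2) by (simp add: taylor_coeff_def)

lemma hardy2_sums: "f \<in> hardy2 \<Longrightarrow> cmod z < 1 \<Longrightarrow> (\<lambda>n. taylor_coeff f n * z ^ n) sums f z"
  by (rule taylor_sums) (auto simp: hardy2_def)

lemma hardy2_holomorphic: "f \<in> hardy2 \<Longrightarrow> f holomorphic_on ball 0 1"
  by (simp add: hardy2_def)

lemma hardy2_outside: "f \<in> hardy2 \<Longrightarrow> cmod z \<ge> 1 \<Longrightarrow> f z = 0"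
  by (auto simp: hardy2_def)

lemma hardy2_summable: "f \<in> hardy2 \<Longrightarrow> summable (\<lambda>n. (cmod (taylor_coeff f n))\<^sup>2)"
  by (simp add: hardy2_def)

lemma hardy2I:
  assumes "\<And>z. cmod z < 1 \<Longrightarrow> (\<lambda>n. a n * z ^ n) sums f z"
    and "summable (\<lambda>n. (cmod (a n))\<^sup>2)" and "\<And>z. cmod z \<ge> 1 \<Longrightarrow> f z = 0"
  shows "f \<in> hardy2"
proof -
  have "f holomorphic_on ball 0 1"
    by (rule power_series_holomorphic[where a = a]) (use assms(1) in auto)
  then show ?thesis
    using assms by (auto simp: hardy2_def taylor_coeff_eqI[of a f, OF assms(1)])
qed

definition hardy_series :: "(nat \<Rightarrow> complex) \<Rightarrow> complex \<Rightarrow> complex" where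
  "hardy_series a = on_disc (\<lambda>z. \<Sum>n. a n * z ^ n)"

lemma square_summable_bounded:
  assumes "summable (\<lambda>n. (cmod (a n))\<^sup>2)"
  obtains B where "\<And>n. cmod (a n) \<le> B"
proof -
  have "Bseq (\<lambda>n. (cmod (a n))\<^sup>2)"
    using assms summable_LIMSEQ_zero convergent_imp_Bseq convergentI by blast
  then obtain K where K: "\<And>n. (cmod (a n))\<^sup>2 \<le> K" by (auto simp: Bseq_def)
  have "cmod (a n) \<le> sqrt K" for n
    using K[of n] by (simp add: real_le_rsqrt)
  then show ?thesis by (rule that)
qed

lemma square_summable_power_summable:
  assumes "summable (\<lambda>n. (cmod (a n))\<^sup>2)" and "cmod z < 1"
  shows "summable (\<lambda>n. cmod (a n * z ^ n))"
proof -
  obtain B where B: "\<And>n. cmod (a n) \<le> B" using square_summable_bounded[OF assms(1)] by blast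
  have "summable (\<lambda>n. B * cmod z ^ n)"
    using assms(2) by (intro summable_mult summable_geometric) auto
  then show ?thesis
    by (rule summable_comparison_test') (auto simp: norm_mult norm_power intro!: mult_right_mono B)
qed

lemma hardy_series:
  assumes "summable (\<lambda>n. (cmod (a n))\<^sup>2)"
  shows "hardy_series a \<in> hardy2" "taylor_coeff (hardy_series a) = a"
proof -
  have s: "(\<lambda>n. a n * z ^ n) sums hardy_series a z" if "cmod z < 1" for z
    using summable_norm_cancel[OF square_summable_power_summable[OF assms that]] that
    by (auto simp: hardy_series_def on_disc_def summable_sums)
  show "hardy_series a \<in> hardy2"
    by (rule hardy2I[OF s assms]) (auto simp: hardy_series_def on_disc_def)
  show "taylor_coeff (hardy_series a) = a" by (rule taylor_coeff_eqI[OF s])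
qed

lemma hardy2_eqI:
  assumes "f \<in> hardy2" "g \<in> hardy2" "taylor_coeff f = taylor_coeff g"
  shows "f = g"
proof
  fix z show "f z = g z"
  proof (cases "cmod z < 1")
    case True then show ?thesis
      using hardy2_sums[OF assms(1) True] hardy2_sums[OF assms(2) True] assms(3) sums_unique2 by metis
  next
    case False then show ?thesis using assms by (simp add: hardy2_outside)
  qed
qed

lemma square_summable_add:
  assumes "summable (\<lambda>n. (cmod (a n))\<^sup>2)" "summable (\<lambda>n. (cmod (b n))\<^sup>2)"
  shows "summable (\<lambda>n. (cmod (a n + b n))\<^sup>2)"
proof (rule summable_comparison_test')
  show "summable (\<lambda>n. 2 * (cmod (a n))\<^sup>2 + 2 * (cmod (b n))\<^sup>2)"
    using assms by (intro summable_add summable_mult)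
  fix n
  have "(cmod (a n + b n))\<^sup>2 \<le> (cmod (a n) + cmod (b n))\<^sup>2"
    by (intro power_mono norm_triangle_ineq) auto
  also have "\<dots> \<le> 2 * (cmod (a n))\<^sup>2 + 2 * (cmod (b n))\<^sup>2"
    using sum_squares_bound[of "cmod (a n)" "cmod (b n)"] by (simp add: power2_sum)
  finally show "norm ((cmod (a n + b n))\<^sup>2) \<le> 2 * (cmod (a n))\<^sup>2 + 2 * (cmod (b n))\<^sup>2" by simp
qed

lemma square_summable_scale:
  assumes "summable (\<lambda>n. (cmod (a n))\<^sup>2)"
  shows "summable (\<lambda>n. (cmod (c * a n))\<^sup>2)"
  using summable_mult[OF assms, of "(cmod c)\<^sup>2"] by (simp add: norm_mult power_mult_distrib)

lemma hardy2_add: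
  assumes "f \<in> hardy2" "g \<in> hardy2"
  shows "f + g \<in> hardy2" "taylor_coeff (f + g) = (\<lambda>n. taylor_coeff f n + taylor_coeff g n)"
proof -
  have s: "(\<lambda>n. (taylor_coeff f n + taylor_coeff g n) * z ^ n) sums (f + g) z" if "cmod z < 1" for z
    using sums_add[OF hardy2_sums[OF assms(1) that] hardy2_sums[OF assms(2) that]]
    by (simp add: algebra_simps)
  show "f + g \<in> hardy2"
    by (rule hardy2I[OF s square_summable_add[OF hardy2_summable hardy2_summable]])
      (use assms in \<open>auto simp: hardy2_outside\<close>)
  show "taylor_coeff (f + g) = (\<lambda>n. taylor_coeff f n + taylor_coeff g n)"
    by (rule taylor_coeff_eqI[OF s])
qed

lemma hardy2_scale:
  assumes "f \<in> hardy2"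
  shows "cfun_scale c f \<in> hardy2" "taylor_coeff (cfun_scale c f) = (\<lambda>n. c * taylor_coeff f n)"
proof -
  have s: "(\<lambda>n. (c * taylor_coeff f n) * z ^ n) sums cfun_scale c f z" if "cmod z < 1" for z
    using sums_mult[OF hardy2_sums[OF assms(1) that], of c]
    by (simp add: algebra_simps cfun_scale_def)
  show "cfun_scale c f \<in> hardy2"
    by (rule hardy2I[OF s square_summable_scale[OF hardy2_summable]])
      (use assms in \<open>auto simp: hardy2_outside cfun_scale_def\<close>)
  show "taylor_coeff (cfun_scale c f) = (\<lambda>n. c * taylor_coeff f n)"
    by (rule taylor_coeff_eqI[OF s])
qed

lemma diff_eq_add_scale: "f - g = f + cfun_scale (- 1) g"
  by (auto simp: cfun_scale_def fun_eq_iff)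

lemma hardy2_diff:
  assumes "f \<in> hardy2" "g \<in> hardy2"
  shows "f - g \<in> hardy2" "taylor_coeff (f - g) = (\<lambda>n. taylor_coeff f n - taylor_coeff g n)"
  unfolding diff_eq_add_scale
  using hardy2_add[OF assms(1) hardy2_scale(1)[OF assms(2), of "-1"]] hardy2_scale(2)[OF assms(2), of "-1"]
  by auto

lemma hardy2_zero: "0 \<in> hardy2" "taylor_coeff 0 = (\<lambda>n. 0)"
proof -
  have s: "(\<lambda>n. (0::complex) * z ^ n) sums 0 z" for z :: complex by simp
  show "0 \<in> hardy2" by (rule hardy2I[where a = "\<lambda>_. 0"]) auto
  show "taylor_coeff 0 = (\<lambda>n. 0)" by (rule taylor_coeff_eqI) auto
qed

lemma hardy2_sum:
  assumes "\<And>i. i \<in> I \<Longrightarrow> f i \<in> hardy2"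
  shows "sum f I \<in> hardy2" "taylor_coeff (sum f I) = (\<lambda>n. \<Sum>i\<in>I. taylor_coeff (f i) n)"
  using assms
  by (induction I rule: infinite_finite_induct) (auto simp: hardy2_zero hardy2_add)

lemma hardy2_norm_square:
  assumes "f \<in> hardy2"
  shows "(hardy2_norm f)\<^sup>2 = (\<Sum>n. (cmod (taylor_coeff f n))\<^sup>2)"
  unfolding hardy2_norm_def by (simp add: suminf_nonneg hardy2_summable[OF assms])

lemma hardy2_norm_nonneg: "f \<in> hardy2 \<Longrightarrow> hardy2_norm f \<ge> 0"
  unfolding hardy2_norm_def by (simp add: suminf_nonneg hardy2_summable)

lemma L2_set_le_hardy2_norm:
  assumes "f \<in> hardy2" "finite I"
  shows "L2_set (\<lambda>n. cmod (taylor_coeff f n)) I \<le> hardy2_norm f"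
  unfolding L2_set_def hardy2_norm_def
  by (intro real_sqrt_le_mono sum_le_suminf hardy2_summable assms) auto

lemma hardy2_norm_leI:
  assumes "f \<in> hardy2" "\<And>n. L2_set (\<lambda>n. cmod (taylor_coeff f n)) {..<n} \<le> C"
  shows "hardy2_norm f \<le> C"
proof -
  have C: "0 \<le> C" using assms(2)[of 0] by simp
  have "(\<Sum>n. (cmod (taylor_coeff f n))\<^sup>2) \<le> C\<^sup>2"
  proof (rule suminf_le_const[OF hardy2_summable[OF assms(1)]])
    fix n
    have "sqrt (\<Sum>i<n. (cmod (taylor_coeff f i))\<^sup>2) \<le> C"
      using assms(2)[of n] by (simp add: L2_set_def)
    then show "(\<Sum>i<n. (cmod (taylor_coeff f i))\<^sup>2) \<le> C\<^sup>2"
      by (simp add: sqrt_le_D)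
  qed
  then show ?thesis unfolding hardy2_norm_def using C by (simp add: real_le_lsqrt)
qed

lemma hardy2_norm_triangle:
  assumes "f \<in> hardy2" "g \<in> hardy2"
  shows "hardy2_norm (f + g) \<le> hardy2_norm f + hardy2_norm g"
proof (rule hardy2_norm_leI)
  show "f + g \<in> hardy2" using assms by (rule hardy2_add)
  fix n
  have "L2_set (\<lambda>n. cmod (taylor_coeff (f + g) n)) {..<n}
      \<le> L2_set (\<lambda>n. cmod (taylor_coeff f n) + cmod (taylor_coeff g n)) {..<n}"
    by (rule L2_set_mono) (auto simp: hardy2_add assms norm_triangle_ineq)
  also have "\<dots> \<le> L2_set (\<lambda>n. cmod (taylor_coeff f n)) {..<n} + L2_set (\<lambda>n. cmod (taylor_coeff g n)) {..<n}"
    by (rule L2_set_triangle_ineq)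
  also have "\<dots> \<le> hardy2_norm f + hardy2_norm g"
    by (intro add_mono L2_set_le_hardy2_norm assms) auto
  finally show "L2_set (\<lambda>n. cmod (taylor_coeff (f + g) n)) {..<n} \<le> hardy2_norm f + hardy2_norm g" .
qed

lemma hardy2_norm_scale:
  assumes "f \<in> hardy2"
  shows "hardy2_norm (cfun_scale c f) = cmod c * hardy2_norm f"
  unfolding hardy2_norm_def
  by (simp add: hardy2_scale[OF assms] norm_mult power_mult_distrib suminf_mult
      hardy2_summable[OF assms] real_sqrt_mult)

lemma hardy2_norm_diff_commute:
  assumes "f \<in> hardy2" "g \<in> hardy2"
  shows "hardy2_norm (f - g) = hardy2_norm (g - f)"
  unfolding hardy2_norm_def by (simp add: hardy2_diff assms norm_minus_commute)

lemma hardy2_norm_diff_triangle: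
  assumes "f \<in> hardy2" "g \<in> hardy2" "h \<in> hardy2"
  shows "hardy2_norm (f - h) \<le> hardy2_norm (f - g) + hardy2_norm (g - h)"
  using hardy2_norm_triangle[of "f - g" "g - h"] assms by (simp add: hardy2_diff)

lemma hardy2_norm_zero: "hardy2_norm 0 = 0"
  by (simp add: hardy2_norm_def hardy2_zero)

lemma cmod_taylor_coeff_le:
  assumes "f \<in> hardy2" shows "cmod (taylor_coeff f n) \<le> hardy2_norm f"
  using L2_set_le_hardy2_norm[OF assms, of "{n}"] by simp

lemma hardy2_norm_eq_0:
  assumes "f \<in> hardy2" "hardy2_norm f = 0" shows "f = 0"
proof (rule hardy2_eqI[OF assms(1) hardy2_zero(1)])
  show "taylor_coeff f = taylor_coeff 0"
    using cmod_taylor_coeff_le[OF assms(1)] assms(2) by (auto simp: hardy2_zero)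
qed

text \<open>
  The norm of a difference has its meaning only between members of the Hardy space. The value 0
  elsewhere makes the distance symmetric and nonnegative for all arguments, as a metric space requires.
\<close>

definition hardy_dist :: "(complex \<Rightarrow> complex) \<Rightarrow> (complex \<Rightarrow> complex) \<Rightarrow> real" where
  "hardy_dist f g = (if f \<in> hardy2 \<and> g \<in> hardy2 then hardy2_norm (f - g) else 0)"

interpretation hardy: Metric_space hardy2 hardy_dist
proof
  show "0 \<le> hardy_dist x y" for x y
    by (auto simp: hardy_dist_def hardy2_norm_nonneg hardy2_diff)
  show "hardy_dist x y = hardy_dist y x" for x y
    by (auto simp: hardy_dist_def hardy2_norm_diff_commute)
  show "hardy_dist x y = 0 \<longleftrightarrow> x = y" if "x \<in> hardy2" "y \<in> hardy2" for x y
    using hardy2_norm_eq_0[of "x - y"] that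
    by (auto simp: hardy_dist_def hardy2_norm_zero hardy2_diff)
  show "hardy_dist x z \<le> hardy_dist x y + hardy_dist y z"
    if "x \<in> hardy2" "y \<in> hardy2" "z \<in> hardy2" for x y z
    using that hardy2_norm_diff_triangle by (simp add: hardy_dist_def)
qed

text \<open>
  The coefficients converge one by one. The bound for a finite block of coefficients of
  \<open>\<sigma> m - \<sigma> n\<close> survives the limit in \<open>n\<close>, and as it does not depend on the block, the limit is square
  summable and close to \<open>\<sigma> m\<close>.
\<close>

lemma hardy_mcomplete: "hardy.mcomplete"
  unfolding hardy.mcomplete_def
proof (intro allI impI)
  fix x assume C: "hardy.MCauchy x"
  then have x: "x n \<in> hardy2" for n by (auto simp: hardy.MCauchy_def)
  have cau: "\<exists>M. \<forall>m\<ge>M. \<forall>n\<ge>M. hardy2_norm (x m - x n) < e" if "e > 0" for e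
    using C that x unfolding hardy.MCauchy_def hardy_dist_def by auto
  define c where "c n k = taylor_coeff (x n) k" for n k
  have "Cauchy (\<lambda>n. c n k)" for k
  proof (rule metric_CauchyI)
    fix e :: real assume "e > 0"
    then obtain M where M: "\<forall>m\<ge>M. \<forall>n\<ge>M. hardy2_norm (x m - x n) < e" using cau by blast
    have "dist (c m k) (c n k) < e" if "m \<ge> M" "n \<ge> M" for m n
      using cmod_taylor_coeff_le[of "x m - x n" k] M that x
      by (fastforce simp: hardy2_diff c_def dist_norm)
    then show "\<exists>M. \<forall>m\<ge>M. \<forall>n\<ge>M. dist (c m k) (c n k) < e" by blast
  qed
  then have "\<forall>k. \<exists>l. (\<lambda>n. c n k) \<longlonglongrightarrow> l" using Cauchy_convergent_iff convergent_def by blast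
  then obtain a where a: "\<And>k. (\<lambda>n. c n k) \<longlonglongrightarrow> a k" by metis
  have key: "L2_set (\<lambda>k. cmod (c m k - a k)) {..<L} \<le> e"
    if M: "\<forall>m\<ge>M. \<forall>n\<ge>M. hardy2_norm (x m - x n) < e" and m: "m \<ge> M" for M e m L
  proof (rule tendsto_upperbound)
    show "(\<lambda>n. L2_set (\<lambda>k. cmod (c m k - c n k)) {..<L}) \<longlonglongrightarrow> L2_set (\<lambda>k. cmod (c m k - a k)) {..<L}"
      unfolding L2_set_def by (intro tendsto_intros a)
    show "\<forall>\<^sub>F n in sequentially. L2_set (\<lambda>k. cmod (c m k - c n k)) {..<L} \<le> e"
      using eventually_ge_at_top[of M]
    proof eventually_elim
      case (elim n)
      have "L2_set (\<lambda>k. cmod (c m k - c n k)) {..<L} \<le> hardy2_norm (x m - x n)"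
        using L2_set_le_hardy2_norm[of "x m - x n" "{..<L}"] x by (simp add: hardy2_diff c_def)
      also have "\<dots> \<le> e" using M m elim by (intro less_imp_le) auto
      finally show ?case .
    qed
  qed auto
  have diff_summable: "summable (\<lambda>k. (cmod (c m k - a k))\<^sup>2)"
    if M: "\<forall>m\<ge>M. \<forall>n\<ge>M. hardy2_norm (x m - x n) < e" and m: "m \<ge> M" for M e m
  proof (rule summableI_nonneg_bounded)
    have "(\<Sum>i<L. (cmod (c m i - a i))\<^sup>2) \<le> e\<^sup>2" for L
      using key[OF M m, of L] unfolding L2_set_def by (rule sqrt_le_D)
    then show "(\<Sum>i<L. (cmod (c m i - a i))\<^sup>2) \<le> e\<^sup>2" for L .
  qed auto
  obtain M1 where M1: "\<forall>m\<ge>M1. \<forall>n\<ge>M1. hardy2_norm (x m - x n) < 1" using cau[of 1] by auto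
  have "summable (\<lambda>k. (cmod (a k))\<^sup>2)"
  proof -
    have "summable (\<lambda>k. (cmod (c M1 k + - 1 * (c M1 k - a k)))\<^sup>2)"
      by (rule square_summable_add[OF _ square_summable_scale])
        (use hardy2_summable[OF x] diff_summable[OF M1 order_refl] in \<open>auto simp: c_def\<close>)
    then show ?thesis by simp
  qed
  note fa = hardy_series[OF this]
  have "hardy2_norm (hardy_series a - x m) \<le> e"
    if M: "\<forall>m\<ge>M. \<forall>n\<ge>M. hardy2_norm (x m - x n) < e" and m: "m \<ge> M" for M e m
  proof (rule hardy2_norm_leI)
    show "hardy_series a - x m \<in> hardy2" by (intro hardy2_diff fa x)
    show "L2_set (\<lambda>n. cmod (taylor_coeff (hardy_series a - x m) n)) {..<n} \<le> e" for n
      using key[OF M m, of n] by (simp add: hardy2_diff fa x c_def norm_minus_commute)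
  qed
  note close = this
  have lim: "\<exists>M. \<forall>m\<ge>M. hardy2_norm (hardy_series a - x m) < e" if "e > 0" for e
  proof -
    obtain M where M: "\<forall>m\<ge>M. \<forall>n\<ge>M. hardy2_norm (x m - x n) < e / 2"
      using cau[OF half_gt_zero[OF \<open>e > 0\<close>]] by blast
    have "hardy2_norm (hardy_series a - x m) < e" if "m \<ge> M" for m
      using close[OF M that] \<open>e > 0\<close> by linarith
    then show ?thesis by blast
  qed
  have "limitin hardy.mtopology x (hardy_series a) sequentially"
    unfolding hardy.limit_metric_sequentially
    using lim fa x by (auto simp: hardy_dist_def hardy2_norm_diff_commute)
  then show "\<exists>y. limitin hardy.mtopology x y sequentially" by blast
qed

definition disc_monom :: "nat \<Rightarrow> complex \<Rightarrow> complex" where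
  "disc_monom n = on_disc (\<lambda>z. z ^ n)"

lemma disc_monom:
  "disc_monom n \<in> hardy2" "taylor_coeff (disc_monom n) = (\<lambda>k. if k = n then 1 else 0)"
proof -
  have s: "(\<lambda>k. (if k = n then 1 else 0) * z ^ k) sums disc_monom n z" if "cmod z < 1" for z
  proof -
    have "(\<lambda>k. if k = n then z ^ k else 0) sums z ^ n"
      using sums_single[of n "\<lambda>k. z ^ k"] by simp
    then show ?thesis using that
      by (simp add: disc_monom_def on_disc_def if_distrib[of "\<lambda>c. c * _"] cong: if_cong)
  qed
  show "disc_monom n \<in> hardy2"
    by (rule hardy2I[OF s summable_finite[of "{n}"]]) (auto simp: disc_monom_def on_disc_def)
  show "taylor_coeff (disc_monom n) = (\<lambda>k. if k = n then 1 else 0)"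
    by (rule taylor_coeff_eqI[OF s])
qed

definition disc_poly :: "(nat \<Rightarrow> complex) \<Rightarrow> nat \<Rightarrow> complex \<Rightarrow> complex" where
  "disc_poly a L = (\<Sum>n<L. cfun_scale (a n) (disc_monom n))"

lemma disc_poly:
  "disc_poly a L \<in> hardy2"
  "taylor_coeff (disc_poly a L) = (\<lambda>n. if n < L then a n else 0)"
proof -
  show "disc_poly a L \<in> hardy2"
    unfolding disc_poly_def by (intro hardy2_sum hardy2_scale disc_monom)
  show "taylor_coeff (disc_poly a L) = (\<lambda>n. if n < L then a n else 0)"
    unfolding disc_poly_def
    by (subst hardy2_sum) (auto simp: hardy2_scale disc_monom if_distrib cong: if_cong)
qed

lemma disc_poly_apply: "cmod z < 1 \<Longrightarrow> disc_poly a L z = (\<Sum>n<L. a n * z ^ n)"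
  unfolding disc_poly_def
  by (induction L) (auto simp: cfun_scale_def disc_monom_def on_disc_def)

lemma disc_poly_tendsto:
  assumes "f \<in> hardy2"
  shows "(\<lambda>L. hardy2_norm (f - disc_poly (taylor_coeff f) L)) \<longlonglongrightarrow> 0"
proof -
  let ?s = "\<lambda>n. (cmod (taylor_coeff f n))\<^sup>2"
  have eq: "hardy2_norm (f - disc_poly (taylor_coeff f) L) = sqrt ((\<Sum>n. ?s n) - (\<Sum>n<L. ?s n))" for L
  proof -
    have "(\<lambda>n. if n \<in> {..<L} then ?s n else 0) sums (\<Sum>n<L. ?s n)"
      by (rule sums_If_finite_set) auto
    from sums_diff[OF summable_sums[OF hardy2_summable[OF assms]] this]
    have "(\<lambda>n. (cmod (taylor_coeff (f - disc_poly (taylor_coeff f) L) n))\<^sup>2) sums ((\<Sum>n. ?s n) - (\<Sum>n<L. ?s n))"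
      by (rule sums_cong[THEN iffD1, rotated]) (auto simp: hardy2_diff disc_poly assms)
    then show ?thesis by (simp add: hardy2_norm_def sums_iff)
  qed
  have "(\<lambda>L. sqrt ((\<Sum>n. ?s n) - (\<Sum>n<L. ?s n))) \<longlonglongrightarrow> sqrt ((\<Sum>n. ?s n) - (\<Sum>n. ?s n))"
    by (intro tendsto_intros summable_LIMSEQ hardy2_summable assms)
  then show ?thesis by (simp add: eq)
qed

lemma disc_poly_approx:
  assumes "f \<in> hardy2" "e > 0"
  obtains L where "hardy2_norm (f - disc_poly (taylor_coeff f) L) < e"
  using order_tendstoD(2)[OF disc_poly_tendsto[OF assms(1)] assms(2)]
  by (auto simp: eventually_sequentially)

text \<open>
  The countable set consists of the polynomials with coefficients in a countable dense subset of the
  plane.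
\<close>

lemma hardy2_separable:
  obtains D where "countable D" "D \<subseteq> hardy2" "\<And>g e. g \<in> hardy2 \<Longrightarrow> e > 0 \<Longrightarrow> \<exists>f\<in>D. hardy2_norm (f - g) < e"
proof -
  obtain Q :: "complex set" where Q: "countable Q" "\<And>X. open X \<Longrightarrow> X \<noteq> {} \<Longrightarrow> \<exists>d\<in>Q. d \<in> X"
    using countable_dense_setE by blast
  define D where "D = (\<lambda>xs. disc_poly (\<lambda>n. xs ! n) (length xs)) ` lists Q"
  have "countable D" unfolding D_def using Q(1) by (intro countable_image countable_lists)
  moreover have "D \<subseteq> hardy2" by (auto simp: D_def disc_poly)
  moreover have "\<exists>f\<in>D. hardy2_norm (f - g) < e" if g: "g \<in> hardy2" and e: "e > 0" for g e
  proof -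
    obtain L where L: "hardy2_norm (g - disc_poly (taylor_coeff g) L) < e / 2"
      using disc_poly_approx[OF g, of "e / 2"] e by auto
    define d where "d = e / (2 * (real L + 1))"
    have d: "d > 0" using e by (simp add: d_def)
    have "\<exists>q\<in>Q. q \<in> ball (taylor_coeff g n) d" for n
      using Q(2)[of "ball (taylor_coeff g n) d"] d by auto
    then obtain q where q: "\<And>n. q n \<in> Q" "\<And>n. dist (taylor_coeff g n) (q n) < d" by (metis mem_ball)
    define f where "f = disc_poly q L"
    have "f = disc_poly (\<lambda>n. map q [0..<L] ! n) L"
      unfolding f_def disc_poly_def by (intro sum.cong) auto
    then have fD: "f \<in> D" unfolding D_def
      by (intro image_eqI[where x = "map q [0..<L]"]) (auto simp: q in_lists_conv_set)
    have f: "f \<in> hardy2" by (simp add: f_def disc_poly)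
    have "hardy2_norm (disc_poly (taylor_coeff g) L - f) \<le> real L * d"
    proof (rule hardy2_norm_leI)
      fix n
      have "L2_set (\<lambda>n. cmod (taylor_coeff (disc_poly (taylor_coeff g) L - f) n)) {..<n}
        \<le> (\<Sum>n<n. cmod (taylor_coeff (disc_poly (taylor_coeff g) L - f) n))"
        by (rule L2_set_le_sum) auto
      also have "\<dots> \<le> (\<Sum>n<n. if n < L then d else 0)"
        using q(2) d by (intro sum_mono)
          (auto simp: hardy2_diff disc_poly f_def dist_norm less_imp_le)
      also have "\<dots> = (\<Sum>n\<in>{..<n}\<inter>{..<L}. d)"
        by (subst sum.inter_restrict) (auto intro!: sum.cong)
      also have "\<dots> \<le> real L * d"
        using d card_mono[of "{..<L}" "{..<n} \<inter> {..<L}"] by simp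
      finally show "L2_set (\<lambda>n. cmod (taylor_coeff (disc_poly (taylor_coeff g) L - f) n)) {..<n} \<le> real L * d" .
    qed (intro hardy2_diff disc_poly f)
    also have "\<dots> < e / 2" using e by (simp add: d_def field_simps)
    finally have "hardy2_norm (disc_poly (taylor_coeff g) L - f) < e / 2" .
    then have "hardy2_norm (g - f) < e"
      using L hardy2_norm_diff_triangle[OF g disc_poly(1) f, of "taylor_coeff g" L] by linarith
    then show ?thesis using fD f g by (auto simp: hardy2_norm_diff_commute)
  qed
  ultimately show ?thesis by (rule that)
qed

section \<open>Fourier coefficients on the circle\<close>

text \<open>
  The circle measure before completion. Its measurable sets are the Borel sets, so measurability of
  explicit functions is a matter of continuity.
\<close>

definition arc_measure :: "complex measure" where
  "arc_measure = distr (uniform_measure lborel {0..<2*pi}) borel cis"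

lemma circle_measure_eq: "circle_measure = completion arc_measure"
  by (simp add: circle_measure_def arc_measure_def)

lemma space_circle [simp]: "space circle_measure = UNIV"
  by (simp add: circle_measure_eq arc_measure_def)

lemma sets_arc [simp, measurable_cong]: "sets arc_measure = sets borel"
  by (simp add: arc_measure_def)

lemma measurable_cis [measurable]: "cis \<in> borel_measurable borel"
  by (intro borel_measurable_continuous_onI continuous_intros)

lemma borel_measurable_circle: "F \<in> borel_measurable borel \<Longrightarrow> F \<in> borel_measurable circle_measure"
  unfolding circle_measure_eq by (rule measurable_completion) simp

lemma uniform_eq_density:
  "uniform_measure lborel {0..<2*pi} = density lborel (\<lambda>x. ennreal (indicator {0..<2*pi} x / (2*pi)))"
  unfolding uniform_measure_def
  by (intro density_cong) (auto simp: indicator_def divide_ennreal[symmetric])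

lemma prob_space_arc: "prob_space arc_measure"
proof -
  interpret u: prob_space "uniform_measure lborel {0..<2*pi}"
    by (rule prob_space_uniform_measure) auto
  show ?thesis unfolding arc_measure_def by (rule u.prob_space_distr) simp
qed

lemma prob_space_circle: "prob_space circle_measure"
  unfolding circle_measure_eq
by (rule prob_space.prob_space_completion[OF prob_space_arc])

interpretation circle: prob_space circle_measure by (rule prob_space_circle)

interpretation circle: complete_measure circle_measure
  unfolding circle_measure_eq by (rule completion.complete_measure_axioms)

lemma measure_circle_UNIV [simp]: "measure circle_measure UNIV = 1"
  using circle.prob_space by simp

lemma AE_circleI:
  assumes "AE w in arc_measure. Q w" shows "AE w in circle_measure. Q w"
  unfolding circle_measure_eq by (rule AE_completion[OF assms])

lemma AE_circle_unit: "AE w in circle_measure. cmod w = 1"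
proof (rule AE_circleI)
  show "AE w in arc_measure. cmod w = 1"
    unfolding arc_measure_def by (subst AE_distr_iff) (auto simp: norm_cis)
qed

text \<open>
  Boundary functions are defined by limits that exist only almost everywhere; this is where they
  become measurable, by completeness of the measure.
\<close>

lemma measurable_AE_cong:
  fixes F G :: "complex \<Rightarrow> complex"
  assumes "F \<in> borel_measurable circle_measure" "AE w in circle_measure. F w = G w"
  shows "G \<in> borel_measurable circle_measure"
proof (rule measurableI)
  fix A :: "complex set" assume A: "A \<in> sets borel"
  have "G -` A \<in> sets circle_measure"
  proof (rule circle.in_sets_AE)
    show "F -` A \<in> sets circle_measure" using measurable_sets[OF assms(1) A] by simp
    show "AE x in circle_measure. (x \<in> F -` A) = (x \<in> G -` A)"
      using assms(2) by eventually_elim simp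
  qed auto
  then show "G -` A \<inter> space circle_measure \<in> sets circle_measure" by simp
qed auto

lemma circle_integral_eq:
  fixes F :: "complex \<Rightarrow> complex"
  assumes F: "F \<in> borel_measurable borel" and c: "continuous_on {0..2*pi} (\<lambda>t. F (cis t))"
  shows "(LINT w|circle_measure. F w) = integral {0..2*pi} (\<lambda>t. F (cis t)) / (2 * pi)"
proof -
  note F[measurable]
  have "(LINT w|circle_measure. F w) = (LINT w|arc_measure. F w)"
    unfolding circle_measure_eq by (rule integral_completion) simp
  also have "\<dots> = (LINT t|uniform_measure lborel {0..<2*pi}. F (cis t))"
    unfolding arc_measure_def by (rule integral_distr) auto
  also have "\<dots> = (LINT t|lborel. (indicator {0..<2*pi} t / (2*pi)) *\<^sub>R F (cis t))"
    unfolding uniform_eq_density by (rule integral_density) (auto simp: indicator_def)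
  also have "\<dots> = (LINT t|lborel. (1/(2*pi)) *\<^sub>R (indicator {0..2*pi} t *\<^sub>R F (cis t)))"
  proof (rule integral_cong_AE)
    have "AE t in lborel. t \<noteq> 2*pi" by (rule AE_lborel_singleton)
    then show "AE t in lborel. (indicator {0..<2*pi} t / (2*pi)) *\<^sub>R F (cis t) =
      (1/(2*pi)) *\<^sub>R (indicator {0..2*pi} t *\<^sub>R F (cis t))"
      by eventually_elim (auto simp: indicator_def)
  qed auto
  also have "\<dots> = (1/(2*pi)) *\<^sub>R (LINT t:{0..2*pi}|lborel. F (cis t))"
    unfolding set_lebesgue_integral_def by (rule integral_scaleR_right)
  also have "(LINT t:{0..2*pi}|lborel. F (cis t)) = integral {0..2*pi} (\<lambda>t. F (cis t))"
    by (intro set_borel_integral_eq_integral borel_integrable_atLeastAtMost')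
      (use c in auto)
  finally show ?thesis by (simp add: scaleR_conv_of_real)
qed

lemma integral_cis_int:
  assumes "k \<noteq> 0"
  shows "integral {0..2*pi} (\<lambda>t. cis (of_int k * t)) = 0"
proof -
  have "((\<lambda>t. cis (of_int k * t)) has_integral
      (cis (of_int k * (2*pi)) / (\<i> * of_int k) - cis (of_int k * 0) / (\<i> * of_int k))) {0..2*pi}"
  proof (rule fundamental_theorem_of_calculus)
    fix x :: real
    have "((\<lambda>z. exp (\<i> * of_int k * z) / (\<i> * of_int k)) has_field_derivative exp (\<i> * of_int k * of_real x)) (at (of_real x))"
      using assms by (auto intro!: derivative_eq_intros)
    from has_vector_derivative_real_field[OF this, of "{0..2*pi}"]
    show "((\<lambda>t. cis (of_int k * t) / (\<i> * of_int k)) has_vector_derivative cis (of_int k * x)) (at x within {0..2*pi})"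
      by (simp add: cis_conv_exp mult.assoc)
  qed simp
  moreover have "cis (of_int k * (2*pi)) = 1"
    using cis_multiple_2pi[of "of_int k"] by (simp add: mult.commute mult.left_commute)
  ultimately show ?thesis by (simp add: integral_unique)
qed

lemma circle_orthonormal:
  "(LINT w|circle_measure. w ^ m * cnj (w ^ n)) = (if m = n then 1 else 0)"
proof -
  have e: "cis t ^ m * cnj (cis t ^ n) = cis (of_int (int m - int n) * t)" for t
    unfolding complex_cnj_power cis_cnj Complex.DeMoivre cis_mult by (simp add: algebra_simps)
  have "(LINT w|circle_measure. w ^ m * cnj (w ^ n))
      = integral {0..2*pi} (\<lambda>t. cis t ^ m * cnj (cis t ^ n)) / (2 * pi)"
    by (rule circle_integral_eq)
      (auto intro!: borel_measurable_continuous_onI continuous_intros)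
  also have "\<dots> = (if m = n then 1 else 0)"
    unfolding e using integral_cis_int[of "int m - int n"] by (auto simp: content_real scaleR_conv_of_real)
  finally show ?thesis .
qed

definition L2_circle :: "(complex \<Rightarrow> complex) \<Rightarrow> bool" where
  "L2_circle F \<longleftrightarrow> F \<in> borel_measurable circle_measure \<and> integrable circle_measure (\<lambda>w. (cmod (F w))\<^sup>2)"

abbreviation mean_square :: "(complex \<Rightarrow> complex) \<Rightarrow> real" where
  "mean_square F \<equiv> LINT w|circle_measure. (cmod (F w))\<^sup>2"

lemma L2_measurable: "L2_circle F \<Longrightarrow> F \<in> borel_measurable circle_measure"
  and L2_integrable: "L2_circle F \<Longrightarrow> integrable circle_measure (\<lambda>w. (cmod (F w))\<^sup>2)"
  by (auto simp: L2_circle_def)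

lemma L2_bounded_mult:
  assumes F: "L2_circle F" and m: "\<psi> \<in> borel_measurable circle_measure"
    and b: "AE w in circle_measure. cmod (\<psi> w) \<le> K"
  shows "L2_circle (\<lambda>w. \<psi> w * F w)"
    "mean_square (\<lambda>w. \<psi> w * F w) \<le> K\<^sup>2 * mean_square F"
proof -
  note [measurable] = m L2_measurable[OF F]
  have le: "AE w in circle_measure. (cmod (\<psi> w * F w))\<^sup>2 \<le> K\<^sup>2 * (cmod (F w))\<^sup>2"
    using b by eventually_elim (auto simp: norm_mult power_mult_distrib intro!: mult_right_mono power_mono)
  have i: "integrable circle_measure (\<lambda>w. K\<^sup>2 * (cmod (F w))\<^sup>2)"
    using L2_integrable[OF F] by simp
  have i2: "integrable circle_measure (\<lambda>w. (cmod (\<psi> w * F w))\<^sup>2)"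
    by (rule Bochner_Integration.integrable_bound[OF i]) (use le in auto)
  then show "L2_circle (\<lambda>w. \<psi> w * F w)" by (simp add: L2_circle_def)
  show "mean_square (\<lambda>w. \<psi> w * F w) \<le> K\<^sup>2 * mean_square F"
    using integral_mono_AE[OF i2 i le] by simp
qed

lemma L2_bounded:
  assumes m: "\<psi> \<in> borel_measurable circle_measure"
    and b: "AE w in circle_measure. cmod (\<psi> w) \<le> K"
  shows "L2_circle \<psi>"
proof -
  have "L2_circle (\<lambda>_. 1)" by (simp add: L2_circle_def)
  from L2_bounded_mult(1)[OF this m b] show ?thesis by simp
qed

lemma L2_AE_cong:
  assumes "L2_circle F" "AE w in circle_measure. F w = G w"
  shows "L2_circle G"
proof -
  have G: "G \<in> borel_measurable circle_measure"
    using measurable_AE_cong assms L2_measurable by blast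
  note [measurable] = G L2_measurable[OF assms(1)]
  have "integrable circle_measure (\<lambda>w. (cmod (F w))\<^sup>2) \<longleftrightarrow> integrable circle_measure (\<lambda>w. (cmod (G w))\<^sup>2)"
    by (rule integrable_cong_AE) (use assms(2) in auto)
  then show ?thesis using G assms(1) by (simp add: L2_circle_def)
qed

lemma L2_monom: "L2_circle (\<lambda>w. w ^ n)"
  by (rule L2_bounded[where K = 1])
    (use AE_circle_unit in \<open>auto simp: norm_power intro!: borel_measurable_circle\<close>)

text \<open>
  This takes the place of the Cauchy-Schwarz inequality: the free parameter makes the integral of a
  product small as soon as one factor is small in mean square.
\<close>

lemma product_bound:
  fixes a b e :: real assumes "e > 0" shows "a * b \<le> (e * a\<^sup>2 + b\<^sup>2 / e) / 2"
proof -
  have "0 \<le> (e * a - b)\<^sup>2 / e" using assms by simp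
  also have "\<dots> = e * a\<^sup>2 + b\<^sup>2 / e - 2 * a * b"
    using assms by (simp add: field_simps power2_eq_square)
  finally show ?thesis by simp
qed

lemma L2_prod:
  assumes "L2_circle F" "L2_circle G"
  shows "integrable circle_measure (\<lambda>w. F w * cnj (G w))"
    and "e > 0 \<Longrightarrow> cmod (LINT w|circle_measure. F w * cnj (G w)) \<le>
      (e * mean_square F + mean_square G / e) / 2"
proof -
  note [measurable] = L2_measurable[OF assms(1)] L2_measurable[OF assms(2)]
  have i: "integrable circle_measure (\<lambda>w. (e * (cmod (F w))\<^sup>2 + (cmod (G w))\<^sup>2 / e) / 2)" for e
    using L2_integrable[OF assms(1)] L2_integrable[OF assms(2)] by simp
  have [measurable]: "(\<lambda>w. cnj (G w)) \<in> borel_measurable circle_measure"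
    by (rule measurable_compose[OF L2_measurable[OF assms(2)]])
      (intro borel_measurable_continuous_onI continuous_intros)
  show int: "integrable circle_measure (\<lambda>w. F w * cnj (G w))"
  proof (rule Bochner_Integration.integrable_bound[OF i[of 1]])
    show "AE x in circle_measure. cmod (F x * cnj (G x)) \<le> norm ((1 * (cmod (F x))\<^sup>2 + (cmod (G x))\<^sup>2 / 1) / 2)"
      using product_bound[of 1 "cmod (F _)" "cmod (G _)"] by (auto simp: norm_mult)
  qed measurable
  assume e: "e > 0"
  have "cmod (LINT w|circle_measure. F w * cnj (G w)) \<le> (LINT w|circle_measure. cmod (F w * cnj (G w)))"
    by (rule integral_norm_bound)
  also have "\<dots> \<le> (LINT w|circle_measure. (e * (cmod (F w))\<^sup>2 + (cmod (G w))\<^sup>2 / e) / 2)"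
    by (rule integral_mono[OF integrable_norm[OF int] i]) (use product_bound[OF e] in \<open>auto simp: norm_mult\<close>)
  also have "\<dots> = (e * mean_square F + mean_square G / e) / 2"
    using L2_integrable[OF assms(1)] L2_integrable[OF assms(2)] by simp
  finally show "cmod (LINT w|circle_measure. F w * cnj (G w)) \<le>
      (e * mean_square F + mean_square G / e) / 2" .
qed

lemma L2_scale: "L2_circle F \<Longrightarrow> L2_circle (\<lambda>w. c * F w)"
  by (auto simp: L2_circle_def norm_mult power_mult_distrib)

lemma L2_add:
  assumes "L2_circle F" "L2_circle G" shows "L2_circle (\<lambda>w. F w + G w)"
proof -
  note [measurable] = L2_measurable[OF assms(1)] L2_measurable[OF assms(2)]
  have i: "integrable circle_measure (\<lambda>w. 2 * (cmod (F w))\<^sup>2 + 2 * (cmod (G w))\<^sup>2)"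
    using L2_integrable[OF assms(1)] L2_integrable[OF assms(2)] by simp
  have "(cmod (F w + G w))\<^sup>2 \<le> 2 * (cmod (F w))\<^sup>2 + 2 * (cmod (G w))\<^sup>2" for w
  proof -
    have "(cmod (F w + G w))\<^sup>2 \<le> (cmod (F w) + cmod (G w))\<^sup>2"
      by (intro power_mono norm_triangle_ineq) auto
    also have "\<dots> \<le> 2 * (cmod (F w))\<^sup>2 + 2 * (cmod (G w))\<^sup>2"
      using sum_squares_bound[of "cmod (F w)" "cmod (G w)"] by (simp add: power2_sum)
    finally show ?thesis .
  qed
  then have "integrable circle_measure (\<lambda>w. (cmod (F w + G w))\<^sup>2)"
    by (intro Bochner_Integration.integrable_bound[OF i]) (auto intro: order_trans[OF _ abs_ge_self])
  then show ?thesis by (simp add: L2_circle_def)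
qed

lemma L2_diff: "L2_circle F \<Longrightarrow> L2_circle G \<Longrightarrow> L2_circle (\<lambda>w. F w - G w)"
  using L2_add[of F "\<lambda>w. - 1 * G w"] L2_scale[of G "-1"] by simp

lemma L2_sum: "(\<And>i. i \<in> I \<Longrightarrow> L2_circle (F i)) \<Longrightarrow> L2_circle (\<lambda>w. \<Sum>i\<in>I. F i w)"
proof (induction I rule: infinite_finite_induct)
  case (insert x I) then show ?case by (simp add: L2_add)
qed (auto simp: L2_circle_def)

definition fourier :: "(complex \<Rightarrow> complex) \<Rightarrow> nat \<Rightarrow> complex" where
  "fourier F n = (LINT w|circle_measure. F w * cnj (w ^ n))"

lemma fourier_integrable: "L2_circle F \<Longrightarrow> integrable circle_measure (\<lambda>w. F w * cnj (w ^ n))"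
  by (rule L2_prod(1)[OF _ L2_monom])

lemma fourier_add: "L2_circle F \<Longrightarrow> L2_circle G \<Longrightarrow> fourier (\<lambda>w. F w + G w) n = fourier F n + fourier G n"
  using fourier_integrable[of F n] fourier_integrable[of G n] by (simp add: fourier_def distrib_right)

lemma fourier_diff: "L2_circle F \<Longrightarrow> L2_circle G \<Longrightarrow> fourier (\<lambda>w. F w - G w) n = fourier F n - fourier G n"
  using fourier_integrable[of F n] fourier_integrable[of G n] by (simp add: fourier_def left_diff_distrib)

lemma fourier_scale: "fourier (\<lambda>w. c * F w) n = c * fourier F n"
  by (simp add: fourier_def mult.assoc)

lemma fourier_monom: "fourier (\<lambda>w. w ^ m) n = (if m = n then 1 else 0)"
  unfolding fourier_def by (rule circle_orthonormal)

lemma fourier_sum: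
  "(\<And>i. i \<in> I \<Longrightarrow> L2_circle (F i)) \<Longrightarrow> fourier (\<lambda>w. \<Sum>i\<in>I. F i w) n = (\<Sum>i\<in>I. fourier (F i) n)"
proof (induction I rule: infinite_finite_induct)
  case (insert x I) then show ?case by (simp add: fourier_add L2_sum)
qed (auto simp: fourier_def)

lemma L2_circle_poly: "L2_circle (\<lambda>w. \<Sum>n<L. a n * w ^ n)"
  by (intro L2_sum L2_scale L2_monom)

lemma fourier_poly: "fourier (\<lambda>w. \<Sum>n<L. a n * w ^ n) n = (if n < L then a n else 0)"
  by (subst fourier_sum) (auto intro: L2_scale L2_monom simp: fourier_scale fourier_monom if_distrib cong: if_cong)

lemma fourier_AE_cong:
  assumes "L2_circle F" "AE w in circle_measure. F w = G w"
  shows "fourier F n = fourier G n"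
  unfolding fourier_def
proof (rule integral_cong_AE)
  show "(\<lambda>w. F w * cnj (w ^ n)) \<in> borel_measurable circle_measure"
    using fourier_integrable[OF assms(1)] by auto
  show "(\<lambda>w. G w * cnj (w ^ n)) \<in> borel_measurable circle_measure"
    using fourier_integrable[OF L2_AE_cong[OF assms]] by auto
  show "AE x in circle_measure. F x * cnj (x ^ n) = G x * cnj (x ^ n)"
    using assms(2) by eventually_elim simp
qed

lemma cmod_diff_squared: "(cmod (a - b))\<^sup>2 = (cmod a)\<^sup>2 - 2 * Re (a * cnj b) + (cmod b)\<^sup>2"
  unfolding cmod_power2 by (simp add: power2_eq_square algebra_simps)

lemma L2_norm_minus_projection:
  assumes F: "L2_circle F"
  shows "mean_square (\<lambda>w. F w - fourier F n * w ^ n)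
    = mean_square F - (cmod (fourier F n))\<^sup>2"
proof -
  let ?c = "fourier F n"
  have i1: "integrable circle_measure (\<lambda>w. cnj ?c * (F w * cnj (w ^ n)))"
    using fourier_integrable[OF F] by simp
  have i2: "integrable circle_measure (\<lambda>w. (cmod (F w))\<^sup>2)" by (rule L2_integrable[OF F])
  have pointwise: "AE w in circle_measure. (cmod (F w - ?c * w ^ n))\<^sup>2
      = (cmod (F w))\<^sup>2 - 2 * Re (cnj ?c * (F w * cnj (w ^ n))) + (cmod ?c)\<^sup>2"
    using AE_circle_unit
  proof eventually_elim
    case (elim w)
    have "(cmod (F w - ?c * w ^ n))\<^sup>2 = (cmod (F w))\<^sup>2 - 2 * Re (F w * cnj (?c * w ^ n)) + (cmod (?c * w ^ n))\<^sup>2"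
      by (rule cmod_diff_squared)
    then show ?case using elim by (simp add: norm_mult norm_power mult.assoc mult.left_commute)
  qed
  define u where "u = (\<lambda>w. Re (cnj ?c * (F w * cnj (w ^ n))))"
  have iu: "integrable circle_measure u"
    unfolding u_def by (rule integrable_Re[OF i1])
  from pointwise have "mean_square (\<lambda>w. F w - ?c * w ^ n)
      = (LINT w|circle_measure. (cmod (F w))\<^sup>2 - 2 * u w + (cmod ?c)\<^sup>2)"
    unfolding u_def[symmetric, THEN fun_cong]
    by (rule integral_cong_AE[rotated 2])
      (intro borel_measurable_add borel_measurable_diff borel_measurable_times borel_measurable_const
        borel_measurable_integrable[OF i2] borel_measurable_integrable[OF iu]
        borel_measurable_integrable[OF L2_integrable[OF L2_diff[OF F L2_scale[OF L2_monom, of ?c n]]]])+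
  also have "\<dots> = mean_square F - 2 * (LINT w|circle_measure. u w) + (cmod ?c)\<^sup>2"
    using i2 iu by simp
  also have "(LINT w|circle_measure. u w) = Re (cnj ?c * ?c)"
    unfolding u_def using integral_Re[OF i1] by (simp add: fourier_def)
  also have "Re (cnj ?c * ?c) = (cmod ?c)\<^sup>2"
    by (metis Re_complex_of_real complex_norm_square mult.commute)
  finally show ?thesis by simp
qed

text \<open>
  Frequencies are removed one at a time. Nonnegativity of the left-hand side is Bessel's inequality,
  and for a polynomial the left-hand side vanishes, which is Parseval's identity.
\<close>

lemma L2_norm_minus_partial_sum:
  assumes F: "L2_circle F"
  shows "mean_square (\<lambda>w. F w - (\<Sum>n<L. fourier F n * w ^ n))
    = mean_square F - (\<Sum>n<L. (cmod (fourier F n))\<^sup>2)"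
proof (induction L)
  case (Suc L)
  let ?G = "\<lambda>w. F w - (\<Sum>n<L. fourier F n * w ^ n)"
  have G: "L2_circle ?G" by (rule L2_diff[OF F L2_circle_poly])
  have "fourier ?G L = fourier F L" by (simp add: fourier_diff F L2_circle_poly fourier_poly)
  with L2_norm_minus_projection[OF G, of L] Suc show ?case by (simp add: algebra_simps)
qed simp

lemma Bessel:
  assumes F: "L2_circle F"
  shows "(\<Sum>n<L. (cmod (fourier F n))\<^sup>2) \<le> mean_square F"
proof -
  have "0 \<le> mean_square (\<lambda>w. F w - (\<Sum>n<L. fourier F n * w ^ n))" by simp
  then show ?thesis unfolding L2_norm_minus_partial_sum[OF F] by simp
qed

lemma L2_norm_poly:
  "mean_square (\<lambda>w. \<Sum>n<L. a n * w ^ n) = (\<Sum>n<L. (cmod (a n))\<^sup>2)"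
  using L2_norm_minus_partial_sum[OF L2_circle_poly, of a L L] by (simp add: fourier_poly)

lemma hardy2_borel: assumes f: "f \<in> hardy2" shows "f \<in> borel_measurable borel"
proof -
  have "(\<lambda>z. indicator (ball 0 1) z *\<^sub>R f z) \<in> borel_measurable borel"
    by (rule borel_measurable_continuous_on_indicator)
      (auto intro!: holomorphic_on_imp_continuous_on hardy2_holomorphic f)
  also have "(\<lambda>z. indicator (ball 0 1) z *\<^sub>R f z) = f"
    using hardy2_outside[OF f] by (auto simp: indicator_def fun_eq_iff)
  finally show ?thesis .
qed

text \<open>
  On a circle of radius less than 1 the Taylor series converges absolutely, so dominated convergence
  carries the facts about polynomials over to \<open>f\<close>.
\<close>

lemma dilation_L2:
  assumes f: "f \<in> hardy2" and r: "0 \<le> r" "r < 1"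
  shows "L2_circle (\<lambda>w. f (of_real r * w))"
    and "mean_square (\<lambda>w. f (of_real r * w)) \<le> (hardy2_norm f)\<^sup>2"
    and "fourier (\<lambda>w. f (of_real r * w)) n = taylor_coeff f n * of_real r ^ n"
proof -
  let ?a = "\<lambda>n. taylor_coeff f n * of_real r ^ n"
  let ?s = "\<lambda>L w. \<Sum>n<L. ?a n * w ^ n"
  have sm: "summable (\<lambda>n. cmod (?a n))"
    by (rule square_summable_power_summable[OF hardy2_summable[OF f]]) (use r in auto)
  define C where "C = (\<Sum>n. cmod (?a n))"
  have lt: "cmod (of_real r * w) < 1" if "cmod w = 1" for w using that r by (simp add: norm_mult)
  have lim: "AE w in circle_measure. (\<lambda>L. ?s L w) \<longlonglongrightarrow> f (of_real r * w)"
    using AE_circle_unit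
  proof eventually_elim
    case (elim w)
    from hardy2_sums[OF f lt[OF elim]] show ?case
      by (simp add: sums_def power_mult_distrib mult.assoc)
  qed
  have bd: "AE w in circle_measure. cmod (?s L w) \<le> C" for L
    using AE_circle_unit
  proof eventually_elim
    case (elim w)
    have "cmod (?s L w) \<le> (\<Sum>n<L. cmod (?a n * w ^ n))" by (rule norm_sum)
    also have "\<dots> = (\<Sum>n<L. cmod (?a n))" using elim by (simp add: norm_mult norm_power)
    also have "\<dots> \<le> C" unfolding C_def by (rule sum_le_suminf[OF sm]) auto
    finally show ?case .
  qed
  note [measurable] = hardy2_borel[OF f]
  have m [measurable]: "(\<lambda>w. f (of_real r * w)) \<in> borel_measurable circle_measure"
    by (rule borel_measurable_circle) measurable
  have ms [measurable]: "?s L \<in> borel_measurable circle_measure" for L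
    by (rule borel_measurable_circle) measurable
  have bf: "AE w in circle_measure. cmod (f (of_real r * w)) \<le> C"
  proof -
    have "AE w in circle_measure. \<forall>L. cmod (?s L w) \<le> C" using bd by (simp add: AE_all_countable)
    with lim show ?thesis
      by eventually_elim (rule tendsto_upperbound[OF tendsto_norm], auto)
  qed
  show L: "L2_circle (\<lambda>w. f (of_real r * w))" by (rule L2_bounded[OF m bf])
  have "(\<lambda>L. LINT w|circle_measure. (cmod (?s L w))\<^sup>2) \<longlonglongrightarrow> mean_square (\<lambda>w. f (of_real r * w))"
  proof (rule integral_dominated_convergence[where w = "\<lambda>_. C\<^sup>2"])
    show "AE w in circle_measure. (\<lambda>L. (cmod (?s L w))\<^sup>2) \<longlonglongrightarrow> (cmod (f (of_real r * w)))\<^sup>2"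
      using lim by eventually_elim (intro tendsto_intros)
    show "AE w in circle_measure. norm ((cmod (?s L w))\<^sup>2) \<le> C\<^sup>2" for L
      using bd[of L] by eventually_elim (auto intro: power_mono)
  qed auto
  then show "mean_square (\<lambda>w. f (of_real r * w)) \<le> (hardy2_norm f)\<^sup>2"
  proof (rule tendsto_upperbound)
    have "(\<Sum>n<L. (cmod (?a n))\<^sup>2) \<le> (hardy2_norm f)\<^sup>2" for L
    proof -
      have "(\<Sum>n<L. (cmod (?a n))\<^sup>2) \<le> (\<Sum>n<L. (cmod (taylor_coeff f n))\<^sup>2)"
        using r by (intro sum_mono power_mono) (auto simp: norm_mult norm_power power_le_one intro!: mult_left_le)
      also have "\<dots> \<le> (hardy2_norm f)\<^sup>2"
        unfolding hardy2_norm_square[OF f] by (rule sum_le_suminf[OF hardy2_summable[OF f]]) auto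
      finally show ?thesis .
    qed
    then show "\<forall>\<^sub>F L in sequentially. mean_square (?s L) \<le> (hardy2_norm f)\<^sup>2"
      unfolding L2_norm_poly by simp
  qed auto
  have "(\<lambda>L. LINT w|circle_measure. ?s L w * cnj (w ^ n)) \<longlonglongrightarrow> (LINT w|circle_measure. f (of_real r * w) * cnj (w ^ n))"
  proof (rule integral_dominated_convergence[where w = "\<lambda>_. C"])
    show "AE w in circle_measure. (\<lambda>L. ?s L w * cnj (w ^ n)) \<longlonglongrightarrow> f (of_real r * w) * cnj (w ^ n)"
      using lim by eventually_elim (intro tendsto_intros)
    show "AE w in circle_measure. norm (?s L w * cnj (w ^ n)) \<le> C" for L
      using bd[of L] AE_circle_unit by eventually_elim (auto simp: norm_mult norm_power)
    show "(\<lambda>w. f (of_real r * w) * cnj (w ^ n)) \<in> borel_measurable circle_measure"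
      using fourier_integrable[OF L] by auto
    show "(\<lambda>w. ?s L w * cnj (w ^ n)) \<in> borel_measurable circle_measure" for L
      using fourier_integrable[OF L2_circle_poly] by auto
  qed auto
  then have "(\<lambda>L. fourier (?s L) n) \<longlonglongrightarrow> fourier (\<lambda>w. f (of_real r * w)) n"
    by (simp add: fourier_def)
  moreover have "(\<lambda>L. fourier (?s L) n) \<longlonglongrightarrow> ?a n"
    by (rule tendsto_eventually) (auto simp: fourier_poly eventually_at_top_linorder intro!: exI[of _ "Suc n"])
  ultimately show "fourier (\<lambda>w. f (of_real r * w)) n = ?a n" by (rule LIMSEQ_unique)
qed

section \<open>The Poisson integral and the maximal function\<close>

lemma has_integral_reflect_shift:
  fixes k :: "real \<Rightarrow> 'a::euclidean_space"
  assumes "(k has_integral i) {c - b..c - a}" "a \<le> b"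
  shows "((\<lambda>t. k (c - t)) has_integral i) {a..b}"
proof -
  have "(\<lambda>x. - x + c) ` {c - b..c - a} = {a..b}"
  proof (intro equalityI subsetI)
    fix x assume "x \<in> {a..b}"
    then show "x \<in> (\<lambda>x. - x + c) ` {c - b..c - a}" by (intro image_eqI[of _ _ "c - x"]) auto
  qed auto
  then show ?thesis
    using has_integral_affinity[of k i "c - b" "c - a" "-1" c] assms by simp
qed

lemma has_integral_shift:
  fixes k :: "real \<Rightarrow> 'a::euclidean_space"
  assumes "(k has_integral i) {c + a..c + b}" "a \<le> b"
  shows "((\<lambda>t. k (c + t)) has_integral i) {a..b}"
proof -
  have "(\<lambda>x. x - c) ` {c + a..c + b} = {a..b}"
  proof (intro equalityI subsetI)
    fix x assume "x \<in> {a..b}"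
    then show "x \<in> (\<lambda>x. x - c) ` {c + a..c + b}" by (intro image_eqI[of _ _ "c + x"]) auto
  qed auto
  then show ?thesis
    using has_integral_affinity[of k i "c + a" "c + b" 1 c] assms by (simp add: add.commute)
qed

lemma integral_fold:
  fixes k :: "real \<Rightarrow> real"
  assumes k: "continuous_on {0..2 * b} k" and b: "0 \<le> b"
  shows "integral {0..2 * b} k = integral {0..b} (\<lambda>t. k t + k (2 * b - t))"
proof -
  have i: "k integrable_on {0..2 * b}" "k integrable_on {0..b}" "k integrable_on {b..2 * b}"
    using b by (auto intro!: integrable_continuous_interval continuous_on_subset[OF k])
  have "((\<lambda>t. k (2 * b - t)) has_integral integral {b..2 * b} k) {0..b}"
    by (rule has_integral_reflect_shift) (use i b in \<open>auto intro: integrable_integral\<close>)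
  from has_integral_add[OF integrable_integral[OF i(2)] this] show ?thesis
    using Henstock_Kurzweil_Integration.integral_combine[OF _ _ i(1), of b] b
    by (simp add: integral_unique)
qed

text \<open>
  Each point of \<open>E\<close> is the centre of an interval on which the mean of \<open>g\<close> exceeds \<open>\<tau>\<close>. By the Vitali
  covering lemma some of these intervals are disjoint and cover \<open>E\<close> after enlargement by the factor 5.
  Disjointness bounds their total length by the integral of \<open>g\<close> divided by \<open>\<tau>\<close>.
\<close>

lemma Hardy_Littlewood_weak_type:
  fixes g :: "real \<Rightarrow> real"
  assumes g: "continuous_on UNIV g" "\<And>t. g t \<ge> 0" and \<tau>: "\<tau> > 0"
    and E: "E \<in> sets borel" "E \<subseteq> {a..b}"
    and h: "\<And>t. t \<in> E \<Longrightarrow> \<exists>h. 0 < h \<and> h \<le> H \<and> 2 * h * \<tau> < integral {t - h..t + h} g"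
  shows "measure lborel E \<le> 5 / \<tau> * integral {a - H..b + H} g"
proof -
  have int: "g integrable_on {x..y}" for x y
    using g(1) by (intro integrable_continuous_interval continuous_on_subset[OF g(1)]) auto
  obtain h where h: "\<And>t. t \<in> E \<Longrightarrow> 0 < h t \<and> h t \<le> H" "\<And>t. t \<in> E \<Longrightarrow> 2 * h t * \<tau> < integral {t - h t..t + h t} g"
    using h by metis
  obtain C where C: "countable C" "C \<subseteq> E"
     "pairwise (\<lambda>i j. disjnt (cball i (h i)) (cball j (h j))) C"
     "E \<subseteq> (\<Union>i\<in>C. cball i (5 * h i))"
  proof (rule Vitali_covering_lemma_cballs[where S = E and K = E and a = "\<lambda>t::real. t" and r = h and B = H])
    show "E \<subseteq> (\<Union>i\<in>E. cball i (h i))"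
    proof
      fix t assume "t \<in> E"
      then show "t \<in> (\<Union>i\<in>E. cball i (h i))" using h(1)[of t] by (intro UN_I[of t]) auto
    qed
  qed (use h in auto)
  let ?A = "\<lambda>i. cball i (5 * h i)"
  let ?J = "\<lambda>i. {i - h i..i + h i}"
  have Af: "?A i \<in> fmeasurable lborel" for i
    by (rule fmeasurableI) (use emeasure_bounded_finite[OF bounded_cball] in auto)
  have bound: "measure lborel (\<Union>i\<in>I. ?A i) \<le> 5 / \<tau> * integral {a - H..b + H} g"
    if I: "I \<subseteq> C" "finite I" for I
  proof -
    have IE: "I \<subseteq> E" using I(1) C(2) by (rule order_trans)
    have "measure lborel (\<Union>i\<in>I. ?A i) \<le> (\<Sum>i\<in>I. measure lborel (?A i))"
      by (rule measure_UNION_le) (use I in auto)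
    also have "\<dots> = (\<Sum>i\<in>I. 10 * h i)"
    proof (intro sum.cong refl)
      fix i assume "i \<in> I"
      then have "0 < h i" using h IE by blast
      then show "measure lborel (?A i) = 10 * h i" by (simp add: cball_eq_atLeastAtMost)
    qed
    also have "\<dots> \<le> (\<Sum>i\<in>I. 5 / \<tau> * integral (?J i) g)"
    proof (intro sum_mono)
      fix i assume "i \<in> I"
      then have "2 * h i * \<tau> < integral (?J i) g" using h IE by blast
      then show "10 * h i \<le> 5 / \<tau> * integral (?J i) g" using \<tau> by (simp add: field_simps)
    qed
    also have "\<dots> = 5 / \<tau> * (\<Sum>i\<in>I. integral (?J i) g)" by (simp add: sum_distrib_left)
    also have "\<dots> \<le> 5 / \<tau> * integral {a - H..b + H} g"
    proof (rule mult_left_mono)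
      have U: "(g has_integral (\<Sum>i\<in>I. integral (?J i) g)) (\<Union>i\<in>I. ?J i)"
      proof (rule has_integral_UN)
        show "pairwise (\<lambda>i i'. negligible (?J i \<inter> ?J i')) I"
        proof (rule pairwise_mono[OF C(3) _ I(1)])
          fix i j assume "disjnt (cball i (h i)) (cball j (h j))"
          then show "negligible (?J i \<inter> ?J j)"
            by (simp add: cball_eq_atLeastAtMost disjnt_def)
        qed
      qed (use I int in \<open>auto intro: integrable_integral\<close>)
      have "(\<Sum>i\<in>I. integral (?J i) g) = integral (\<Union>i\<in>I. ?J i) g"
        using U by (simp add: integral_unique)
      also have "\<dots> \<le> integral {a - H..b + H} g"
      proof (rule integral_subset_le)
        show "(\<Union>i\<in>I. ?J i) \<subseteq> {a - H..b + H}"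
          using IE E(2) h(1) by fastforce
      qed (use U int g in \<open>auto simp: has_integral_integrable\<close>)
      finally show "(\<Sum>i\<in>I. integral (?J i) g) \<le> integral {a - H..b + H} g" .
    qed (use \<tau> in simp)
    finally show ?thesis .
  qed
  have "measure lborel E \<le> measure lborel (\<Union>i\<in>C. ?A i)"
    by (rule measure_mono_fmeasurable[OF C(4)])
      (use E fmeasurable_UN_bound[OF C(1) Af bound] in auto)
  also have "\<dots> \<le> 5 / \<tau> * integral {a - H..b + H} g"
    by (rule measure_UN_bound[OF C(1) Af bound])
  finally show ?thesis .
qed

definition poisson_kernel :: "real \<Rightarrow> real \<Rightarrow> real" where
  "poisson_kernel r t = (1 - r\<^sup>2) / (1 - 2 * r * cos t + r\<^sup>2)"

lemma poisson_denominator: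
  fixes r t :: real
  assumes "0 \<le> r" "r < 1"
  shows "1 - 2 * r * cos t + r\<^sup>2 > 0"
proof -
  have "0 < (1 - r)\<^sup>2" using assms by (intro zero_less_power) simp
  also have "\<dots> = 1 - 2 * r + r\<^sup>2" by (simp add: power2_eq_square algebra_simps)
  also have "\<dots> \<le> 1 - 2 * r * cos t + r\<^sup>2" using assms by (simp add: mult_left_le)
  finally show ?thesis .
qed

lemma poisson_kernel_nonneg: "0 \<le> r \<Longrightarrow> r < 1 \<Longrightarrow> poisson_kernel r t \<ge> 0"
  using poisson_denominator[of r t] unfolding poisson_kernel_def
  by (intro divide_nonneg_nonneg) (auto simp: power_le_one)

lemma continuous_poisson_kernel: "0 \<le> r \<Longrightarrow> r < 1 \<Longrightarrow> continuous_on S (poisson_kernel r)"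
  unfolding poisson_kernel_def
  by (intro continuous_intros) (use poisson_denominator in \<open>auto simp: less_imp_neq[symmetric]\<close>)

text \<open>
  This is Cauchy's integral formula at \<open>r\<close> for \<open>f(u) (1 - r\<^sup>2) / (1 - r u)\<close>, which agrees with \<open>f\<close> at
  \<open>r\<close>. On the circle the additional factor turns the Cauchy kernel into the Poisson kernel.
\<close>

lemma poisson_representation:
  fixes f :: "complex \<Rightarrow> complex"
  assumes f: "f holomorphic_on cball 0 1" and r: "0 \<le> r" "r < 1"
  shows "((\<lambda>t. of_real (poisson_kernel r t) * f (cis t)) has_integral 2 * pi * f (of_real r)) {0..2*pi}"
proof -
  let ?r = "complex_of_real r"
  define F where "F u = f u * (1 - ?r\<^sup>2) / (1 - ?r * u)" for u
  have nz: "1 - ?r * u \<noteq> 0" if "cmod u \<le> 1" for u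
  proof
    assume "1 - ?r * u = 0"
    then have "cmod (?r * u) = 1" by (metis eq_iff_diff_eq_0 norm_one)
    moreover have "cmod (?r * u) \<le> r" using that r by (simp add: norm_mult mult_left_le)
    ultimately show False using r by simp
  qed
  have "F holomorphic_on cball 0 1"
    unfolding F_def by (intro holomorphic_intros f) (use nz in auto)
  from Cauchy_integral_circlepath_simple[OF this, of ?r] r
  have "((\<lambda>u. F u / (u - ?r)) has_contour_integral (2 * pi * \<i> * F ?r)) (part_circlepath 0 1 0 (2*pi))"
    by (simp add: circlepath_def)
  then have "((\<lambda>t. F (cis t) / (cis t - ?r) * \<i> * cis t) has_integral (2 * pi * \<i> * F ?r)) {0..2*pi}"
    by (subst (asm) has_contour_integral_part_circlepath_iff) auto
  from has_integral_mult_right[OF this, of "- \<i>"]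
  have *: "((\<lambda>t. F (cis t) / (cis t - ?r) * cis t) has_integral (2 * pi * F ?r)) {0..2*pi}"
    by (simp add: mult.assoc mult.left_commute)
  have e1: "F ?r = f ?r"
  proof -
    have "1 - ?r * ?r \<noteq> 0" using nz[of ?r] r by auto
    then show ?thesis by (simp add: F_def power2_eq_square)
  qed
  have e2: "F (cis t) / (cis t - ?r) * cis t = of_real (poisson_kernel r t) * f (cis t)" for t
  proof -
    have c: "cis t \<noteq> 0" by simp
    have sum: "cis t + cis (- t) = of_real (2 * cos t)" and prod: "cis t * cis (- t) = 1"
      by (simp_all add: complex_eq_iff cis_mult)
    have "cis t * (1 - ?r * cis (- t)) = cis t - ?r" using prod by (simp add: algebra_simps)
    then have "(1 - ?r * cis t) * (cis t - ?r) = cis t * ((1 - ?r * cis t) * (1 - ?r * cis (- t)))"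
      by (simp add: mult.left_commute)
    also have "(1 - ?r * cis t) * (1 - ?r * cis (- t))
        = 1 - ?r * (cis t + cis (- t)) + ?r\<^sup>2 * (cis t * cis (- t))"
      by (simp add: algebra_simps power2_eq_square)
    also have "\<dots> = of_real (1 - 2 * r * cos t + r\<^sup>2)"
      unfolding sum prod by simp
    finally have d: "(1 - ?r * cis t) * (cis t - ?r) = cis t * of_real (1 - 2 * r * cos t + r\<^sup>2)" .
    have "F (cis t) / (cis t - ?r) * cis t = f (cis t) * (1 - ?r\<^sup>2) * cis t / ((1 - ?r * cis t) * (cis t - ?r))"
      by (simp add: F_def)
    also have "\<dots> = f (cis t) * (1 - ?r\<^sup>2) / of_real (1 - 2 * r * cos t + r\<^sup>2)"
      unfolding d using c by simp
    also have "\<dots> = of_real (poisson_kernel r t) * f (cis t)"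
      by (simp add: poisson_kernel_def)
    finally show ?thesis .
  qed
  show ?thesis using * unfolding e1 e2 .
qed

text \<open>
  The Poisson kernel \<open>P\<close> decreases on \<open>[0, \<pi>]\<close>. By the second mean value theorem its integral against
  \<open>k(t) = 2 \<tau> - g(a + t) - g(a - t)\<close> is a combination, with nonnegative weights, of integrals of \<open>k\<close>
  over two intervals \<open>[0, c]\<close> and \<open>[0, \<pi>]\<close>, and these are nonnegative by the hypothesis on the means
  of \<open>g\<close>. As \<open>P\<close> has integral \<open>\<pi>\<close> over \<open>[0, \<pi>]\<close>, the Poisson integral of \<open>g\<close> is at most \<open>\<tau>\<close>.
\<close>

lemma poisson_le_maximal:
  fixes f :: "complex \<Rightarrow> complex"
  assumes f: "f holomorphic_on cball 0 1" and r: "0 \<le> r" "r < 1"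
    and avg: "\<And>h. 0 < h \<Longrightarrow> h \<le> pi \<Longrightarrow> integral {a - h..a + h} (\<lambda>t. cmod (f (cis t))) \<le> 2 * h * \<tau>"
  shows "cmod (f (of_real r * cis a)) \<le> \<tau>"
proof -
  let ?P = "poisson_kernel r"
  define g where "g t = cmod (f (cis t))" for t
  have cg: "continuous_on UNIV g"
    unfolding g_def
    by (intro continuous_intros continuous_on_compose2[OF holomorphic_on_imp_continuous_on[OF f]]) auto
  then have cg': "continuous_on S g" for S using continuous_on_subset by blast
  have gper: "g (t + 2 * pi) = g t" for t by (simp add: g_def flip: cis_mult)
  have Psym: "?P (2 * pi - t) = ?P t" for t by (simp add: poisson_kernel_def cos_diff)
  have hol: "(\<lambda>u. f (cis a * u)) holomorphic_on cball 0 1"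
    by (rule holomorphic_on_compose_gen[OF _ f, unfolded o_def])
      (auto intro!: holomorphic_intros simp: norm_mult)
  have "2 * pi * cmod (f (of_real r * cis a)) = cmod (2 * pi * f (cis a * of_real r))"
    by (simp add: norm_mult mult.commute)
  also have "2 * pi * f (cis a * of_real r) = integral {0..2*pi} (\<lambda>t. of_real (?P t) * f (cis a * cis t))"
    using poisson_representation[OF hol r] by (simp add: integral_unique)
  also have "cmod \<dots> \<le> integral {0..2*pi} (\<lambda>t. ?P t * g (a + t))"
  proof (rule integral_norm_bound_integral)
    show "(\<lambda>t. of_real (?P t) * f (cis a * cis t)) integrable_on {0..2*pi}"
      using poisson_representation[OF hol r] by blast
    show "(\<lambda>t. ?P t * g (a + t)) integrable_on {0..2*pi}"
      by (intro integrable_continuous_interval continuous_intros continuous_poisson_kernel r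
          continuous_on_compose2[OF cg]) auto
  qed (use r in \<open>auto simp: norm_mult g_def cis_mult poisson_kernel_nonneg\<close>)
  also have "\<dots> = integral {0..pi} (\<lambda>t. ?P t * (g (a + t) + g (a - t)))"
  proof -
    have "g (a + (2 * pi - t)) = g (a - t)" for t using gper[of "a - t"] by (simp add: algebra_simps)
    then show ?thesis
      by (subst integral_fold)
        (auto simp: Psym distrib_left intro!: continuous_intros continuous_poisson_kernel r continuous_on_compose2[OF cg])
  qed
  also have "\<dots> \<le> integral {0..pi} (\<lambda>t. ?P t * (2 * \<tau>))"
  proof -
    define k where "k t = 2 * \<tau> - (g (a + t) + g (a - t))" for t
    have ck: "continuous_on S k" for S
      unfolding k_def by (intro continuous_intros continuous_on_compose2[OF cg]) auto
    have ik: "k integrable_on {x..y}" for x y by (intro integrable_continuous_interval ck)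
    have D: "integral {0..c} k \<ge> 0" if c: "0 \<le> c" "c \<le> pi" for c
    proof (cases "c = 0")
      case False
      have ig: "g integrable_on {x..y}" for x y by (intro integrable_continuous_interval cg')
      have "((\<lambda>t. g (a + t)) has_integral integral {a..a + c} g) {0..c}"
        by (rule has_integral_shift) (use ig c in \<open>auto intro: integrable_integral\<close>)
      moreover have "((\<lambda>t. g (a - t)) has_integral integral {a - c..a} g) {0..c}"
        by (rule has_integral_reflect_shift) (use ig c in \<open>auto intro: integrable_integral\<close>)
      ultimately have "((\<lambda>t. g (a + t) + g (a - t)) has_integral
          (integral {a..a + c} g + integral {a - c..a} g)) {0..c}"
        by (rule has_integral_add)
      also have "integral {a..a + c} g + integral {a - c..a} g = integral {a - c..a + c} g"
        using Henstock_Kurzweil_Integration.integral_combine[OF _ _ ig, of "a - c" a "a + c"] c by simp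
      finally have "((\<lambda>t. g (a + t) + g (a - t)) has_integral integral {a - c..a + c} g) {0..c}" .
      from has_integral_diff[OF has_integral_const_real[of "2 * \<tau>" 0 c] this]
      have "(k has_integral (2 * \<tau> * c - integral {a - c..a + c} g)) {0..c}"
        using c by (simp add: k_def[abs_def] mult.commute)
      then show ?thesis using avg[of c] c False by (simp add: integral_unique g_def[abs_def] mult_ac)
    qed simp
    obtain c where c: "c \<in> {0..pi}" and I: "((\<lambda>t. - ?P t * k t) has_integral
        (- ?P 0 * integral {0..c} k + - ?P pi * integral {c..pi} k)) {0..pi}"
    proof (rule second_mean_value_theorem_full[of k 0 pi "\<lambda>t. - ?P t"])
      fix x y :: real assume xy: "0 \<le> x" "x \<le> y" "y \<le> pi"
      have "cos y \<le> cos x" using xy by (intro cos_monotone_0_pi_le) auto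
      then have "?P y \<le> ?P x" unfolding poisson_kernel_def using r poisson_denominator[OF r]
        by (intro divide_left_mono mult_pos_pos) (auto simp: power_le_one mult_left_mono)
      then show "- ?P x \<le> - ?P y" by simp
    qed (use ik in auto)
    have P0: "?P pi \<le> ?P 0" unfolding poisson_kernel_def using r poisson_denominator[OF r, of 0] poisson_denominator[OF r, of pi]
        by (intro divide_left_mono mult_pos_pos) (auto simp: power_le_one)
    have "integral {0..c} k + integral {c..pi} k = integral {0..pi} k"
      using c ik by (intro Henstock_Kurzweil_Integration.integral_combine) auto
    then have "?P 0 * integral {0..c} k + ?P pi * integral {c..pi} k
       = (?P 0 - ?P pi) * integral {0..c} k + ?P pi * integral {0..pi} k"
      by (simp add: algebra_simps flip: distrib_left)
    moreover have "\<dots> \<ge> 0"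
      using D[of c] D[of pi] c P0 poisson_kernel_nonneg[OF r] by (intro add_nonneg_nonneg mult_nonneg_nonneg) auto
    ultimately have nn: "integral {0..pi} (\<lambda>t. ?P t * k t) \<ge> 0"
      using integral_unique[OF I] by simp
    have "integral {0..pi} (\<lambda>t. ?P t * (2 * \<tau>)) - integral {0..pi} (\<lambda>t. ?P t * (g (a + t) + g (a - t)))
        = integral {0..pi} (\<lambda>t. ?P t * (2 * \<tau>) - ?P t * (g (a + t) + g (a - t)))"
      by (intro Henstock_Kurzweil_Integration.integral_diff[symmetric] integrable_continuous_interval continuous_intros
          continuous_poisson_kernel r continuous_on_compose2[OF cg]) auto
    also have "\<dots> = integral {0..pi} (\<lambda>t. ?P t * k t)" by (simp add: k_def algebra_simps)
    finally show ?thesis using nn by simp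
  qed
  also have "\<dots> = 2 * pi * \<tau>"
  proof -
    have full: "(?P has_integral 2 * pi) {0..2*pi}"
    proof -
      have "((\<lambda>t. complex_of_real (?P t) * 1) has_integral (2 * pi * 1)) {0..2*pi}"
        using poisson_representation[OF holomorphic_on_const r, of 1] by simp
      from has_integral_linear[OF this bounded_linear_Re] show ?thesis by (simp add: o_def)
    qed
    have "integral {0..2*pi} ?P = integral {0..pi} (\<lambda>t. ?P t + ?P (2 * pi - t))"
      by (rule integral_fold) (auto intro: continuous_poisson_kernel r)
    then have "integral {0..pi} ?P = pi" using full by (simp add: Psym integral_unique)
    then show ?thesis by simp
  qed
  finally show ?thesis by simp
qed

section \<open>Radial limits\<close>

lemma measure_circle_eq:
  assumes B: "B \<in> sets borel"
  shows "measure circle_measure B = measure lborel ({0..<2*pi} \<inter> cis -` B) / (2 * pi)"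
proof -
  have B': "cis -` B \<in> sets borel" using measurable_sets[OF measurable_cis B] by simp
  have "measure circle_measure B = measure arc_measure B"
    unfolding circle_measure_eq using B by (intro measure_completion) simp
  also have "\<dots> = measure (uniform_measure lborel {0..<2*pi}) (cis -` B)"
    unfolding arc_measure_def using B by (subst measure_distr) auto
  also have "\<dots> = measure lborel ({0..<2*pi} \<inter> cis -` B) / (2 * pi)"
    using B' by (subst measure_uniform_measure) auto
  finally show ?thesis .
qed

text \<open>
  A superlevel set of the radial maximal function, truncated at radius \<open>s\<close>. For \<open>s < 1\<close> it concerns a
  dilation of \<open>f\<close>, which is analytic across the circle.
\<close>

definition superlevel :: "(complex \<Rightarrow> complex) \<Rightarrow> real \<Rightarrow> real \<Rightarrow> complex set" where
  "superlevel f \<tau> s = {w. \<exists>r\<in>{0<..<s}. \<tau> < cmod (f (of_real r * w))}"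

lemma open_superlevel:
  assumes f: "f \<in> hardy2" and \<tau>: "\<tau> > 0"
  shows "open (superlevel f \<tau> s)"
proof -
  have c: "continuous_on (ball 0 1) (\<lambda>z. cmod (f z))"
    by (intro continuous_intros holomorphic_on_imp_continuous_on hardy2_holomorphic f)
  have "open (ball 0 1 \<inter> (\<lambda>z. cmod (f z)) -` {\<tau><..})"
    using continuous_open_preimage[OF c open_ball open_greaterThan] .
  moreover have "ball 0 1 \<inter> (\<lambda>z. cmod (f z)) -` {\<tau><..} = {z. \<tau> < cmod (f z)}" (is "_ = ?U")
  proof -
    have "cmod z < 1" if "\<tau> < cmod (f z)" for z
      using hardy2_outside[OF f, of z] \<tau> that by (cases "cmod z < 1") auto
    then show ?thesis by auto
  qed
  ultimately have U: "open ?U" by simp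
  have "open ((\<lambda>w. of_real r * w) -` ?U)" for r :: real
    by (rule open_vimage[OF U]) (intro continuous_intros)
  moreover have "superlevel f \<tau> s = (\<Union>r\<in>{0<..<s}. (\<lambda>w. of_real r * w) -` ?U)"
    by (auto simp: superlevel_def)
  ultimately show ?thesis by auto
qed

lemma integral_two_periods:
  fixes g :: "real \<Rightarrow> real"
  assumes g: "continuous_on UNIV g" and per: "\<And>t. g (t + 2 * pi) = g t"
  shows "integral {0 - pi..2 * pi + pi} g = 2 * integral {0..2 * pi} g"
proof -
  have ig: "g integrable_on {x..y}" for x y
    by (intro integrable_continuous_interval continuous_on_subset[OF g]) auto
  have shift: "integral {x..y} g = integral {2*pi + x..2*pi + y} g" if "x \<le> y" for x y
    using has_integral_shift[OF integrable_integral[OF ig] that, of "2*pi"] per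
    by (simp add: integral_unique add.commute)
  have "integral {-pi..0} g = integral {pi..2*pi} g" "integral {0..pi} g = integral {2*pi..3*pi} g"
    using shift[of "-pi" 0] shift[of 0 pi] by (simp_all add: algebra_simps)
  moreover have "integral {-pi..3*pi} g = integral {-pi..0} g + integral {0..3*pi} g"
    "integral {0..3*pi} g = integral {0..2*pi} g + integral {2*pi..3*pi} g"
    "integral {0..2*pi} g = integral {0..pi} g + integral {pi..2*pi} g"
    using Henstock_Kurzweil_Integration.integral_combine[OF _ _ ig] by simp_all
  ultimately show ?thesis by simp
qed

text \<open>
  Put \<open>g(t) = \<bar>f(s e\<^sup>i\<^sup>t)\<bar>\<close>. If all means of \<open>g\<close> over intervals centred at \<open>a\<close> were at most \<open>\<tau>\<close>, then
  the Poisson bound would exclude \<open>e\<^sup>i\<^sup>a\<close> from the set. Hence the weak type inequality applies, and the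
  integral of \<open>g\<close> that appears in it is controlled by the norm of \<open>f\<close>.
\<close>

lemma maximal_inequality_inner:
  assumes f: "f \<in> hardy2" and s: "0 < s" "s < 1" and \<tau>: "\<tau> > 0" and d: "hardy2_norm f \<le> d" "d > 0"
  shows "measure circle_measure (superlevel f \<tau> s) \<le> 10 * d / \<tau>"
proof -
  define F where "F z = f (of_real s * z)" for z
  have "s * cmod z < 1" if "cmod z \<le> 1" for z
    using mult_left_le[OF that, of s] s by linarith
  then have F: "F holomorphic_on cball 0 1"
    unfolding F_def
    by (intro holomorphic_on_compose_gen[OF _ hardy2_holomorphic[OF f], unfolded o_def])
      (use s in \<open>auto intro!: holomorphic_intros simp: norm_mult\<close>)
  define g where "g t = cmod (F (cis t))" for t
  have cF: "continuous_on UNIV (\<lambda>t. F (cis t))"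
    by (intro continuous_intros continuous_on_compose2[OF holomorphic_on_imp_continuous_on[OF F]]) auto
  have cg: "continuous_on UNIV g"
    unfolding g_def by (intro continuous_intros cF)
  have cg': "continuous_on S g" for S using cg continuous_on_subset by blast
  have gper: "g (t + 2 * pi) = g t" for t by (simp add: g_def flip: cis_mult)
  let ?B = "superlevel f \<tau> s"
  have B: "?B \<in> sets borel" using open_superlevel[OF f \<tau>] by simp
  let ?E = "{0..<2*pi} \<inter> cis -` ?B"
  have "measure lborel ?E \<le> 5 / \<tau> * integral {0 - pi..2 * pi + pi} g"
  proof (rule Hardy_Littlewood_weak_type[OF cg])
    show "0 \<le> g t" for t by (simp add: g_def)
    show "?E \<in> sets borel" using measurable_sets[OF measurable_cis B] by auto
    show "?E \<subseteq> {0..2*pi}" by auto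
    show "\<exists>h>0. h \<le> pi \<and> 2 * h * \<tau> < integral {t - h..t + h} g" if t: "t \<in> ?E" for t
    proof (rule ccontr)
      assume no: "\<not> (\<exists>h>0. h \<le> pi \<and> 2 * h * \<tau> < integral {t - h..t + h} g)"
      obtain r where r: "0 < r" "r < s" "\<tau> < cmod (f (of_real r * cis t))"
        using t by (auto simp: superlevel_def)
      have "cmod (F (of_real (r / s) * cis t)) \<le> \<tau>"
        by (rule poisson_le_maximal[OF F]) (use r s no in \<open>auto simp: g_def[abs_def] not_less\<close>)
      then show False using r s by (simp add: F_def)
    qed
  qed (use \<tau> in auto)
  also have "\<dots> = 10 / \<tau> * integral {0..2*pi} g"
    using integral_two_periods[OF cg gper] by simp
  finally have weak: "measure lborel ?E \<le> 10 / \<tau> * integral {0..2*pi} g" .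
  have "integral {0..2*pi} g \<le> 2 * pi * d"
  proof -
    have [measurable]: "f \<in> borel_measurable borel" by (rule hardy2_borel[OF f])
    have ig2: "(\<lambda>t. (g t)\<^sup>2) integrable_on {0..2*pi}"
      by (intro integrable_continuous_interval continuous_intros cg')
    have "integral {0..2*pi} g \<le> integral {0..2*pi} (\<lambda>t. (1 / d) / 2 * (g t)\<^sup>2 + d / 2)"
    proof (rule integral_le)
      show "g t \<le> (1 / d) / 2 * (g t)\<^sup>2 + d / 2" for t
        using product_bound[of "1 / d" "g t" 1] d(2) by (simp add: field_simps)
    qed (intro integrable_continuous_interval continuous_intros cg')+
    also have "\<dots> = (1 / d) / 2 * integral {0..2*pi} (\<lambda>t. (g t)\<^sup>2) + pi * d"
      using d(2) by (subst Henstock_Kurzweil_Integration.integral_add)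
        (auto intro!: integrable_continuous_interval continuous_intros cg')
    finally have split: "integral {0..2*pi} g \<le> (1 / d) / 2 * integral {0..2*pi} (\<lambda>t. (g t)\<^sup>2) + pi * d" .
    have "integral {0..2*pi} (\<lambda>t. (g t)\<^sup>2) \<le> 2 * pi * d\<^sup>2"
    proof -
      have "(LINT w|circle_measure. complex_of_real ((cmod (F w))\<^sup>2)) =
          integral {0..2*pi} (\<lambda>t. complex_of_real ((g t)\<^sup>2)) / (2 * pi)"
        unfolding g_def
        by (rule circle_integral_eq)
          (auto simp: F_def[abs_def] intro!: continuous_intros continuous_on_subset[OF cF[unfolded F_def]])
      also have "integral {0..2*pi} (\<lambda>t. complex_of_real ((g t)\<^sup>2)) = of_real (integral {0..2*pi} (\<lambda>t. (g t)\<^sup>2))"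
        using has_integral_linear[OF integrable_integral[OF ig2] bounded_linear_of_real]
        by (intro integral_unique) (simp add: o_def)
      finally have "complex_of_real (mean_square F) = of_real (integral {0..2*pi} (\<lambda>t. (g t)\<^sup>2) / (2 * pi))"
        by (simp add: integral_complex_of_real[symmetric])
      then have "mean_square F = integral {0..2*pi} (\<lambda>t. (g t)\<^sup>2) / (2 * pi)"
        using of_real_eq_iff by blast
      moreover have "mean_square F \<le> d\<^sup>2"
        using dilation_L2(2)[OF f, of s] s power_mono[OF d(1) hardy2_norm_nonneg[OF f], of 2] by (simp add: F_def)
      ultimately have "integral {0..2*pi} (\<lambda>t. (g t)\<^sup>2) / (2 * pi) \<le> d\<^sup>2" by simp
      then show ?thesis by (simp add: divide_le_eq mult.commute)
    qed
    then have "(1 / d) / 2 * integral {0..2*pi} (\<lambda>t. (g t)\<^sup>2) \<le> (1 / d) / 2 * (2 * pi * d\<^sup>2)"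
      using d(2) by (intro mult_left_mono) auto
    also have "\<dots> = pi * d" using d(2) by (simp add: power2_eq_square)
    finally show ?thesis using split by simp
  qed
  then have "measure lborel ?E \<le> 10 / \<tau> * (2 * pi * d)"
    using \<tau> by (intro order_trans[OF weak] mult_left_mono) auto
  then have "measure lborel ?E / (2 * pi) \<le> 10 * d / \<tau>" using \<tau> by (simp add: field_simps)
  then show ?thesis using measure_circle_eq[OF B] by simp
qed

lemma maximal_inequality:
  assumes f: "f \<in> hardy2" and \<tau>: "\<tau> > 0" and d: "hardy2_norm f \<le> d" "d > 0"
  shows "measure circle_measure (superlevel f \<tau> 1) \<le> 10 * d / \<tau>"
proof -
  define s where "s n = 1 - 1 / real (n + 2)" for n
  have s: "0 < s n" "s n < 1" for n by (auto simp: s_def)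
  have sets: "superlevel f \<tau> t \<in> sets circle_measure" for t
    unfolding circle_measure_eq using open_superlevel[OF f \<tau>] by (intro sets_completionI_sets) simp
  have "superlevel f \<tau> 1 = (\<Union>n. superlevel f \<tau> (s n))"
  proof (intro equalityI subsetI)
    fix w assume "w \<in> superlevel f \<tau> 1"
    then obtain r where r: "0 < r" "r < 1" "\<tau> < cmod (f (of_real r * w))"
      by (auto simp: superlevel_def)
    obtain n where "1 / (1 - r) < real n" using reals_Archimedean2 by blast
    then have "1 / (1 - r) < real (n + 2)" by simp
    then have "r < s n" using r by (simp add: s_def field_simps)
    then have "w \<in> superlevel f \<tau> (s n)" using r by (auto simp: superlevel_def)
    then show "w \<in> (\<Union>n. superlevel f \<tau> (s n))" by blast
  next
    fix w assume "w \<in> (\<Union>n. superlevel f \<tau> (s n))"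
    then obtain n r where "0 < r" "r < s n" "\<tau> < cmod (f (of_real r * w))"
      by (auto simp: superlevel_def)
    then show "w \<in> superlevel f \<tau> 1" using s(2)[of n]
      by (auto simp: superlevel_def intro!: bexI[of _ r])
  qed
  moreover have "incseq (\<lambda>n. superlevel f \<tau> (s n))"
  proof (rule incseq_SucI, rule subsetI)
    fix n w assume "w \<in> superlevel f \<tau> (s n)"
    moreover have "s n \<le> s (Suc n)" by (simp add: s_def field_simps)
    ultimately show "w \<in> superlevel f \<tau> (s (Suc n))" by (force simp: superlevel_def)
  qed
  ultimately have "(\<lambda>n. measure circle_measure (superlevel f \<tau> (s n))) \<longlonglongrightarrow> measure circle_measure (superlevel f \<tau> 1)"
    using circle.finite_Lim_measure_incseq[of "\<lambda>n. superlevel f \<tau> (s n)"] sets by auto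
  then show ?thesis
    by (rule tendsto_upperbound) (use maximal_inequality_inner[OF f s \<tau> d] in auto)
qed

text \<open>
  Fatou's theorem. Polynomials have radial limits everywhere, so the oscillation of \<open>f\<close> at the end of a
  radius equals that of \<open>f - p\<close> for every polynomial \<open>p\<close>. It exceeds a given bound only where the maximal
  function of \<open>f - p\<close> is large, and the maximal inequality makes this set as small as desired by the
  choice of \<open>p\<close>.
\<close>

theorem radial_limit_exists:
  assumes f: "f \<in> hardy2"
  shows "AE w in circle_measure. \<exists>l. ((\<lambda>r. f (of_real r * w)) \<longlongrightarrow> l) (at_left 1)"
proof -
  define a where "a = taylor_coeff f"
  define q where "q L = f - disc_poly a L" for L
  have q: "q L \<in> hardy2" for L unfolding q_def by (intro hardy2_diff f disc_poly)
  define Z where "Z m = (\<Inter>L. superlevel (q L) (1 / real (Suc m)) 1)" for m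
  have sets: "superlevel (q L) (1 / real (Suc m)) 1 \<in> sets circle_measure" for L m
    unfolding circle_measure_eq using open_superlevel[OF q] by (intro sets_completionI_sets) simp
  have Zs: "Z m \<in> sets circle_measure" for m
    unfolding Z_def by (intro sets.countable_INT) (use sets in auto)
  have "measure circle_measure (Z m) = 0" for m
  proof (rule antisym)
    show "measure circle_measure (Z m) \<le> 0"
    proof (rule field_le_epsilon)
      fix e :: real assume e: "e > 0"
      define d where "d = e / (10 * real (Suc m))"
      have d: "d > 0" using e by (simp add: d_def)
      obtain L where L: "hardy2_norm (q L) < d"
        using disc_poly_approx[OF f d] unfolding q_def a_def by blast
      have "measure circle_measure (Z m) \<le> measure circle_measure (superlevel (q L) (1 / real (Suc m)) 1)"
        by (rule circle.finite_measure_mono) (use sets in \<open>auto simp: Z_def\<close>)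
      also have "\<dots> \<le> 10 * d / (1 / real (Suc m))"
        by (rule maximal_inequality[OF q _ _ d]) (use L in auto)
      also have "\<dots> = e" by (simp add: d_def field_simps)
      finally show "measure circle_measure (Z m) \<le> 0 + e" by simp
    qed
  qed simp
  then have "Z m \<in> null_sets circle_measure" for m
    using Zs by (simp add: null_sets_def circle.emeasure_eq_measure)
  then have "AE w in circle_measure. w \<notin> Z m" for m by (rule AE_not_in)
  then have "AE w in circle_measure. \<forall>m. w \<notin> Z m" by (simp add: AE_all_countable)
  with AE_circle_unit show ?thesis
  proof eventually_elim
    case (elim w)
    have "cauchy_filter (filtermap (\<lambda>r. f (of_real r * w)) (at_left 1))"
      unfolding cauchy_filter_metric_filtermap
    proof (intro allI impI)
      fix e :: real assume e: "e > 0"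
      obtain m where m: "inverse (real (Suc m)) < e / 4" using reals_Archimedean[of "e / 4"] e by auto
      from elim(2) obtain L where L: "w \<notin> superlevel (q L) (1 / real (Suc m)) 1" by (auto simp: Z_def)
      define p where "p r = (\<Sum>n<L. a n * (of_real r * w) ^ n)" for r :: real
      have "(p \<longlongrightarrow> p 1) (at_left 1)"
        unfolding p_def by (intro tendsto_intros)
      then have "\<forall>\<^sub>F r in at_left 1. dist (p r) (p 1) < e / 4"
        using e by (intro tendstoD) auto
      moreover have "\<forall>\<^sub>F r in at_left 1. r \<in> {0<..<1::real}" by (rule eventually_at_left_real) simp
      ultimately have "\<forall>\<^sub>F r in at_left 1. dist (f (of_real r * w)) (p 1) < e / 2"
      proof eventually_elim
        case (elim r)
        then have "cmod (of_real r * w) < 1" using \<open>cmod w = 1\<close> by (simp add: norm_mult)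
        then have "f (of_real r * w) - p r = q L (of_real r * w)"
          by (simp add: q_def disc_poly_apply p_def)
        moreover have "cmod (q L (of_real r * w)) \<le> 1 / real (Suc m)"
          using L elim by (auto simp: superlevel_def not_less)
        ultimately have "dist (f (of_real r * w)) (p r) < e / 4"
          using m by (simp add: dist_norm inverse_eq_divide)
        with elim show ?case
          using dist_triangle[of "f (of_real r * w)" "p 1" "p r"] by simp
      qed
      then show "\<exists>P. eventually P (at_left 1) \<and>
          (\<forall>x y. P x \<and> P y \<longrightarrow> dist (f (of_real x * w)) (f (of_real y * w)) < e)"
        by (intro exI[of _ "\<lambda>r. dist (f (of_real r * w)) (p 1) < e / 2"])
          (auto intro: dist_triangle_half_l)
    qed
    from cauchy_filter_complete_converges[OF this complete_UNIV]
    show ?case by (auto simp: filterlim_def filtermap_bot_iff)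
  qed
qed

lemma boundary_fun_eqI:
  "((\<lambda>r. f (of_real r * w)) \<longlongrightarrow> l) (at_left 1) \<Longrightarrow> boundary_fun f w = l"
  unfolding boundary_fun_def by (rule tendsto_Lim) auto

lemma boundary_fun_tendsto:
  assumes "f \<in> hardy2"
  shows "AE w in circle_measure. ((\<lambda>r. f (of_real r * w)) \<longlongrightarrow> boundary_fun f w) (at_left 1)"
  using radial_limit_exists[OF assms] by eventually_elim (auto simp: boundary_fun_eqI)

text \<open>
  Fatou's lemma along a sequence of radii tending to 1.
\<close>

lemma boundary_fun_L2:
  assumes f: "f \<in> hardy2"
  shows "L2_circle (boundary_fun f)"
    and "mean_square (boundary_fun f) \<le> (hardy2_norm f)\<^sup>2"
proof -
  define s where "s n = 1 - 1 / real (n + 2)" for n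
  let ?e = "\<lambda>n w. ennreal ((cmod (f (of_real (s n) * w)))\<^sup>2)"
  have s: "0 \<le> s n" "s n < 1" for n by (auto simp: s_def)
  have "filterlim s (at_left 1) sequentially"
  proof (rule filterlim_at_withinI)
    show "s \<longlonglongrightarrow> 1" unfolding s_def by real_asymp
  qed (use s in \<open>auto simp: less_imp_neq\<close>)
  then have lim: "AE w in circle_measure. (\<lambda>n. f (of_real (s n) * w)) \<longlonglongrightarrow> boundary_fun f w"
    using boundary_fun_tendsto[OF f] by (auto elim!: eventually_mono intro: filterlim_compose)
  note [measurable] = borel_measurable_circle[OF hardy2_borel[OF f]] L2_measurable[OF dilation_L2(1)[OF f s]]
  have m [measurable]: "boundary_fun f \<in> borel_measurable circle_measure"
  proof (rule measurable_AE_cong)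
    show "(\<lambda>w. lim (\<lambda>n. f (of_real (s n) * w))) \<in> borel_measurable circle_measure" by measurable
    show "AE w in circle_measure. lim (\<lambda>n. f (of_real (s n) * w)) = boundary_fun f w"
      using lim by eventually_elim (rule limI)
  qed
  have "(\<integral>\<^sup>+w. ennreal ((cmod (boundary_fun f w))\<^sup>2) \<partial>circle_measure)
      = (\<integral>\<^sup>+w. liminf (\<lambda>n. ?e n w) \<partial>circle_measure)"
  proof (rule nn_integral_cong_AE)
    show "AE w in circle_measure. ennreal ((cmod (boundary_fun f w))\<^sup>2) = liminf (\<lambda>n. ?e n w)"
      using lim
    proof eventually_elim
      case (elim w)
      then have "(\<lambda>n. ?e n w) \<longlonglongrightarrow> ennreal ((cmod (boundary_fun f w))\<^sup>2)"
        by (intro tendsto_ennrealI tendsto_intros)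
      then show ?case by (rule lim_imp_Liminf[OF sequentially_bot, symmetric])
    qed
  qed
  also have "\<dots> \<le> liminf (\<lambda>n. \<integral>\<^sup>+w. ?e n w \<partial>circle_measure)"
    by (rule nn_integral_liminf) measurable
  also have "\<dots> \<le> liminf (\<lambda>n::nat. ennreal ((hardy2_norm f)\<^sup>2))"
  proof (intro Liminf_mono always_eventually allI)
    fix n
    have "(\<integral>\<^sup>+w. ?e n w \<partial>circle_measure)
        = ennreal (mean_square (\<lambda>w. f (of_real (s n) * w)))"
      by (rule nn_integral_eq_integral[OF L2_integrable[OF dilation_L2(1)[OF f s]]]) simp
    also have "\<dots> \<le> ennreal ((hardy2_norm f)\<^sup>2)"
      by (intro ennreal_leI dilation_L2(2)[OF f s])
    finally show "(\<integral>\<^sup>+w. ?e n w \<partial>circle_measure) \<le> ennreal ((hardy2_norm f)\<^sup>2)" .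
  qed
  also have "\<dots> = ennreal ((hardy2_norm f)\<^sup>2)" by (simp add: Liminf_const)
  finally have le: "(\<integral>\<^sup>+w. ennreal ((cmod (boundary_fun f w))\<^sup>2) \<partial>circle_measure) \<le> ennreal ((hardy2_norm f)\<^sup>2)" .
  have int: "integrable circle_measure (\<lambda>w. (cmod (boundary_fun f w))\<^sup>2)"
    by (rule integrableI_bounded) (use le in \<open>auto intro: le_less_trans\<close>)
  then show "L2_circle (boundary_fun f)" using m by (simp add: L2_circle_def)
  have "ennreal (mean_square (boundary_fun f)) \<le> ennreal ((hardy2_norm f)\<^sup>2)"
    using le nn_integral_eq_integral[OF int] by simp
  then show "mean_square (boundary_fun f) \<le> (hardy2_norm f)\<^sup>2"
    by simp
qed

lemma boundary_fun_add:
  assumes "f \<in> hardy2" "g \<in> hardy2"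
  shows "AE w in circle_measure. boundary_fun (f + g) w = boundary_fun f w + boundary_fun g w"
  using boundary_fun_tendsto[OF assms(1)] boundary_fun_tendsto[OF assms(2)]
  by eventually_elim (auto intro!: boundary_fun_eqI tendsto_add)

lemma boundary_fun_diff:
  assumes "f \<in> hardy2" "g \<in> hardy2"
  shows "AE w in circle_measure. boundary_fun (f - g) w = boundary_fun f w - boundary_fun g w"
  using boundary_fun_tendsto[OF assms(1)] boundary_fun_tendsto[OF assms(2)]
  by eventually_elim (auto intro!: boundary_fun_eqI tendsto_diff)

lemma boundary_fun_scale:
  assumes "f \<in> hardy2"
  shows "AE w in circle_measure. boundary_fun (cfun_scale c f) w = c * boundary_fun f w"
  using boundary_fun_tendsto[OF assms(1)]
  by eventually_elim (auto intro!: boundary_fun_eqI tendsto_mult simp: cfun_scale_def)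

lemma boundary_fun_disc_poly:
  assumes "cmod w = 1"
  shows "boundary_fun (disc_poly a L) w = (\<Sum>n<L. a n * w ^ n)"
proof (rule boundary_fun_eqI)
  have "((\<lambda>r. \<Sum>n<L. a n * (of_real r * w) ^ n) \<longlongrightarrow> (\<Sum>n<L. a n * (of_real 1 * w) ^ n)) (at_left 1)"
    by (intro tendsto_intros)
  moreover have "\<forall>\<^sub>F r in at_left 1. (\<Sum>n<L. a n * (of_real r * w) ^ n) = disc_poly a L (of_real r * w)"
    using eventually_at_left_real[of 0 1, simplified]
    by eventually_elim (use assms in \<open>auto simp: disc_poly_apply norm_mult\<close>)
  ultimately show "((\<lambda>r. disc_poly a L (of_real r * w)) \<longlongrightarrow> (\<Sum>n<L. a n * w ^ n)) (at_left 1)"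
    by (simp add: tendsto_cong)
qed

text \<open>
  This is clear for polynomials, and both sides depend continuously on \<open>f\<close> by Bessel's inequality.
\<close>

lemma fourier_boundary_fun:
  assumes f: "f \<in> hardy2"
  shows "fourier (boundary_fun f) n = taylor_coeff f n"
proof -
  let ?p = "disc_poly (taylor_coeff f)"
  have "cmod (fourier (boundary_fun f) n - taylor_coeff f n) \<le> hardy2_norm (f - ?p L)" if "n < L" for L
  proof -
    have fp: "f - ?p L \<in> hardy2" by (intro hardy2_diff f disc_poly)
    have AEp: "AE w in circle_measure. boundary_fun (?p L) w = (\<Sum>n<L. taylor_coeff f n * w ^ n)"
      using AE_circle_unit by eventually_elim (rule boundary_fun_disc_poly)
    have "fourier (boundary_fun (f - ?p L)) n = fourier (\<lambda>w. boundary_fun f w - boundary_fun (?p L) w) n"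
      by (rule fourier_AE_cong[OF boundary_fun_L2(1)[OF fp] boundary_fun_diff[OF f disc_poly(1)]])
    also have "\<dots> = fourier (boundary_fun f) n - fourier (boundary_fun (?p L)) n"
      by (intro fourier_diff boundary_fun_L2 f disc_poly)
    also have "fourier (boundary_fun (?p L)) n = taylor_coeff f n"
      using fourier_AE_cong[OF boundary_fun_L2(1)[OF disc_poly(1)] AEp] that by (simp add: fourier_poly)
    finally have "(cmod (fourier (boundary_fun f) n - taylor_coeff f n))\<^sup>2 = (cmod (fourier (boundary_fun (f - ?p L)) n))\<^sup>2"
      by (simp only:)
    also have "\<dots> \<le> (\<Sum>k<Suc n. (cmod (fourier (boundary_fun (f - ?p L)) k))\<^sup>2)"
      by (rule member_le_sum) auto
    also have "\<dots> \<le> (hardy2_norm (f - ?p L))\<^sup>2"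
      by (rule order_trans[OF Bessel[OF boundary_fun_L2(1)[OF fp]] boundary_fun_L2(2)[OF fp]])
    finally show ?thesis using hardy2_norm_nonneg[OF fp] by (rule power2_le_imp_le)
  qed
  then have "cmod (fourier (boundary_fun f) n - taylor_coeff f n) \<le> 0"
    by (intro tendsto_lowerbound[OF disc_poly_tendsto[OF f]])
      (auto simp: eventually_at_top_linorder intro!: exI[of _ "Suc n"])
  then show ?thesis by simp
qed

section \<open>The orthogonal projection and Toeplitz operators\<close>

lemma fourier_square_summable:
  assumes F: "L2_circle F"
  shows "summable (\<lambda>n. (cmod (fourier F n))\<^sup>2)"
    and "(\<Sum>n. (cmod (fourier F n))\<^sup>2) \<le> mean_square F"
proof -
  show s: "summable (\<lambda>n. (cmod (fourier F n))\<^sup>2)"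
    by (rule summableI_nonneg_bounded[OF _ Bessel[OF F]]) simp
  show "(\<Sum>n. (cmod (fourier F n))\<^sup>2) \<le> mean_square F"
    by (rule suminf_le_const[OF s Bessel[OF F]])
qed

text \<open>
  \<open>D\<close> is orthogonal to polynomials, and these approximate \<open>u\<close> in mean square on the circle.
\<close>

lemma orthogonal_to_hardy2:
  assumes D: "L2_circle D" and z: "\<And>n. fourier D n = 0" and u: "u \<in> hardy2"
  shows "(LINT w|circle_measure. D w * cnj (boundary_fun u w)) = 0"
proof -
  let ?I = "\<lambda>G. LINT w|circle_measure. D w * cnj (G w)"
  define A where "A = mean_square D"
  have A: "A \<ge> 0" by (simp add: A_def)
  have "cmod (?I (boundary_fun u)) \<le> 0"
  proof (rule field_le_epsilon)
    fix e :: real assume e: "e > 0"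
    define d where "d = e / (A + 1)"
    have d: "d > 0" using e A by (simp add: d_def)
    obtain L where L: "hardy2_norm (u - disc_poly (taylor_coeff u) L) < sqrt (d * e)"
      using disc_poly_approx[OF u, of "sqrt (d * e)"] d e by auto
    let ?p = "\<lambda>w. \<Sum>n<L. taylor_coeff u n * w ^ n"
    define p where "p = disc_poly (taylor_coeff u) L"
    have p: "p \<in> hardy2" by (simp add: p_def disc_poly)
    have up: "u - p \<in> hardy2" by (intro hardy2_diff u p)
    have polyL2: "L2_circle ?p" by (rule L2_circle_poly)
    have AEq: "AE w in circle_measure. boundary_fun (u - p) w = boundary_fun u w - (?p w)"
      using boundary_fun_diff[OF u p] AE_circle_unit
      by eventually_elim (simp add: p_def boundary_fun_disc_poly)
    have "?I ?p = (LINT w|circle_measure. (\<Sum>n<L. cnj (taylor_coeff u n) * (D w * cnj (w ^ n))))"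
      by (intro Bochner_Integration.integral_cong) (auto simp: sum_distrib_left mult_ac)
    also have "\<dots> = (\<Sum>n<L. cnj (taylor_coeff u n) * fourier D n)"
      unfolding fourier_def using fourier_integrable[OF D]
      by (subst Bochner_Integration.integral_sum) auto
    finally have pz: "?I ?p = 0" by (simp add: z)
    have "?I (boundary_fun (u - p)) = ?I (\<lambda>w. boundary_fun u w - (?p w))"
    proof (rule integral_cong_AE)
      show "(\<lambda>w. D w * cnj (boundary_fun (u - p) w)) \<in> borel_measurable circle_measure"
        by (rule borel_measurable_integrable[OF L2_prod(1)[OF D boundary_fun_L2(1)[OF up]]])
      show "(\<lambda>w. D w * cnj (boundary_fun u w - (?p w))) \<in> borel_measurable circle_measure"
        by (rule borel_measurable_integrable[OF L2_prod(1)[OF D L2_diff[OF boundary_fun_L2(1)[OF u] polyL2]]])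
      show "AE x in circle_measure. D x * cnj (boundary_fun (u - p) x) =
          D x * cnj (boundary_fun u x - (?p x))"
        using AEq by eventually_elim simp
    qed
    also have "\<dots> = (LINT w|circle_measure. D w * cnj (boundary_fun u w) - D w * cnj (?p w))"
      by (intro Bochner_Integration.integral_cong) (simp_all add: right_diff_distrib)
    also have "\<dots> = ?I (boundary_fun u) - ?I ?p"
      by (rule Bochner_Integration.integral_diff[OF L2_prod(1)[OF D boundary_fun_L2(1)[OF u]] L2_prod(1)[OF D polyL2]])
    finally have "?I (boundary_fun u) = ?I (boundary_fun (u - p))" using pz by simp
    then have "cmod (?I (boundary_fun u)) \<le> (d * A + mean_square (boundary_fun (u - p)) / d) / 2"
      using L2_prod(2)[OF D boundary_fun_L2(1)[OF up] d] by (simp add: A_def)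
    also have "\<dots> \<le> (e + d * e / d) / 2"
    proof -
      have "d * A \<le> d * (A + 1)" using d by (intro mult_left_mono) auto
      also have "\<dots> = e" using A by (simp add: d_def)
      finally have "d * A \<le> e" .
      moreover have "mean_square (boundary_fun (u - p)) \<le> d * e"
      proof -
        have "mean_square (boundary_fun (u - p)) \<le> (hardy2_norm (u - p))\<^sup>2"
          by (rule boundary_fun_L2(2)[OF up])
        also have "\<dots> \<le> (sqrt (d * e))\<^sup>2"
          using L hardy2_norm_nonneg[OF up] by (intro power_mono) (auto simp: p_def)
        finally show ?thesis using d e by simp
      qed
      ultimately show ?thesis using d by (intro divide_right_mono add_mono) auto
    qed
    finally show "cmod (?I (boundary_fun u)) \<le> 0 + e" using d by simp
  qed
  then show ?thesis by simp
qed

text \<open>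
  Subtracting the series cancels all Fourier coefficients of nonnegative index, which suffices for
  orthogonality; conversely, testing with monomials determines the projection.
\<close>

theorem hardy_projection_eq:
  assumes F: "L2_circle F"
  shows "hardy_projection F = hardy_series (fourier F)"
  unfolding hardy_projection_def
proof (rule the_equality)
  let ?f = "hardy_series (fourier F)"
  note f = hardy_series[OF fourier_square_summable(1)[OF F]]
  have D: "L2_circle (\<lambda>w. F w - boundary_fun ?f w)" by (intro L2_diff F boundary_fun_L2 f)
  have "fourier (\<lambda>w. F w - boundary_fun ?f w) n = 0" for n
    by (simp add: fourier_diff F boundary_fun_L2 f fourier_boundary_fun)
  with orthogonal_to_hardy2[OF D] f(1)
  show "?f \<in> hardy2 \<and> (\<forall>u\<in>hardy2. (LINT w|circle_measure. (F w - boundary_fun ?f w) * cnj (boundary_fun u w)) = 0)"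
    by blast
  fix g assume g: "g \<in> hardy2 \<and> (\<forall>u\<in>hardy2. (LINT w|circle_measure. (F w - boundary_fun g w) * cnj (boundary_fun u w)) = 0)"
  have D: "L2_circle (\<lambda>w. F w - boundary_fun g w)" using g by (intro L2_diff F boundary_fun_L2) auto
  have "fourier F n = taylor_coeff g n" for n
  proof -
    define m where "m = disc_poly (\<lambda>k. if k = n then 1 else 0) (Suc n)"
    have m: "m \<in> hardy2" by (simp add: m_def disc_poly)
    have "fourier (\<lambda>w. F w - boundary_fun g w) n = (LINT w|circle_measure. (F w - boundary_fun g w) * cnj (boundary_fun m w))"
      unfolding fourier_def
    proof (rule integral_cong_AE)
      show "AE w in circle_measure. (F w - boundary_fun g w) * cnj (w ^ n) = (F w - boundary_fun g w) * cnj (boundary_fun m w)"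
        using AE_circle_unit
        by eventually_elim (simp add: m_def boundary_fun_disc_poly if_distrib[of "\<lambda>c. c * _"] cong: if_cong)
    qed (intro borel_measurable_integrable fourier_integrable[OF D] L2_prod(1)[OF D boundary_fun_L2(1)[OF m]])+
    also have "\<dots> = 0" using g m by blast
    finally show ?thesis using g by (simp add: fourier_diff F boundary_fun_L2 fourier_boundary_fun)
  qed
  then have "taylor_coeff g = taylor_coeff ?f" unfolding f(2) by auto
  with g f(1) show "g = ?f" by (blast intro: hardy2_eqI)
qed

theorem toeplitz_bounded_operator:
  assumes m: "\<psi> \<in> borel_measurable circle_measure" and b: "AE w in circle_measure. cmod (\<psi> w) \<le> K"
  shows "hardy2_bounded_operator (toeplitz \<psi>)"
    and "\<And>f. f \<in> hardy2 \<Longrightarrow> taylor_coeff (toeplitz \<psi> f) = fourier (\<lambda>w. \<psi> w * boundary_fun f w)"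
proof -
  let ?F = "\<lambda>f w. \<psi> w * boundary_fun f w"
  have K: "K \<ge> 0"
  proof -
    have "AE w in circle_measure. K \<ge> 0" using b by eventually_elim (rule order_trans[OF norm_ge_zero])
    then show ?thesis by simp
  qed
  have L2: "L2_circle (?F f)" if "f \<in> hardy2" for f
    by (rule L2_bounded_mult[OF boundary_fun_L2(1)[OF that] m b])
  have eq: "toeplitz \<psi> f = hardy_series (fourier (?F f))" if "f \<in> hardy2" for f
    unfolding toeplitz_def by (rule hardy_projection_eq[OF L2[OF that]])
  have T: "toeplitz \<psi> f \<in> hardy2" "taylor_coeff (toeplitz \<psi> f) = fourier (?F f)" if "f \<in> hardy2" for f
    unfolding eq[OF that] by (rule hardy_series[OF fourier_square_summable(1)[OF L2[OF that]]])+
  show "\<And>f. f \<in> hardy2 \<Longrightarrow> taylor_coeff (toeplitz \<psi> f) = fourier (?F f)" by (rule T)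
  have norm: "hardy2_norm (toeplitz \<psi> f) \<le> K * hardy2_norm f" if f: "f \<in> hardy2" for f
  proof (rule power2_le_imp_le)
    have "(hardy2_norm (toeplitz \<psi> f))\<^sup>2 \<le> mean_square (?F f)"
      unfolding hardy2_norm_square[OF T(1)[OF f]] T(2)[OF f] by (rule fourier_square_summable(2)[OF L2[OF f]])
    also have "\<dots> \<le> K\<^sup>2 * mean_square (boundary_fun f)"
      by (rule L2_bounded_mult[OF boundary_fun_L2(1)[OF f] m b])
    also have "\<dots> \<le> K\<^sup>2 * (hardy2_norm f)\<^sup>2"
      by (intro mult_left_mono boundary_fun_L2 f) auto
    finally show "(hardy2_norm (toeplitz \<psi> f))\<^sup>2 \<le> (K * hardy2_norm f)\<^sup>2" by (simp add: power_mult_distrib)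
  qed (use K hardy2_norm_nonneg[OF f] in simp)
  have add: "toeplitz \<psi> (f + g) = toeplitz \<psi> f + toeplitz \<psi> g" if f: "f \<in> hardy2" and g: "g \<in> hardy2" for f g
  proof (rule hardy2_eqI)
    have "fourier (?F (f + g)) n = fourier (\<lambda>w. ?F f w + ?F g w) n" for n
    proof (rule fourier_AE_cong[OF L2[OF hardy2_add(1)[OF f g]]])
      show "AE w in circle_measure. ?F (f + g) w = ?F f w + ?F g w"
        using boundary_fun_add[OF f g] by eventually_elim (simp add: distrib_left)
    qed
    then show "taylor_coeff (toeplitz \<psi> (f + g)) = taylor_coeff (toeplitz \<psi> f + toeplitz \<psi> g)"
      using f g by (simp add: T hardy2_add fourier_add L2 fun_eq_iff)
  qed (use f g in \<open>auto simp: T hardy2_add\<close>)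
  have scale: "toeplitz \<psi> (cfun_scale c f) = cfun_scale c (toeplitz \<psi> f)" if f: "f \<in> hardy2" for f c
  proof (rule hardy2_eqI)
    have "fourier (?F (cfun_scale c f)) n = fourier (\<lambda>w. c * ?F f w) n" for n
    proof (rule fourier_AE_cong[OF L2[OF hardy2_scale(1)[OF f]]])
      show "AE w in circle_measure. ?F (cfun_scale c f) w = c * ?F f w"
        using boundary_fun_scale[OF f, of c] by eventually_elim simp
    qed
    then show "taylor_coeff (toeplitz \<psi> (cfun_scale c f)) = taylor_coeff (cfun_scale c (toeplitz \<psi> f))"
      using f by (simp add: T hardy2_scale fourier_scale fun_eq_iff)
  qed (use f in \<open>auto simp: T hardy2_scale\<close>)
  show "hardy2_bounded_operator (toeplitz \<psi>)"
    unfolding hardy2_bounded_operator_def using T(1) add scale norm by blast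
qed

section \<open>The hypercyclicity criterion\<close>

lemma bounded_operator_funpow:
  assumes "hardy2_bounded_operator T"
  shows "hardy2_bounded_operator (T ^^ n)"
proof (induction n)
  case 0
  show ?case unfolding hardy2_bounded_operator_def by (auto intro!: exI[of _ 1])
next
  case (Suc n)
  obtain K where K: "\<And>f. f \<in> hardy2 \<Longrightarrow> hardy2_norm (T f) \<le> K * hardy2_norm f"
    using assms unfolding hardy2_bounded_operator_def by blast
  obtain L where L: "\<And>f. f \<in> hardy2 \<Longrightarrow> hardy2_norm ((T ^^ n) f) \<le> L * hardy2_norm f"
    using Suc unfolding hardy2_bounded_operator_def by blast
  have "hardy2_norm (T ((T ^^ n) f)) \<le> (\<bar>K\<bar> * L) * hardy2_norm f" if f: "f \<in> hardy2" for f
  proof -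
    have Tn: "(T ^^ n) f \<in> hardy2" using Suc f by (auto simp: hardy2_bounded_operator_def)
    have "hardy2_norm (T ((T ^^ n) f)) \<le> K * hardy2_norm ((T ^^ n) f)" by (rule K[OF Tn])
    also have "\<dots> \<le> \<bar>K\<bar> * hardy2_norm ((T ^^ n) f)" by (intro mult_right_mono hardy2_norm_nonneg Tn) auto
    also have "\<dots> \<le> \<bar>K\<bar> * (L * hardy2_norm f)" by (intro mult_left_mono L f) auto
    finally show ?thesis by (simp add: mult.assoc)
  qed
  then show ?case using assms Suc unfolding hardy2_bounded_operator_def by auto
qed

lemma bounded_operatorD:
  assumes "hardy2_bounded_operator T"
  shows "f \<in> hardy2 \<Longrightarrow> T f \<in> hardy2"
    and "f \<in> hardy2 \<Longrightarrow> g \<in> hardy2 \<Longrightarrow> T (f + g) = T f + T g"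
    and "f \<in> hardy2 \<Longrightarrow> T (cfun_scale c f) = cfun_scale c (T f)"
    and "f \<in> hardy2 \<Longrightarrow> g \<in> hardy2 \<Longrightarrow> T (f - g) = T f - T g"
proof -
  show "f \<in> hardy2 \<Longrightarrow> T f \<in> hardy2"
    and add: "f \<in> hardy2 \<Longrightarrow> g \<in> hardy2 \<Longrightarrow> T (f + g) = T f + T g"
    and scale: "f \<in> hardy2 \<Longrightarrow> T (cfun_scale c f) = cfun_scale c (T f)" for f g c
    using assms by (auto simp: hardy2_bounded_operator_def)
  show "T (f - g) = T f - T g" if "f \<in> hardy2" "g \<in> hardy2"
    unfolding diff_eq_add_scale using that by (simp only: add scale hardy2_scale(1))
qed

definition hardy2_subspace :: "(complex \<Rightarrow> complex) set \<Rightarrow> bool" where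
  "hardy2_subspace S \<longleftrightarrow> S \<subseteq> hardy2 \<and> 0 \<in> S \<and> (\<forall>f\<in>S. \<forall>g\<in>S. f + g \<in> S) \<and> (\<forall>c. \<forall>f\<in>S. cfun_scale c f \<in> S)"

definition hardy2_closure :: "(complex \<Rightarrow> complex) set \<Rightarrow> (complex \<Rightarrow> complex) set" where
  "hardy2_closure S = {f \<in> hardy2. \<forall>e>0. \<exists>g\<in>S. hardy2_norm (g - f) < e}"

lemma subset_hardy2_closure: "S \<subseteq> hardy2 \<Longrightarrow> S \<subseteq> hardy2_closure S"
  by (auto simp: hardy2_closure_def hardy2_norm_zero intro!: bexI)

lemma hardy2_closure_closed:
  assumes S: "S \<subseteq> hardy2" and f: "f \<in> hardy2"
    and "\<And>e. e > 0 \<Longrightarrow> \<exists>g\<in>hardy2_closure S. hardy2_norm (g - f) < e"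
  shows "f \<in> hardy2_closure S"
proof -
  have "\<exists>g\<in>S. hardy2_norm (g - f) < e" if "e > 0" for e
  proof -
    obtain h where h: "h \<in> hardy2" "\<forall>e>0. \<exists>g\<in>S. hardy2_norm (g - h) < e" "hardy2_norm (h - f) < e / 2"
      using assms(3)[of "e / 2"] \<open>e > 0\<close> by (auto simp: hardy2_closure_def)
    obtain g where g: "g \<in> S" "hardy2_norm (g - h) < e / 2" using h(2) \<open>e > 0\<close> half_gt_zero by blast
    have "hardy2_norm (g - f) < e"
      using hardy2_norm_diff_triangle[of g h f] g h S f by auto
    then show ?thesis using g by blast
  qed
  then show ?thesis using f by (simp add: hardy2_closure_def)
qed

lemma hardy2_closure_subspace:
  assumes S: "hardy2_subspace S"
  shows "hardy2_subspace (hardy2_closure S)"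
  unfolding hardy2_subspace_def
proof (intro conjI ballI allI)
  have sub: "S \<subseteq> hardy2" and S0: "0 \<in> S" using S by (auto simp: hardy2_subspace_def)
  show "hardy2_closure S \<subseteq> hardy2" by (auto simp: hardy2_closure_def)
  show "0 \<in> hardy2_closure S" using subset_hardy2_closure[OF sub] S0 by blast
  fix f assume f: "f \<in> hardy2_closure S"
  then have fH: "f \<in> hardy2" by (simp add: hardy2_closure_def)
  {
    fix g assume g: "g \<in> hardy2_closure S"
    then have gH: "g \<in> hardy2" by (simp add: hardy2_closure_def)
    have "\<exists>h\<in>S. hardy2_norm (h - (f + g)) < e" if e: "e > 0" for e
    proof -
      obtain f' g' where f': "f' \<in> S" "hardy2_norm (f' - f) < e / 2" and g': "g' \<in> S" "hardy2_norm (g' - g) < e / 2"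
        using f g half_gt_zero[OF e] unfolding hardy2_closure_def by blast
      have "f' \<in> hardy2" "g' \<in> hardy2" using f' g' sub by auto
      then have "hardy2_norm ((f' - f) + (g' - g)) \<le> hardy2_norm (f' - f) + hardy2_norm (g' - g)"
        using fH gH by (intro hardy2_norm_triangle hardy2_diff)
      moreover have "(f' - f) + (g' - g) = (f' + g') - (f + g)" by simp
      ultimately have "hardy2_norm ((f' + g') - (f + g)) < e" using f' g' by (simp only:)
      moreover have "f' + g' \<in> S" using S f' g' by (simp add: hardy2_subspace_def)
      ultimately show ?thesis by blast
    qed
    then show "f + g \<in> hardy2_closure S" using hardy2_add(1)[OF fH gH] by (simp add: hardy2_closure_def)
  }
  fix c
  have "\<exists>h\<in>S. hardy2_norm (h - cfun_scale c f) < e" if e: "e > 0" for e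
  proof -
    have "e / (cmod c + 1) > 0" using e by (simp add: add_nonneg_pos)
    then obtain f' where f': "f' \<in> S" "hardy2_norm (f' - f) < e / (cmod c + 1)"
      using f unfolding hardy2_closure_def by blast
    have f'H: "f' \<in> hardy2" using f' sub by auto
    have "cfun_scale c f' - cfun_scale c f = cfun_scale c (f' - f)"
      by (auto simp: cfun_scale_def fun_eq_iff right_diff_distrib)
    then have "hardy2_norm (cfun_scale c f' - cfun_scale c f) = cmod c * hardy2_norm (f' - f)"
      using hardy2_norm_scale[OF hardy2_diff(1)[OF f'H fH], of c] by (simp only:)
    also have "\<dots> \<le> (cmod c + 1) * hardy2_norm (f' - f)"
      by (intro mult_right_mono hardy2_norm_nonneg hardy2_diff f'H fH) auto
    also have "\<dots> < e" using f'(2) by (simp add: pos_less_divide_eq add_nonneg_pos mult.commute)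
    finally have "hardy2_norm (cfun_scale c f' - cfun_scale c f) < e" .
    moreover have "cfun_scale c f' \<in> S" using S f' by (simp add: hardy2_subspace_def)
    ultimately show ?thesis by blast
  qed
  then show "cfun_scale c f \<in> hardy2_closure S" using hardy2_scale(1)[OF fH] by (simp add: hardy2_closure_def)
qed

definition stable_set :: "((complex \<Rightarrow> complex) \<Rightarrow> complex \<Rightarrow> complex) \<Rightarrow> (complex \<Rightarrow> complex) set" where
  "stable_set T = {f \<in> hardy2. (\<lambda>n. hardy2_norm ((T ^^ n) f)) \<longlonglongrightarrow> 0}"

text \<open>
  Vectors with a backward orbit tending to zero. As \<open>T\<close> may fail to be injective, the preimages under
  the powers of \<open>T\<close> are a matter of choice.
\<close>

definition unstable_set :: "((complex \<Rightarrow> complex) \<Rightarrow> complex \<Rightarrow> complex) \<Rightarrow> (complex \<Rightarrow> complex) set" where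
  "unstable_set T = {f \<in> hardy2. \<exists>s. (\<forall>n. s n \<in> hardy2 \<and> (T ^^ n) (s n) = f) \<and> (\<lambda>n. hardy2_norm (s n)) \<longlonglongrightarrow> 0}"

lemma hardy2_norm_add_tendsto_0:
  assumes "\<And>n. s n \<in> hardy2" "\<And>n. t n \<in> hardy2"
    and "(\<lambda>n. hardy2_norm (s n)) \<longlonglongrightarrow> 0" "(\<lambda>n. hardy2_norm (t n)) \<longlonglongrightarrow> 0"
  shows "(\<lambda>n. hardy2_norm (s n + t n)) \<longlonglongrightarrow> 0"
proof (rule tendsto_sandwich[where f = "\<lambda>_. 0" and h = "\<lambda>n. hardy2_norm (s n) + hardy2_norm (t n)"])
  show "(\<lambda>n. hardy2_norm (s n) + hardy2_norm (t n)) \<longlonglongrightarrow> 0"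
    using tendsto_add[OF assms(3,4)] by simp
  show "\<forall>\<^sub>F n in sequentially. 0 \<le> hardy2_norm (s n + t n)"
    using assms by (intro always_eventually allI hardy2_norm_nonneg hardy2_add)
  show "\<forall>\<^sub>F n in sequentially. hardy2_norm (s n + t n) \<le> hardy2_norm (s n) + hardy2_norm (t n)"
    using assms by (intro always_eventually allI hardy2_norm_triangle)
qed auto

lemma hardy2_norm_scale_tendsto_0:
  assumes "\<And>n. s n \<in> hardy2" "(\<lambda>n. hardy2_norm (s n)) \<longlonglongrightarrow> 0"
  shows "(\<lambda>n. hardy2_norm (cfun_scale c (s n))) \<longlonglongrightarrow> 0"
  using tendsto_mult_left[OF assms(2), of "cmod c"] by (simp add: hardy2_norm_scale assms)

lemma stable_subspace:
  assumes T: "hardy2_bounded_operator T"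
  shows "hardy2_subspace (stable_set T)"
  unfolding hardy2_subspace_def
proof (intro conjI ballI allI)
  note Tn = bounded_operatorD[OF bounded_operator_funpow[OF T]]
  have "(T ^^ n) 0 = 0" for n
    using Tn(3)[OF hardy2_zero(1), of n 0] by simp
  then show "0 \<in> stable_set T" by (simp add: stable_set_def hardy2_zero hardy2_norm_zero)
  fix f assume f: "f \<in> stable_set T"
  show "f + g \<in> stable_set T" if "g \<in> stable_set T" for g
    using f that hardy2_norm_add_tendsto_0[of "\<lambda>n. (T ^^ n) f" "\<lambda>n. (T ^^ n) g"]
    by (auto simp: stable_set_def hardy2_add Tn)
  show "cfun_scale c f \<in> stable_set T" for c
    using f hardy2_norm_scale_tendsto_0[of "\<lambda>n. (T ^^ n) f" c]
    by (auto simp: stable_set_def hardy2_scale Tn)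
qed (auto simp: stable_set_def)

lemma unstable_subspace:
  assumes T: "hardy2_bounded_operator T"
  shows "hardy2_subspace (unstable_set T)"
  unfolding hardy2_subspace_def
proof (intro conjI ballI allI)
  note Tn = bounded_operatorD[OF bounded_operator_funpow[OF T]]
  have "(T ^^ n) 0 = 0" for n
    using Tn(3)[OF hardy2_zero(1), of n 0] by simp
  then show "0 \<in> unstable_set T"
    by (auto simp: unstable_set_def hardy2_zero hardy2_norm_zero intro!: exI[of _ "\<lambda>_. 0"])
  fix f assume "f \<in> unstable_set T"
  then obtain s where f: "f \<in> hardy2" and s: "\<And>n. s n \<in> hardy2" "\<And>n. (T ^^ n) (s n) = f" "(\<lambda>n. hardy2_norm (s n)) \<longlonglongrightarrow> 0"
    by (auto simp: unstable_set_def)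
  show "f + g \<in> unstable_set T" if "g \<in> unstable_set T" for g
  proof -
    obtain t where g: "g \<in> hardy2" and t: "\<And>n. t n \<in> hardy2" "\<And>n. (T ^^ n) (t n) = g" "(\<lambda>n. hardy2_norm (t n)) \<longlonglongrightarrow> 0"
      using \<open>g \<in> unstable_set T\<close> by (auto simp: unstable_set_def)
    have "(\<forall>n. s n + t n \<in> hardy2 \<and> (T ^^ n) (s n + t n) = f + g) \<and> (\<lambda>n. hardy2_norm (s n + t n)) \<longlonglongrightarrow> 0"
      using s t hardy2_norm_add_tendsto_0[of s t] by (auto simp: hardy2_add Tn)
    then show ?thesis using f g unfolding unstable_set_def by (auto simp: hardy2_add intro!: exI[of _ "\<lambda>n. s n + t n"])
  qed
  show "cfun_scale c f \<in> unstable_set T" for c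
  proof -
    have "(\<forall>n. cfun_scale c (s n) \<in> hardy2 \<and> (T ^^ n) (cfun_scale c (s n)) = cfun_scale c f) \<and>
        (\<lambda>n. hardy2_norm (cfun_scale c (s n))) \<longlonglongrightarrow> 0"
      using s hardy2_norm_scale_tendsto_0[of s c] by (auto simp: hardy2_scale Tn)
    then show ?thesis using f unfolding unstable_set_def by (auto simp: hardy2_scale intro!: exI[of _ "\<lambda>n. cfun_scale c (s n)"])
  qed
qed (auto simp: unstable_set_def)

lemma eigenvector_funpow:
  assumes T: "hardy2_bounded_operator T" and f: "f \<in> hardy2" and e: "T f = cfun_scale \<mu> f"
  shows "(T ^^ n) f = cfun_scale (\<mu> ^ n) f"
proof (induction n)
  case (Suc n)
  then show ?case using bounded_operatorD(3)[OF T f, of "\<mu> ^ n"] e by (simp add: mult.commute)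
qed simp

lemma eigenvector_stable:
  assumes T: "hardy2_bounded_operator T" and f: "f \<in> hardy2" and e: "T f = cfun_scale \<mu> f" and \<mu>: "cmod \<mu> < 1"
  shows "f \<in> stable_set T"
proof -
  have "(\<lambda>n. cmod \<mu> ^ n * hardy2_norm f) \<longlonglongrightarrow> 0 * hardy2_norm f"
    using \<mu> by (intro tendsto_mult tendsto_const LIMSEQ_power_zero) auto
  then show ?thesis
    using f by (simp add: stable_set_def eigenvector_funpow[OF T f e] hardy2_norm_scale norm_power)
qed

lemma eigenvector_unstable:
  assumes T: "hardy2_bounded_operator T" and f: "f \<in> hardy2" and e: "T f = cfun_scale \<mu> f" and \<mu>: "cmod \<mu> > 1"
  shows "f \<in> unstable_set T"
proof -
  define s where "s n = cfun_scale (inverse \<mu> ^ n) f" for n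
  note Tn = bounded_operatorD[OF bounded_operator_funpow[OF T]]
  have "\<mu> \<noteq> 0" using \<mu> by auto
  then have "(T ^^ n) (s n) = f" for n
    unfolding s_def using f
    by (simp add: Tn eigenvector_funpow[OF T f e] flip: power_mult_distrib)
  moreover have "s n \<in> hardy2" for n unfolding s_def by (rule hardy2_scale[OF f])
  moreover have "(\<lambda>n. inverse (cmod \<mu>) ^ n * hardy2_norm f) \<longlonglongrightarrow> 0 * hardy2_norm f"
    using \<mu> by (intro tendsto_mult tendsto_const LIMSEQ_power_zero) (auto simp: inverse_less_1_iff)
  then have "(\<lambda>n. hardy2_norm (s n)) \<longlonglongrightarrow> 0"
    by (simp add: s_def hardy2_norm_scale f norm_power norm_inverse)
  ultimately show ?thesis using f by (auto simp: unstable_set_def)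
qed

text \<open>
  Let \<open>x\<close> be a stable vector near \<open>g\<close>, and let \<open>y\<close> be an unstable vector near \<open>c\<close> with preimages \<open>s n\<close>.
  For large \<open>n\<close> the vector \<open>x + s n\<close> is near \<open>g\<close>, and the \<open>n\<close>-th power of \<open>T\<close> maps it to
  \<open>T\<^sup>n x + y\<close>, which is near \<open>c\<close>. Thus the points whose orbits meet a given ball form a dense open set,
  and by Baire's theorem some point lies in all these sets for a countable base of balls.
\<close>

theorem hypercyclicity_criterion:
  assumes T: "hardy2_bounded_operator T"
    and stable: "hardy2_closure (stable_set T) = hardy2"
    and unstable: "hardy2_closure (unstable_set T) = hardy2"
  shows "hypercyclic_on_hardy2 T"
proof -
  note Tn = bounded_operatorD[OF bounded_operator_funpow[OF T]]
  obtain D where D: "countable D" "D \<subseteq> hardy2" "\<And>g e. g \<in> hardy2 \<Longrightarrow> e > 0 \<Longrightarrow> \<exists>f\<in>D. hardy2_norm (f - g) < e"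
    using hardy2_separable by blast
  define G where "G = (\<lambda>(c, m). {x \<in> hardy2. \<exists>n. hardy2_norm ((T ^^ n) x - c) < 1 / real (Suc m)})"
  have opn: "openin hardy.mtopology (G (c, m))" if c: "c \<in> hardy2" for c m
    unfolding hardy.openin_mtopology
  proof (intro conjI allI impI)
    show "G (c, m) \<subseteq> hardy2" by (auto simp: G_def)
    fix x assume "x \<in> G (c, m)"
    then obtain n where x: "x \<in> hardy2" and n: "hardy2_norm ((T ^^ n) x - c) < 1 / real (Suc m)"
      by (auto simp: G_def)
    obtain K where K: "\<And>f. f \<in> hardy2 \<Longrightarrow> hardy2_norm ((T ^^ n) f) \<le> K * hardy2_norm f"
      using bounded_operator_funpow[OF T, of n] unfolding hardy2_bounded_operator_def by blast
    define r where "r = (1 / real (Suc m) - hardy2_norm ((T ^^ n) x - c)) / (\<bar>K\<bar> + 1)"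
    have r: "r > 0" using n by (simp add: r_def add_nonneg_pos)
    have "y \<in> G (c, m)" if "y \<in> hardy.mball x r" for y
    proof -
      have y: "y \<in> hardy2" and yx: "hardy2_norm (y - x) < r"
        using that x by (auto simp: hardy.in_mball hardy_dist_def hardy2_norm_diff_commute)
      have yxH: "y - x \<in> hardy2" by (intro hardy2_diff y x)
      have "hardy2_norm ((T ^^ n) y - (T ^^ n) x) = hardy2_norm ((T ^^ n) (y - x))" by (simp only: Tn(4)[OF y x])
      also have "\<dots> \<le> K * hardy2_norm (y - x)" by (rule K[OF yxH])
      also have "\<dots> \<le> (\<bar>K\<bar> + 1) * hardy2_norm (y - x)"
        by (intro mult_right_mono hardy2_norm_nonneg yxH) auto
      also have "\<dots> < (\<bar>K\<bar> + 1) * r" using yx by (intro mult_strict_left_mono) auto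
      also have "\<dots> = 1 / real (Suc m) - hardy2_norm ((T ^^ n) x - c)"
        by (simp add: r_def add_nonneg_pos less_imp_neq[symmetric])
      finally have "hardy2_norm ((T ^^ n) y - c) < 1 / real (Suc m)"
        using hardy2_norm_diff_triangle[OF Tn(1)[OF y] Tn(1)[OF x] c, of n n] by linarith
      then show ?thesis using y by (auto simp: G_def)
    qed
    then show "\<exists>r>0. hardy.mball x r \<subseteq> G (c, m)" using r by blast
  qed
  have dense: "hardy.mtopology closure_of G (c, m) = hardy2" if c: "c \<in> hardy2" for c m
  proof -
    have "\<exists>y\<in>G (c, m). y \<in> hardy.mball g e" if g: "g \<in> hardy2" and e: "e > 0" for g e
    proof -
      let ?d = "1 / real (Suc m)"
      obtain x where x: "x \<in> stable_set T" "hardy2_norm (x - g) < e / 2"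
        using stable g half_gt_zero[OF e] unfolding hardy2_closure_def by blast
      have "?d / 2 > 0" by simp
      then obtain y where y: "y \<in> unstable_set T" "hardy2_norm (y - c) < ?d / 2"
        using unstable c unfolding hardy2_closure_def by blast
      from y obtain s where s: "\<And>n. s n \<in> hardy2" "\<And>n. (T ^^ n) (s n) = y" "(\<lambda>n. hardy2_norm (s n)) \<longlonglongrightarrow> 0"
        by (auto simp: unstable_set_def)
      have xH: "x \<in> hardy2" and xlim: "(\<lambda>n. hardy2_norm ((T ^^ n) x)) \<longlonglongrightarrow> 0" using x by (auto simp: stable_set_def)
      have yH: "y \<in> hardy2" using y by (auto simp: unstable_set_def)
      have "\<forall>\<^sub>F n in sequentially. hardy2_norm ((T ^^ n) x) < ?d / 2 \<and> hardy2_norm (s n) < e / 2"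
        using order_tendstoD(2)[OF xlim, of "?d / 2"] order_tendstoD(2)[OF s(3), of "e / 2"] e
        by (auto intro: eventually_conj)
      then obtain n where n: "hardy2_norm ((T ^^ n) x) < ?d / 2" "hardy2_norm (s n) < e / 2"
        by (auto simp: eventually_sequentially)
      define z where "z = x + s n"
      have zH: "z \<in> hardy2" unfolding z_def by (intro hardy2_add xH s)
      have "(T ^^ n) z - c = (T ^^ n) x + (y - c)"
        by (simp add: z_def Tn(2)[OF xH s(1)] s(2))
      moreover have "hardy2_norm ((T ^^ n) x + (y - c)) \<le> hardy2_norm ((T ^^ n) x) + hardy2_norm (y - c)"
        by (intro hardy2_norm_triangle Tn xH hardy2_diff yH c)
      ultimately have "hardy2_norm ((T ^^ n) z - c) < ?d" using n y by (simp only:)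
      then have "z \<in> G (c, m)" using zH by (auto simp: G_def)
      moreover have "hardy2_norm (z - g) < e"
      proof -
        have "z - g = (x - g) + s n" by (simp add: z_def)
        moreover have "hardy2_norm ((x - g) + s n) \<le> hardy2_norm (x - g) + hardy2_norm (s n)"
          by (intro hardy2_norm_triangle hardy2_diff xH g s)
        ultimately show ?thesis using n x by (simp only:)
      qed
      then have "z \<in> hardy.mball g e"
        using zH g by (auto simp: hardy.in_mball hardy_dist_def hardy2_norm_diff_commute)
      ultimately show ?thesis by blast
    qed
    then show ?thesis by (auto simp: hardy.metric_closure_of)
  qed
  have "hardy.mtopology closure_of \<Inter>(G ` (D \<times> UNIV)) = hardy2"
    by (rule hardy.metric_Baire_category[OF hardy_mcomplete]) (use D opn dense in auto)
  then have "\<Inter>(G ` (D \<times> UNIV)) \<noteq> {}" using hardy2_zero(1) by force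
  then obtain f where f: "\<And>c m. c \<in> D \<Longrightarrow> f \<in> G (c, m)" by fast
  obtain c0 where "c0 \<in> D" using D(3)[OF hardy2_zero(1), of 1] by auto
  then have fH: "f \<in> hardy2" using f by (auto simp: G_def)
  have "hardy2_dense (range (\<lambda>n. (T ^^ n) f))"
    unfolding hardy2_dense_def
  proof (intro conjI ballI allI impI)
    show "range (\<lambda>n. (T ^^ n) f) \<subseteq> hardy2" using fH Tn by auto
    fix g and e :: real assume g: "g \<in> hardy2" and e: "e > 0"
    obtain c where c: "c \<in> D" "hardy2_norm (c - g) < e / 2" using D(3)[OF g half_gt_zero[OF e]] by blast
    obtain m where m: "inverse (real (Suc m)) < e / 2" using reals_Archimedean[OF half_gt_zero[OF e]] by blast
    obtain n where n: "hardy2_norm ((T ^^ n) f - c) < 1 / real (Suc m)" using f[OF c(1), of m] by (auto simp: G_def)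
    have "hardy2_norm ((T ^^ n) f - g) < e"
      using hardy2_norm_diff_triangle[OF Tn(1)[OF fH] _ g, of c n] c D(2) n m by (auto simp: inverse_eq_divide)
    then show "\<exists>h\<in>range (\<lambda>n. (T ^^ n) f). hardy2_norm (h - g) < e" by blast
  qed
  then show ?thesis unfolding hypercyclic_on_hardy2_def using T fH by blast
qed

section \<open>Multipliers and coanalytic functions\<close>

text \<open>
  The estimate is pointwise on circles of radius \<open>r < 1\<close>: Bessel's inequality bounds the coefficients
  of the product, dilated to radius \<open>r\<close>, by its mean square there, which is at most \<open>K\<^sup>2\<close> times that of
  \<open>f\<close>. The bound does not depend on \<open>r\<close>.
\<close>

lemma multiplier:
  assumes F: "F holomorphic_on ball 0 1" "\<And>z. cmod z < 1 \<Longrightarrow> cmod (F z) \<le> K" and f: "f \<in> hardy2"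
  shows "(\<lambda>z. F z * f z) \<in> hardy2" and "hardy2_norm (\<lambda>z. F z * f z) \<le> K * hardy2_norm f"
proof -
  define g where "g z = F z * f z" for z
  define c where "c = taylor_coeff g"
  let ?c = "\<lambda>r n. (cmod (c n * of_real r ^ n))\<^sup>2"
  have K: "K \<ge> 0" using order_trans[OF norm_ge_zero F(2)[of 0]] by simp
  have g: "g holomorphic_on ball 0 1"
    unfolding g_def by (intro holomorphic_intros F hardy2_holomorphic f)
  have dil: "(\<Sum>n<L. ?c r n) \<le> (K * hardy2_norm f)\<^sup>2" if r: "0 < r" "r < 1" for r L
  proof -
    define gr where "gr = on_disc (\<lambda>z. g (of_real r * z))"
    have lt: "cmod (of_real r * z) < 1" if "cmod z \<le> 1" for z
      using le_less_trans[OF mult_left_le[OF that, of r]] r by (simp add: norm_mult)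
    have grs: "(\<lambda>n. (c n * of_real r ^ n) * z ^ n) sums gr z" if "cmod z < 1" for z
      using taylor_sums[OF g lt, of z] that
      by (simp add: gr_def on_disc_def c_def power_mult_distrib mult.assoc)
    have "summable (?c r)"
    proof -
      define s where "s = (r + 1) / 2"
      have s: "r < s" "s < 1" using r by (auto simp: s_def)
      have "summable (\<lambda>n. c n * of_real s ^ n)"
        using taylor_sums[OF g, of "of_real s"] s r by (auto simp: c_def sums_iff)
      then have "summable (\<lambda>n. norm (c n * of_real r ^ n))"
        by (rule powser_insidea) (use s r in auto)
      then have *: "summable (\<lambda>n. cmod (c n * of_real r ^ n))" .
      from summable_LIMSEQ_zero[OF *] have "\<forall>\<^sub>F n in sequentially. cmod (c n * of_real r ^ n) < 1"
        by (rule order_tendstoD) simp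
      then have "\<forall>\<^sub>F n in sequentially. norm (?c r n) \<le> cmod (c n * of_real r ^ n)"
        by eventually_elim (simp add: power2_eq_square mult_left_le)
      then show ?thesis using * by (rule summable_comparison_test_ev)
    qed
    then have gr: "gr \<in> hardy2"
      by (intro hardy2I[where a = "\<lambda>n. c n * of_real r ^ n"] grs) (auto simp: gr_def on_disc_def)
    have tgr: "taylor_coeff gr = (\<lambda>n. c n * of_real r ^ n)" by (rule taylor_coeff_eqI[OF grs])
    have bgr: "boundary_fun gr w = F (of_real r * w) * f (of_real r * w)" if z: "cmod w = 1" for w
    proof (rule boundary_fun_eqI)
      have cont: "isCont g (of_real r * w)"
        using holomorphic_on_imp_continuous_on[OF g] lt[of w] z
        by (simp add: continuous_on_eq_continuous_at)
      have "((\<lambda>t. of_real r * (of_real t * w)) \<longlongrightarrow> of_real r * (of_real 1 * w)) (at_left 1)"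
        by (intro tendsto_intros)
      then have "((\<lambda>t. g (of_real r * (of_real t * w))) \<longlongrightarrow> g (of_real r * w)) (at_left 1)"
        by (intro isCont_tendsto_compose[OF cont]) simp
      moreover have "\<forall>\<^sub>F t in at_left 1. g (of_real r * (of_real t * w)) = gr (of_real t * w)"
        using eventually_at_left_real[of 0 1, simplified]
        by eventually_elim (use z in \<open>auto simp: gr_def on_disc_def norm_mult\<close>)
      ultimately show "((\<lambda>t. gr (of_real t * w)) \<longlongrightarrow> F (of_real r * w) * f (of_real r * w)) (at_left 1)"
        by (simp add: tendsto_cong g_def)
    qed
    have "(\<Sum>n<L. ?c r n) = (\<Sum>n<L. (cmod (fourier (boundary_fun gr) n))\<^sup>2)"
      by (simp add: fourier_boundary_fun[OF gr] tgr)
    also have "\<dots> \<le> mean_square (boundary_fun gr)"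
      by (rule Bessel[OF boundary_fun_L2(1)[OF gr]])
    also have "\<dots> \<le> (LINT w|circle_measure. K\<^sup>2 * (cmod (f (of_real r * w)))\<^sup>2)"
    proof (rule integral_mono_AE[OF L2_integrable[OF boundary_fun_L2(1)[OF gr]]])
      show "integrable circle_measure (\<lambda>w. K\<^sup>2 * (cmod (f (of_real r * w)))\<^sup>2)"
        using L2_integrable[OF dilation_L2(1)[OF f, of r]] r by simp
      show "AE w in circle_measure. (cmod (boundary_fun gr w))\<^sup>2 \<le> K\<^sup>2 * (cmod (f (of_real r * w)))\<^sup>2"
        using AE_circle_unit
      proof eventually_elim
        case (elim w)
        have "cmod (boundary_fun gr w) \<le> K * cmod (f (of_real r * w))"
          using elim F(2)[OF lt, of w] by (auto simp: bgr norm_mult intro: mult_right_mono)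
        then show ?case by (metis norm_ge_zero power_mono power_mult_distrib)
      qed
    qed
    also have "\<dots> \<le> K\<^sup>2 * (hardy2_norm f)\<^sup>2"
      using dilation_L2(2)[OF f, of r] r by (simp add: mult_left_mono)
    finally show ?thesis by (simp add: power_mult_distrib)
  qed
  have bound: "(\<Sum>n<L. (cmod (c n))\<^sup>2) \<le> (K * hardy2_norm f)\<^sup>2" for L
  proof (rule tendsto_upperbound)
    have "((\<lambda>r. \<Sum>n<L. ?c r n) \<longlongrightarrow> (\<Sum>n<L. (cmod (c n * of_real 1 ^ n))\<^sup>2)) (at_left 1)"
      by (intro tendsto_intros)
    then show "((\<lambda>r. \<Sum>n<L. ?c r n) \<longlongrightarrow> (\<Sum>n<L. (cmod (c n))\<^sup>2)) (at_left 1)" by simp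
    show "\<forall>\<^sub>F r in at_left 1. (\<Sum>n<L. ?c r n) \<le> (K * hardy2_norm f)\<^sup>2"
      using eventually_at_left_real[of 0 1, simplified] by eventually_elim (use dil in auto)
  qed simp
  have sm: "summable (\<lambda>n. (cmod (c n))\<^sup>2)" by (rule summableI_nonneg_bounded[OF _ bound]) simp
  have gH: "g \<in> hardy2"
  proof (rule hardy2I[OF _ sm])
    show "(\<lambda>n. c n * z ^ n) sums g z" if "cmod z < 1" for z unfolding c_def by (rule taylor_sums[OF g that])
    show "g z = 0" if "1 \<le> cmod z" for z using hardy2_outside[OF f that] by (simp add: g_def)
  qed
  then show "(\<lambda>z. F z * f z) \<in> hardy2" by (simp add: g_def[abs_def])
  have "(hardy2_norm g)\<^sup>2 \<le> (K * hardy2_norm f)\<^sup>2"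
    unfolding hardy2_norm_square[OF gH] c_def[symmetric] by (rule suminf_le_const[OF sm bound])
  then have "hardy2_norm g \<le> K * hardy2_norm f"
    by (rule power2_le_imp_le) (use K hardy2_norm_nonneg[OF f] in simp)
  then show "hardy2_norm (\<lambda>z. F z * f z) \<le> K * hardy2_norm f" by (simp add: g_def[abs_def])
qed

lemma on_disc_hardy2:
  assumes F: "F holomorphic_on ball 0 1" "\<And>z. cmod z < 1 \<Longrightarrow> cmod (F z) \<le> K"
  shows "on_disc F \<in> hardy2"
proof -
  have "(\<lambda>z. F z * disc_monom 0 z) = on_disc F" by (auto simp: disc_monom_def on_disc_def)
  then show ?thesis using multiplier(1)[OF F disc_monom(1)] by metis
qed

lemma eventually_radius_in_disc:
  assumes "cmod w = 1"
  shows "\<forall>\<^sub>F t in at_left 1. cmod (of_real t * w) < 1"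
  using eventually_at_left_real[of 0 1, simplified]
  by eventually_elim (use assms in \<open>auto simp: norm_mult\<close>)

lemma radius_tendsto: "((\<lambda>t. of_real t * w) \<longlongrightarrow> (w::complex)) (at_left 1)"
proof -
  have "((\<lambda>t. of_real t * w) \<longlongrightarrow> of_real 1 * w) (at_left 1)" by (intro tendsto_intros)
  then show ?thesis by simp
qed

lemma radius_tendsto_on_disc:
  assumes "cmod w = 1"
  shows "((\<lambda>t. on_disc F (of_real t * w)) \<longlongrightarrow> l) (at_left 1) \<longleftrightarrow> ((\<lambda>t. F (of_real t * w)) \<longlongrightarrow> l) (at_left 1)"
proof (rule tendsto_cong)
  show "\<forall>\<^sub>F t in at_left 1. on_disc F (of_real t * w) = F (of_real t * w)"
    using eventually_radius_in_disc[OF assms] by eventually_elim (simp add: on_disc_def)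
qed

text \<open>
  A function that is continuous up to the circle is its own boundary function, and its mean is the
  Fourier coefficient of index 0.
\<close>

lemma mean_value_circle:
  assumes C: "C holomorphic_on ball 0 1" "continuous_on (cball 0 1) C"
  shows "(LINT w|circle_measure. C w) = C 0" and "L2_circle C"
proof -
  have "compact (C ` cball 0 1)" by (rule compact_continuous_image[OF C(2)]) simp
  then obtain K where K: "\<And>z. cmod z \<le> 1 \<Longrightarrow> cmod (C z) \<le> K"
    using compact_imp_bounded bounded_iff by (metis (no_types, lifting) image_eqI mem_cball_0)
  have H: "on_disc C \<in> hardy2" by (rule on_disc_hardy2[OF C(1), of K]) (use K in auto)
  have b: "boundary_fun (on_disc C) w = C w" if z: "cmod w = 1" for w
  proof (rule boundary_fun_eqI, subst radius_tendsto_on_disc[OF z])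
    show "((\<lambda>t. C (of_real t * w)) \<longlongrightarrow> C w) (at_left 1)"
      by (rule continuous_on_tendsto_compose[OF C(2) radius_tendsto])
        (use z eventually_radius_in_disc[OF z] in \<open>auto elim!: eventually_mono\<close>)
  qed
  then have AEb: "AE w in circle_measure. boundary_fun (on_disc C) w = C w"
    using AE_circle_unit by (auto elim!: eventually_mono)
  show "L2_circle C" by (rule L2_AE_cong[OF boundary_fun_L2(1)[OF H] AEb])
  have "(LINT w|circle_measure. C w) = fourier C 0" by (simp add: fourier_def)
  also have "\<dots> = fourier (boundary_fun (on_disc C)) 0"
    by (rule fourier_AE_cong[OF boundary_fun_L2(1)[OF H] AEb, symmetric])
  also have "\<dots> = C 0"
    unfolding fourier_boundary_fun[OF H] by (simp add: taylor_coeff_def on_disc_def)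
  finally show "(LINT w|circle_measure. C w) = C 0" .
qed

lemma fourier_coanalytic:
  assumes C: "C holomorphic_on ball 0 1" "continuous_on (cball 0 1) C" "C 0 = 0"
  shows "fourier (\<lambda>w. cnj (C w)) n = 0" and "L2_circle (\<lambda>w. cnj (C w))"
proof -
  have "(LINT w|circle_measure. C w * w ^ n) = C 0 * 0 ^ n"
    by (rule mean_value_circle) (intro holomorphic_intros continuous_intros C)+
  then have "(LINT w|circle_measure. C w * w ^ n) = 0" using C(3) by simp
  then have zero: "cnj (LINT w|circle_measure. C w * w ^ n) = 0" by simp
  have "fourier (\<lambda>w. cnj (C w)) n = (LINT w|circle_measure. cnj (C w * w ^ n))"
    by (simp add: fourier_def)
  also have "\<dots> = cnj (LINT w|circle_measure. C w * w ^ n)"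
    by (rule Bochner_Integration.integral_cnj)
  finally show "fourier (\<lambda>w. cnj (C w)) n = 0" using zero by simp
  have m: "(\<lambda>w. cnj (C w)) \<in> borel_measurable circle_measure"
    by (rule measurable_compose[OF L2_measurable[OF mean_value_circle(2)[OF C(1,2)]]])
      (intro borel_measurable_continuous_onI continuous_intros)
  show "L2_circle (\<lambda>w. cnj (C w))"
    using mean_value_circle(2)[OF C(1,2)] m by (simp add: L2_circle_def)
qed

section \<open>Eigenvectors\<close>

text \<open>
  The symbol is a meromorphic function \<open>A / Q\<close> without poles on the circle, perturbed by a bounded
  analytic function. The number \<open>N\<close> enters through the last assumption: the functions \<open>z ^ j / Q\<close> with
  \<open>j < N\<close> are annihilated by the projection onto the Hardy space.
\<close>

locale coanalytic_perturbation =
  fixes A Q \<phi> \<Phi> :: "complex \<Rightarrow> complex" and N :: nat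
  assumes A: "A holomorphic_on UNIV" and Q: "Q holomorphic_on UNIV"
    and Q_circle: "\<And>z. cmod z = 1 \<Longrightarrow> Q z \<noteq> 0"
    and coprime: "\<And>z. cmod z < 1 \<Longrightarrow> Q z = 0 \<Longrightarrow> A z \<noteq> 0"
    and phi: "\<phi> \<in> hardy_inf"
    and Phi: "\<And>z. cmod z < 1 \<Longrightarrow> Q z \<noteq> 0 \<Longrightarrow> \<Phi> z = A z / Q z + \<phi> z"
    and coanalytic: "\<And>j. j < N \<Longrightarrow> \<exists>C. C holomorphic_on ball 0 1 \<and> continuous_on (cball 0 1) C \<and> C 0 = 0 \<and>
        (\<forall>w. cmod w = 1 \<longrightarrow> w ^ j / Q w = cnj (C w))"
begin

abbreviation regular :: "complex \<Rightarrow> bool" where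
  "regular \<mu> \<equiv> \<mu> \<notin> closure (disc_values \<Phi>)"

lemma phi_holomorphic: "\<phi> holomorphic_on ball 0 1"
  using phi by (simp add: hardy_inf_def)

lemma phi_bound: obtains M where "M \<ge> 0" "\<And>z. cmod z < 1 \<Longrightarrow> cmod (\<phi> z) \<le> M"
proof -
  obtain M where M: "\<forall>x\<in>\<phi> ` ball 0 1. cmod x \<le> M" using phi by (auto simp: hardy_inf_def bounded_iff)
  then have "0 \<le> M" using norm_ge_zero order_trans by (metis (mono_tags) centre_in_ball imageI zero_less_one)
  then show ?thesis using M that by auto
qed

lemma continuous_AQ: "continuous_on S A" "continuous_on S Q"
  using holomorphic_on_imp_continuous_on[OF A] holomorphic_on_imp_continuous_on[OF Q] continuous_on_subset by blast+

lemma isCont_AQ: "isCont A z" "isCont Q z"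
  using continuous_AQ[of UNIV] by (simp_all add: continuous_on_eq_continuous_at)

lemma is_pole_iff:
  assumes z: "cmod z < 1"
  shows "is_pole \<Phi> z \<longleftrightarrow> Q z = 0"
proof
  have zb: "z \<in> ball 0 1" using z by simp
  have disc: "\<forall>\<^sub>F w in at z. cmod w < 1"
    using eventually_at_in_open'[OF open_ball zb] by (auto elim: eventually_mono)
  have phi_cont: "(\<phi> \<longlongrightarrow> \<phi> z) (at z)"
    using holomorphic_on_imp_continuous_on[OF phi_holomorphic] zb
    by (simp add: continuous_on_eq_continuous_at isCont_def)
  have A_lim: "(A \<longlongrightarrow> A z) (at z)" and Q_lim: "(Q \<longlongrightarrow> Q z) (at z)"
    using isCont_AQ[of z] by (auto simp: isCont_def)
  show "Q z = 0" if p: "is_pole \<Phi> z"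
  proof (rule ccontr)
    assume q: "Q z \<noteq> 0"
    have "\<forall>\<^sub>F w in at z. Q w \<noteq> 0" by (rule tendsto_imp_eventually_ne[OF Q_lim q])
    with disc have ev: "\<forall>\<^sub>F w in at z. A w / Q w + \<phi> w = \<Phi> w" by eventually_elim (simp add: Phi)
    have "((\<lambda>w. A w / Q w + \<phi> w) \<longlongrightarrow> A z / Q z + \<phi> z) (at z)"
      by (intro tendsto_intros A_lim Q_lim phi_cont q)
    then have "(\<Phi> \<longlongrightarrow> A z / Q z + \<phi> z) (at z)" using ev by (rule Lim_transform_eventually)
    moreover have "filterlim \<Phi> at_infinity (at z)" using p by (simp add: is_pole_def)
    ultimately show False using not_tendsto_and_filterlim_at_infinity[of "at z"] by auto
  qed
  show "is_pole \<Phi> z" if q: "Q z = 0"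
  proof -
    have "\<forall>\<^sub>F w in at z. Q w \<noteq> 0 \<and> w \<in> UNIV"
      by (rule non_zero_neighbour_alt[OF Q _ _ _ _ Q_circle[of 1]]) auto
    with disc have ev: "\<forall>\<^sub>F w in at z. A w / Q w + \<phi> w = \<Phi> w" and ne: "\<forall>\<^sub>F w in at z. Q w \<noteq> 0"
      by (eventually_elim, simp add: Phi, auto elim: eventually_mono)
    have "filterlim Q (at 0) (at z)" using Q_lim q ne by (auto simp: filterlim_at)
    then have "filterlim (\<lambda>w. A w / Q w) at_infinity (at z)"
      by (intro filterlim_divide_at_infinity[OF A_lim _ coprime[OF z q]])
    then have "filterlim (\<lambda>w. A w / Q w + \<phi> w) at_infinity (at z)"
      by (rule tendsto_add_filterlim_at_infinity'[OF _ phi_cont])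
    then show ?thesis unfolding is_pole_def using filterlim_cong[OF refl refl ev] by simp
  qed
qed

text \<open>
  \<open>Q (\<Phi> - \<mu>)\<close>, written in a form that makes sense at the poles as well.
\<close>

definition cleared :: "complex \<Rightarrow> complex \<Rightarrow> complex" where
  "cleared \<mu> z = A z + Q z * (\<phi> z - \<mu>)"

lemma cleared_holomorphic: "cleared \<mu> holomorphic_on ball 0 1"
  unfolding cleared_def
  by (intro holomorphic_intros holomorphic_on_subset[OF A] holomorphic_on_subset[OF Q] phi_holomorphic) auto

lemma compact_bound:
  assumes "continuous_on (cball 0 1) F"
  obtains K where "K \<ge> 0" "\<And>z. cmod z \<le> 1 \<Longrightarrow> cmod (F z) \<le> K"
proof -
  have "compact (F ` cball 0 1)" by (rule compact_continuous_image[OF assms]) simp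
  then obtain K where "\<forall>x\<in>F ` cball 0 1. cmod x \<le> K" using compact_imp_bounded bounded_iff by blast
  then have "cmod (F z) \<le> max K 0" if "cmod z \<le> 1" for z using that by (simp add: le_max_iff_disj)
  then show ?thesis by (intro that[of "max K 0"]) auto
qed

lemma cleared_bounded: obtains K where "\<And>z. cmod z < 1 \<Longrightarrow> cmod (cleared \<mu> z) \<le> K"
proof -
  obtain M where M: "M \<ge> 0" "\<And>z. cmod z < 1 \<Longrightarrow> cmod (\<phi> z) \<le> M" using phi_bound by blast
  obtain KA where KA: "KA \<ge> 0" "\<And>z. cmod z \<le> 1 \<Longrightarrow> cmod (A z) \<le> KA" using compact_bound[OF continuous_AQ(1)] by blast
  obtain KQ where KQ: "KQ \<ge> 0" "\<And>z. cmod z \<le> 1 \<Longrightarrow> cmod (Q z) \<le> KQ" using compact_bound[OF continuous_AQ(2)] by blast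
  have "cmod (cleared \<mu> z) \<le> KA + KQ * (M + cmod \<mu>)" if z: "cmod z < 1" for z
  proof -
    have "cmod (cleared \<mu> z) \<le> cmod (A z) + cmod (Q z) * cmod (\<phi> z - \<mu>)"
      unfolding cleared_def by (metis norm_mult norm_triangle_ineq)
    also have "cmod (\<phi> z - \<mu>) \<le> M + cmod \<mu>"
      using norm_triangle_ineq4[of "\<phi> z" \<mu>] M(2)[OF z] by linarith
    then have "cmod (A z) + cmod (Q z) * cmod (\<phi> z - \<mu>) \<le> KA + KQ * (M + cmod \<mu>)"
      using KA(2)[of z] KQ(2)[of z] KQ(1) z by (intro add_mono mult_mono) auto
    finally show ?thesis .
  qed
  then show ?thesis by (rule that)
qed

lemma cleared_eq: "cmod z < 1 \<Longrightarrow> Q z \<noteq> 0 \<Longrightarrow> cleared \<mu> z = Q z * (\<Phi> z - \<mu>)"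
  by (simp add: cleared_def Phi field_simps)

text \<open>
  The bound is uniform in a neighbourhood of \<open>\<mu>\<close>. It says that the functions \<open>Q / (Q (\<Phi> - \<nu>))\<close>, which are
  the resolvents, are uniformly bounded, and this gives their norm continuity in \<open>\<nu>\<close>.
\<close>

lemma spectral_gap:
  assumes "regular \<mu>"
  obtains d where "d > 0" "\<And>\<nu>. \<nu> \<in> ball \<mu> d \<Longrightarrow> regular \<nu>"
    "\<And>\<nu> z. \<nu> \<in> ball \<mu> d \<Longrightarrow> cmod z < 1 \<Longrightarrow> d * cmod (Q z) \<le> cmod (cleared \<nu> z)"
proof -
  have "open (- closure (disc_values \<Phi>))" "\<mu> \<in> - closure (disc_values \<Phi>)" using assms by auto
  then obtain e where e: "e > 0" "ball \<mu> e \<subseteq> - closure (disc_values \<Phi>)" using open_contains_ball by blast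
  show ?thesis
  proof (rule that[of "e / 2"])
    show "e / 2 > 0" using e by simp
    show "regular \<nu>" if "\<nu> \<in> ball \<mu> (e / 2)" for \<nu>
      using that e by (auto simp: subset_iff)
    fix \<nu> z assume \<nu>: "\<nu> \<in> ball \<mu> (e / 2)" and z: "cmod z < 1"
    show "e / 2 * cmod (Q z) \<le> cmod (cleared \<nu> z)"
    proof (cases "Q z = 0")
      case False
      then have "\<Phi> z \<in> disc_values \<Phi>" using z is_pole_iff[OF z] by (auto simp: disc_values_def)
      then have "\<Phi> z \<notin> ball \<mu> e" using e closure_subset by blast
      then have "e \<le> dist \<mu> (\<Phi> z)" by simp
      also have "\<dots> \<le> dist \<mu> \<nu> + dist \<nu> (\<Phi> z)" by (rule dist_triangle)
      finally have "e / 2 \<le> cmod (\<Phi> z - \<nu>)" using \<nu> by (simp add: dist_norm norm_minus_commute)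
      then have "e / 2 * cmod (Q z) \<le> cmod (\<Phi> z - \<nu>) * cmod (Q z)" by (rule mult_right_mono) simp
      then show ?thesis using cleared_eq[OF z False] by (simp add: norm_mult mult.commute)
    qed simp
  qed
qed

text \<open>
  The spectral gap bounds \<open>\<bar>Q\<bar>\<close> by a multiple of \<open>\<bar>Q (\<Phi> - \<mu>)\<bar>\<close>, and then
  \<open>A = Q (\<Phi> - \<mu>) - Q (\<phi> - \<mu>)\<close> is bounded in the same way. But \<open>\<bar>A\<bar> + \<bar>Q\<bar>\<close> has a positive minimum on
  the closed disc, because \<open>A\<close> and \<open>Q\<close> have no common zero there.
\<close>

lemma cleared_bounded_below:
  assumes "regular \<mu>"
  obtains c where "c > 0" "\<And>z. cmod z < 1 \<Longrightarrow> c \<le> cmod (cleared \<mu> z)"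
proof -
  obtain d where d: "d > 0" "\<And>z. cmod z < 1 \<Longrightarrow> d * cmod (Q z) \<le> cmod (cleared \<mu> z)"
    using spectral_gap[OF assms] by (metis centre_in_ball)
  obtain M where M: "M \<ge> 0" "\<And>z. cmod z < 1 \<Longrightarrow> cmod (\<phi> z) \<le> M" using phi_bound by blast
  have "continuous_on (cball 0 1) (\<lambda>z. cmod (A z) + cmod (Q z))" by (intro continuous_intros continuous_AQ)
  then obtain w where w: "w \<in> cball 0 1" "\<And>z. z \<in> cball 0 1 \<Longrightarrow> cmod (A w) + cmod (Q w) \<le> cmod (A z) + cmod (Q z)"
    using continuous_attains_inf[of "cball 0 1" "\<lambda>z. cmod (A z) + cmod (Q z)"] by auto
  define b where "b = cmod (A w) + cmod (Q w)"
  have b: "b > 0"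
  proof (cases "Q w = 0")
    case True
    then have "cmod w < 1" using w(1) Q_circle[of w] by fastforce
    then show ?thesis using coprime[OF _ True] by (simp add: b_def add_pos_nonneg)
  qed (simp add: b_def add_nonneg_pos)
  define m where "m = 1 + (1 + M + cmod \<mu>) / d"
  have m: "m > 0" unfolding m_def using d M by (intro add_pos_nonneg) auto
  have "b / m \<le> cmod (cleared \<mu> z)" if z: "cmod z < 1" for z
  proof -
    have q: "cmod (Q z) \<le> cmod (cleared \<mu> z) / d" using d(2)[OF z] d(1) by (simp add: pos_le_divide_eq mult.commute)
    have "A z = cleared \<mu> z - Q z * (\<phi> z - \<mu>)" by (simp add: cleared_def)
    then have "cmod (A z) \<le> cmod (cleared \<mu> z) + cmod (Q z) * cmod (\<phi> z - \<mu>)"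
      by (metis norm_mult norm_triangle_ineq4)
    also have "cmod (\<phi> z - \<mu>) \<le> M + cmod \<mu>"
      using norm_triangle_ineq4[of "\<phi> z" \<mu>] M(2)[OF z] by linarith
    then have "cmod (cleared \<mu> z) + cmod (Q z) * cmod (\<phi> z - \<mu>) \<le> cmod (cleared \<mu> z) + cmod (Q z) * (M + cmod \<mu>)"
      by (intro add_left_mono mult_left_mono) auto
    finally have "cmod (A z) + cmod (Q z) \<le> cmod (cleared \<mu> z) + cmod (Q z) * (1 + M + cmod \<mu>)"
      by (simp add: algebra_simps)
    also have "\<dots> \<le> cmod (cleared \<mu> z) + cmod (cleared \<mu> z) / d * (1 + M + cmod \<mu>)"
      using q M by (intro add_left_mono mult_right_mono) auto
    also have "\<dots> = m * cmod (cleared \<mu> z)" by (simp add: m_def algebra_simps)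
    finally have "b \<le> m * cmod (cleared \<mu> z)" using w(2)[of z] z by (simp add: b_def)
    then show ?thesis using m by (simp add: pos_divide_le_eq mult.commute)
  qed
  then show ?thesis using that[of "b / m"] b m by auto
qed

lemma cleared_nonzero:
  assumes "regular \<mu>" "cmod z < 1"
  shows "cleared \<mu> z \<noteq> 0"
  using cleared_bounded_below[OF assms(1)] assms(2) by (metis norm_zero not_less)

lemma resolvent_fun_eq:
  assumes "regular \<mu>"
  shows "resolvent_fun \<Phi> \<mu> = on_disc (\<lambda>z. Q z / cleared \<mu> z)"
proof
  fix z
  show "resolvent_fun \<Phi> \<mu> z = on_disc (\<lambda>z. Q z / cleared \<mu> z) z"
    using is_pole_iff[of z] cleared_eq[of z \<mu>] cleared_nonzero[OF assms, of z]
    by (auto simp: resolvent_fun_def on_disc_def)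
qed

definition eigenvec :: "complex \<Rightarrow> nat \<Rightarrow> complex \<Rightarrow> complex" where
  "eigenvec \<mu> j = on_disc (\<lambda>z. z ^ j / cleared \<mu> z)"

lemma inverse_cleared:
  assumes "regular \<mu>"
  obtains K where "K > 0" "(\<lambda>z. 1 / cleared \<mu> z) holomorphic_on ball 0 1" "\<And>z. cmod z < 1 \<Longrightarrow> cmod (1 / cleared \<mu> z) \<le> K"
proof -
  obtain c where c: "c > 0" "\<And>z. cmod z < 1 \<Longrightarrow> c \<le> cmod (cleared \<mu> z)" using cleared_bounded_below[OF assms] by blast
  show ?thesis
  proof (rule that[of "1 / c"])
    show "(\<lambda>z. 1 / cleared \<mu> z) holomorphic_on ball 0 1"
      by (intro holomorphic_intros cleared_holomorphic) (use cleared_nonzero[OF assms] in auto)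
    show "cmod (1 / cleared \<mu> z) \<le> 1 / c" if "cmod z < 1" for z
      using c(2)[OF that] c(1) by (simp add: norm_divide frac_le)
  qed (use c in simp)
qed

lemma eigenvec_eq: "eigenvec \<mu> j = (\<lambda>z. 1 / cleared \<mu> z * disc_monom j z)"
  by (auto simp: eigenvec_def on_disc_def disc_monom_def)

lemma eigenvec_hardy2:
  assumes "regular \<mu>"
  shows "eigenvec \<mu> j \<in> hardy2"
  unfolding eigenvec_eq using inverse_cleared[OF assms] multiplier(1)[OF _ _ disc_monom(1)] by metis

lemma boundary_Phi:
  "AE w in circle_measure. ((\<lambda>t. \<Phi> (of_real t * w)) \<longlongrightarrow> boundary_fun \<Phi> w) (at_left 1)
      \<and> boundary_fun \<Phi> w = A w / Q w + boundary_fun (on_disc \<phi>) w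
      \<and> ((\<lambda>t. \<phi> (of_real t * w)) \<longlongrightarrow> boundary_fun (on_disc \<phi>) w) (at_left 1)"
proof -
  obtain M where M: "\<And>z. cmod z < 1 \<Longrightarrow> cmod (\<phi> z) \<le> M" using phi_bound by blast
  have "on_disc \<phi> \<in> hardy2" by (rule on_disc_hardy2[OF phi_holomorphic M])
  from AE_circle_unit boundary_fun_tendsto[OF this] show ?thesis
  proof eventually_elim
    case (elim w)
    then have p: "((\<lambda>t. \<phi> (of_real t * w)) \<longlongrightarrow> boundary_fun (on_disc \<phi>) w) (at_left 1)"
      by (simp add: radius_tendsto_on_disc)
    have q: "Q w \<noteq> 0" using Q_circle elim by auto
    have AQ: "((\<lambda>t. A (of_real t * w)) \<longlongrightarrow> A w) (at_left 1)" "((\<lambda>t. Q (of_real t * w)) \<longlongrightarrow> Q w) (at_left 1)"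
      by (intro isCont_tendsto_compose[OF _ radius_tendsto] isCont_AQ)+
    have "\<forall>\<^sub>F t in at_left 1. A (of_real t * w) / Q (of_real t * w) + \<phi> (of_real t * w) = \<Phi> (of_real t * w)"
      using tendsto_imp_eventually_ne[OF AQ(2) q] eventually_radius_in_disc[OF elim(1)]
      by eventually_elim (simp add: Phi)
    moreover have "((\<lambda>t. A (of_real t * w) / Q (of_real t * w) + \<phi> (of_real t * w))
        \<longlongrightarrow> A w / Q w + boundary_fun (on_disc \<phi>) w) (at_left 1)"
      by (intro tendsto_intros AQ p q)
    ultimately have l: "((\<lambda>t. \<Phi> (of_real t * w)) \<longlongrightarrow> A w / Q w + boundary_fun (on_disc \<phi>) w) (at_left 1)"
      by (rule Lim_transform_eventually[rotated])
    with boundary_fun_eqI[OF l] p show ?case by simp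
  qed
qed

lemma symbol_bounded_measurable:
  obtains K where "boundary_fun \<Phi> \<in> borel_measurable circle_measure" "AE w in circle_measure. cmod (boundary_fun \<Phi> w) \<le> K"
proof -
  obtain M where M: "\<And>z. cmod z < 1 \<Longrightarrow> cmod (\<phi> z) \<le> M" using phi_bound by blast
  have H: "on_disc \<phi> \<in> hardy2" by (rule on_disc_hardy2[OF phi_holomorphic M])
  have "continuous_on (sphere 0 1) (\<lambda>z. A z / Q z)"
    by (intro continuous_intros continuous_AQ) (use Q_circle in auto)
  then have "compact ((\<lambda>z. A z / Q z) ` sphere 0 1)" by (rule compact_continuous_image) simp
  then obtain L where L: "\<forall>x\<in>(\<lambda>z. A z / Q z) ` sphere 0 1. cmod x \<le> L" using compact_imp_bounded bounded_iff by blast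
  show ?thesis
  proof (rule that[of "L + M"])
    have [measurable]: "A \<in> borel_measurable borel" "Q \<in> borel_measurable borel"
      by (intro borel_measurable_continuous_onI continuous_AQ)+
    have [measurable]: "(\<lambda>w. A w / Q w) \<in> borel_measurable circle_measure"
      by (rule borel_measurable_circle) measurable
    note [measurable] = L2_measurable[OF boundary_fun_L2(1)[OF H]]
    show "boundary_fun \<Phi> \<in> borel_measurable circle_measure"
    proof (rule measurable_AE_cong)
      show "(\<lambda>w. A w / Q w + boundary_fun (on_disc \<phi>) w) \<in> borel_measurable circle_measure" by measurable
      show "AE w in circle_measure. A w / Q w + boundary_fun (on_disc \<phi>) w = boundary_fun \<Phi> w"
        using boundary_Phi by eventually_elim simp
    qed
    show "AE w in circle_measure. cmod (boundary_fun \<Phi> w) \<le> L + M"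
      using boundary_Phi AE_circle_unit
    proof eventually_elim
      case (elim w)
      have "cmod (boundary_fun (on_disc \<phi>) w) \<le> M"
      proof (rule tendsto_upperbound[OF tendsto_norm])
        show "((\<lambda>t. \<phi> (of_real t * w)) \<longlongrightarrow> boundary_fun (on_disc \<phi>) w) (at_left 1)" using elim by blast
        show "\<forall>\<^sub>F t in at_left 1. cmod (\<phi> (of_real t * w)) \<le> M"
          using eventually_radius_in_disc[OF elim(2)] by eventually_elim (rule M)
      qed simp
      moreover have "cmod (A w / Q w) \<le> L" using L elim(2) by auto
      ultimately show ?case using elim(1) norm_triangle_ineq[of "A w / Q w" "boundary_fun (on_disc \<phi>) w"] by simp
    qed
  qed
qed

lemma toeplitz_operator: "hardy2_bounded_operator (toeplitz (boundary_fun \<Phi>))"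
  using symbol_bounded_measurable toeplitz_bounded_operator(1) by metis

text \<open>
  On the circle \<open>(\<Phi> - \<mu>) v = z ^ j / Q\<close>, by passing to the limit along almost every radius, and the
  right-hand side has no Fourier coefficients of nonnegative index.
\<close>

lemma eigenvec_eigenvector:
  assumes \<mu>: "regular \<mu>" and j: "j < N"
  shows "toeplitz (boundary_fun \<Phi>) (eigenvec \<mu> j) = cfun_scale \<mu> (eigenvec \<mu> j)"
proof -
  let ?v = "eigenvec \<mu> j"
  obtain K where K: "boundary_fun \<Phi> \<in> borel_measurable circle_measure" "AE w in circle_measure. cmod (boundary_fun \<Phi> w) \<le> K"
    using symbol_bounded_measurable by blast
  have v: "?v \<in> hardy2" by (rule eigenvec_hardy2[OF \<mu>])
  have Tv: "toeplitz (boundary_fun \<Phi>) ?v \<in> hardy2" by (rule bounded_operatorD(1)[OF toeplitz_operator v])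
  obtain C where C: "C holomorphic_on ball 0 1" "continuous_on (cball 0 1) C" "C 0 = 0"
    "\<And>w. cmod w = 1 \<Longrightarrow> w ^ j / Q w = cnj (C w)" using coanalytic[OF j] by blast
  have "AE w in circle_measure. boundary_fun \<Phi> w * boundary_fun ?v w = \<mu> * boundary_fun ?v w + cnj (C w)"
    using boundary_Phi boundary_fun_tendsto[OF v] AE_circle_unit
  proof eventually_elim
    case (elim w)
    have q: "Q w \<noteq> 0" using Q_circle elim by auto
    have Ql: "((\<lambda>t. Q (of_real t * w)) \<longlongrightarrow> Q w) (at_left 1)"
      by (intro isCont_tendsto_compose[OF _ radius_tendsto] isCont_AQ)
    have "((\<lambda>t. (\<Phi> (of_real t * w) - \<mu>) * ?v (of_real t * w)) \<longlongrightarrow> (boundary_fun \<Phi> w - \<mu>) * boundary_fun ?v w) (at_left 1)"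
      using elim by (intro tendsto_intros) auto
    moreover have "\<forall>\<^sub>F t in at_left 1. (\<Phi> (of_real t * w) - \<mu>) * ?v (of_real t * w) = (of_real t * w) ^ j / Q (of_real t * w)"
      using tendsto_imp_eventually_ne[OF Ql q] eventually_radius_in_disc[OF elim(3)]
    proof eventually_elim
      case (elim t)
      have "\<Phi> (of_real t * w) - \<mu> \<noteq> 0" using cleared_nonzero[OF \<mu> elim(2)] cleared_eq[OF elim(2,1), of \<mu>] by auto
      then show ?case using elim by (simp add: eigenvec_def on_disc_def cleared_eq)
    qed
    ultimately have "((\<lambda>t. (of_real t * w) ^ j / Q (of_real t * w)) \<longlongrightarrow> (boundary_fun \<Phi> w - \<mu>) * boundary_fun ?v w) (at_left 1)"
      by (rule Lim_transform_eventually)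
    moreover have "((\<lambda>t. (of_real t * w) ^ j / Q (of_real t * w)) \<longlongrightarrow> w ^ j / Q w) (at_left 1)"
      by (intro tendsto_intros Ql radius_tendsto q)
    ultimately have "(boundary_fun \<Phi> w - \<mu>) * boundary_fun ?v w = w ^ j / Q w"
      using tendsto_unique[of "at_left (1::real)"] by auto
    then show ?case using C(4)[of w] elim by (simp add: algebra_simps)
  qed
  then have "fourier (\<lambda>w. boundary_fun \<Phi> w * boundary_fun ?v w) n = fourier (\<lambda>w. \<mu> * boundary_fun ?v w + cnj (C w)) n" for n
    by (intro fourier_AE_cong L2_bounded_mult(1)[OF boundary_fun_L2(1)[OF v] K])
  also have "\<dots> n = \<mu> * taylor_coeff ?v n" for n
    using fourier_coanalytic[OF C(1-3)]
    by (simp add: fourier_add L2_scale boundary_fun_L2(1)[OF v] fourier_scale fourier_boundary_fun[OF v])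
  finally have "taylor_coeff (toeplitz (boundary_fun \<Phi>) ?v) = taylor_coeff (cfun_scale \<mu> ?v)"
    using toeplitz_bounded_operator(2)[OF K v] by (auto simp: hardy2_scale(2)[OF v])
  then show ?thesis by (intro hardy2_eqI Tv hardy2_scale v)
qed

text \<open>
  With \<open>h\<^sub>\<nu> = 1 / (\<Phi> - \<nu>)\<close> the resolvent identity gives \<open>v\<^sub>a - v\<^sub>b = (a - b) h\<^sub>a v\<^sub>b\<close> for eigenvectors,
  so that products of \<open>v\<^sub>b\<close> with powers of \<open>h\<^sub>a\<close> reduce, one power at a time, to combinations of
  eigenvectors as long as \<open>a \<noteq> b\<close>; the case \<open>a = b\<close> follows by letting \<open>b\<close> tend to \<open>a\<close>. Therefore the
  closed span contains the image of the cyclic family under multiplication by \<open>1 / (Q (\<Phi> - \<mu>))\<close>. That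
  multiplication is bounded with bounded inverse, so the image of a complete family is complete.
\<close>

lemma eigenvec_span_dense:
  assumes S: "hardy2_subspace S" and \<mu>: "regular \<mu>" and d: "d > 0"
    and eig: "\<And>\<nu> j. \<nu> \<in> ball \<mu> d \<Longrightarrow> j < N \<Longrightarrow> eigenvec \<nu> j \<in> S"
    and cyc: "cyclic_for_mult (resolvent_fun \<Phi> \<mu>) ((\<lambda>j. on_disc (\<lambda>z. z ^ j)) ` {..<N})"
  shows "hardy2_closure S = hardy2"
proof -
  let ?K = "hardy2_closure S"
  have SH: "S \<subseteq> hardy2" using S by (simp add: hardy2_subspace_def)
  have Ksub: "hardy2_subspace ?K" by (rule hardy2_closure_subspace[OF S])
  then have KH: "?K \<subseteq> hardy2" and K0: "0 \<in> ?K" and Kadd: "\<And>f g. f \<in> ?K \<Longrightarrow> g \<in> ?K \<Longrightarrow> f + g \<in> ?K"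
    and Kscale: "\<And>f c. f \<in> ?K \<Longrightarrow> cfun_scale c f \<in> ?K"
    by (auto simp: hardy2_subspace_def)
  obtain g where g: "g > 0" "\<And>\<nu>. \<nu> \<in> ball \<mu> g \<Longrightarrow> regular \<nu>"
    "\<And>\<nu> z. \<nu> \<in> ball \<mu> g \<Longrightarrow> cmod z < 1 \<Longrightarrow> g * cmod (Q z) \<le> cmod (cleared \<nu> z)"
    using spectral_gap[OF \<mu>] by blast
  define U where "U = ball \<mu> (min d g)"
  have \<mu>U: "\<mu> \<in> U" using d g by (simp add: U_def)
  have openU: "open U" by (simp add: U_def)
  have U: "regular \<nu>" "\<And>z. cmod z < 1 \<Longrightarrow> g * cmod (Q z) \<le> cmod (cleared \<nu> z)"
    "\<And>j. j < N \<Longrightarrow> eigenvec \<nu> j \<in> S" if "\<nu> \<in> U" for \<nu>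
    using that g eig by (auto simp: U_def)
  define h where "h \<nu> z = Q z / cleared \<nu> z" for \<nu> z
  have h_hol: "h \<nu> holomorphic_on ball 0 1" if "\<nu> \<in> U" for \<nu>
    unfolding h_def using cleared_nonzero[OF U(1)[OF that]]
    by (intro holomorphic_intros cleared_holomorphic holomorphic_on_subset[OF Q]) auto
  have h_bd: "cmod (h \<nu> z) \<le> 1 / g" if "\<nu> \<in> U" "cmod z < 1" for \<nu> z
  proof -
    have "cmod (cleared \<nu> z) > 0" using cleared_nonzero[OF U(1)[OF that(1)] that(2)] by simp
    then show ?thesis using U(2)[OF that] g(1) by (simp add: h_def norm_divide field_simps)
  qed
  have diff: "eigenvec a j z - eigenvec b j z = (a - b) * (h a z * eigenvec b j z)"
    if "a \<in> U" "b \<in> U" for a b j z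
  proof (cases "cmod z < 1")
    case True
    have "cleared b z - cleared a z = Q z * (a - b)" by (simp add: cleared_def algebra_simps)
    then have "z ^ j / cleared a z - z ^ j / cleared b z = (a - b) * (Q z / cleared a z * (z ^ j / cleared b z))"
      using cleared_nonzero[OF U(1)[OF that(1)] True] cleared_nonzero[OF U(1)[OF that(2)] True]
      by (simp add: diff_frac_eq) (metis (no_types, lifting) mult.commute mult.left_commute right_diff_distrib)
    then show ?thesis using True by (simp add: eigenvec_def on_disc_def h_def)
  qed (simp add: eigenvec_def on_disc_def)
  have mem: "(\<lambda>z. h a z ^ k * eigenvec b j z) \<in> ?K" if "a \<in> U" "b \<in> U" "j < N" for a b j k
    using that
  proof (induction k arbitrary: a b)
    case 0
    then have "eigenvec b j \<in> ?K" using U(3) subset_hardy2_closure[OF SH] by blast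
    then show ?case by simp
  next
    case (Suc k)
    have distinct: "(\<lambda>z. h a z ^ Suc k * eigenvec b j z) \<in> ?K" if ab: "a \<in> U" "b \<in> U" "a \<noteq> b" for a b
    proof -
      have eq: "(\<lambda>z. h a z ^ Suc k * eigenvec b j z) =
          cfun_scale (1 / (a - b)) ((\<lambda>z. h a z ^ k * eigenvec a j z) + cfun_scale (- 1) (\<lambda>z. h a z ^ k * eigenvec b j z))"
      proof
        fix z
        have "h a z ^ k * eigenvec a j z - h a z ^ k * eigenvec b j z = (a - b) * (h a z ^ Suc k * eigenvec b j z)"
          using diff[OF ab(1,2), of j z] by (simp add: mult_ac flip: right_diff_distrib)
        then show "h a z ^ Suc k * eigenvec b j z =
            cfun_scale (1 / (a - b)) ((\<lambda>z. h a z ^ k * eigenvec a j z) + cfun_scale (- 1) (\<lambda>z. h a z ^ k * eigenvec b j z)) z"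
          using ab(3) by (simp add: cfun_scale_def)
      qed
      show ?thesis unfolding eq by (intro Kscale Kadd Suc.IH ab Suc.prems(3))
    qed
    show ?case
    proof (cases "a = b")
      case False then show ?thesis using distinct Suc.prems by blast
    next
      case True
      let ?w = "\<lambda>b z. h a z ^ Suc k * eigenvec b j z"
      have hp_hol: "(\<lambda>z. h a z ^ Suc k) holomorphic_on ball 0 1"
        by (intro holomorphic_intros h_hol Suc.prems)
      have hp_bd: "cmod (h a z ^ Suc k) \<le> (1 / g) ^ Suc k" if "cmod z < 1" for z
        unfolding norm_power by (intro power_mono h_bd Suc.prems that) auto
      have wH: "?w b \<in> hardy2" if "b \<in> U" for b
        by (rule multiplier(1)[OF hp_hol hp_bd eigenvec_hardy2[OF U(1)[OF that]]])
      define B where "B = (1 / g) ^ Suc k * (1 / g) * hardy2_norm (eigenvec a j)"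
      have B: "B \<ge> 0" unfolding B_def using g(1) hardy2_norm_nonneg[OF eigenvec_hardy2[OF U(1)[OF Suc.prems(1)]]] by simp
      have est: "hardy2_norm (?w b - ?w a) \<le> cmod (b - a) * B" if b: "b \<in> U" for b
      proof -
        let ?m = "\<lambda>z. (b - a) * (h a z ^ Suc k * h b z)"
        have "?w b - ?w a = (\<lambda>z. ?m z * eigenvec a j z)"
        proof
          fix z
          have "(?w b - ?w a) z = h a z ^ Suc k * (eigenvec b j z - eigenvec a j z)"
            by (simp add: right_diff_distrib)
          also have "\<dots> = ?m z * eigenvec a j z" unfolding diff[OF b Suc.prems(1)] by (simp add: mult_ac)
          finally show "(?w b - ?w a) z = ?m z * eigenvec a j z" .
        qed
        moreover have "hardy2_norm (\<lambda>z. ?m z * eigenvec a j z)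
            \<le> (cmod (b - a) * ((1 / g) ^ Suc k * (1 / g))) * hardy2_norm (eigenvec a j)"
        proof (rule multiplier(2)[OF _ _ eigenvec_hardy2[OF U(1)[OF Suc.prems(1)]]])
          show "?m holomorphic_on ball 0 1" by (intro holomorphic_intros h_hol hp_hol b Suc.prems)
          show "cmod (?m z) \<le> cmod (b - a) * ((1 / g) ^ Suc k * (1 / g))" if "cmod z < 1" for z
            unfolding norm_mult using hp_bd[OF that] h_bd[OF b that] g(1)
            by (intro mult_left_mono mult_mono) auto
        qed
        ultimately show ?thesis by (simp only: B_def mult.assoc)
      qed
      have "?w a \<in> ?K"
      proof (rule hardy2_closure_closed[OF SH wH[OF Suc.prems(1)]])
        fix e :: real assume e: "e > 0"
        obtain r where r: "r > 0" "ball a r \<subseteq> U" using openU Suc.prems(1) open_contains_ball by blast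
        \<comment> \<open>A real displacement \<open>t\<close>, inside the neighbourhood \<open>U\<close> and small against the Lipschitz constant \<open>B\<close>.\<close>
        define t where "t = min (r / 2) (e / (2 * (B + 1)))"
        have t: "t > 0" "t < r" "t * B < e"
        proof -
          show "t > 0" using r e B by (simp add: t_def)
          show "t < r" using r by (simp add: t_def min_less_iff_disj)
          have "t * B \<le> e / (2 * (B + 1)) * (B + 1)" using B \<open>t > 0\<close> by (intro mult_mono) (auto simp: t_def)
          also have "\<dots> = e / 2" using B by (simp add: field_simps)
          finally show "t * B < e" using e by simp
        qed
        define \<gamma> where "\<gamma> = a + of_real t"
        have \<gamma>: "\<gamma> \<in> U" "a \<noteq> \<gamma>" "cmod (\<gamma> - a) = t"
          using r(2) t by (auto simp: \<gamma>_def dist_norm subset_iff)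
        have "hardy2_norm (?w \<gamma> - ?w a) < e" using est[OF \<gamma>(1)] \<gamma>(3) t(3) by simp
        then show "\<exists>f\<in>?K. hardy2_norm (f - ?w a) < e" using distinct[OF Suc.prems(1) \<gamma>(1,2)] by blast
      qed
      then show ?thesis using True by simp
    qed
  qed
  obtain B where B: "B > 0" "(\<lambda>z. 1 / cleared \<mu> z) holomorphic_on ball 0 1" "\<And>z. cmod z < 1 \<Longrightarrow> cmod (1 / cleared \<mu> z) \<le> B"
    using inverse_cleared[OF \<mu>] by blast
  obtain BE where BE: "\<And>z. cmod z < 1 \<Longrightarrow> cmod (cleared \<mu> z) \<le> BE" using cleared_bounded by blast
  let ?gen = "{(\<lambda>z. resolvent_fun \<Phi> \<mu> z ^ n * u z) | n u. u \<in> (\<lambda>j. on_disc (\<lambda>z. z ^ j)) ` {..<N}}"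
  let ?M = "{s. (\<lambda>z. 1 / cleared \<mu> z * s z) \<in> ?K}"
  have span: "cfun.span ?gen \<subseteq> ?M"
  proof (rule cfun.span_minimal)
    show "?gen \<subseteq> ?M"
    proof
      fix s assume "s \<in> ?gen"
      then obtain n j where j: "j < N" and s: "s = (\<lambda>z. resolvent_fun \<Phi> \<mu> z ^ n * on_disc (\<lambda>z. z ^ j) z)" by auto
      have "(\<lambda>z. 1 / cleared \<mu> z * s z) = (\<lambda>z. h \<mu> z ^ n * eigenvec \<mu> j z)"
        unfolding s resolvent_fun_eq[OF \<mu>] by (auto simp: on_disc_def eigenvec_def h_def fun_eq_iff)
      then show "s \<in> ?M" using mem[OF \<mu>U \<mu>U j, of n] by simp
    qed
    show "cfun.subspace ?M"
    proof (rule cfun.subspaceI)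
      have "(\<lambda>z. 1 / cleared \<mu> z * (0 :: complex \<Rightarrow> complex) z) = 0" by (simp add: fun_eq_iff)
      then show "0 \<in> ?M" using K0 by (metis mem_Collect_eq)
      fix x y assume xy: "x \<in> ?M"
      {
        assume "y \<in> ?M"
        moreover have "(\<lambda>z. 1 / cleared \<mu> z * (x + y) z) = (\<lambda>z. 1 / cleared \<mu> z * x z) + (\<lambda>z. 1 / cleared \<mu> z * y z)"
          by (simp add: fun_eq_iff distrib_left add_divide_distrib)
        ultimately show "x + y \<in> ?M" using xy Kadd by (metis mem_Collect_eq)
      }
      fix c
      have "(\<lambda>z. 1 / cleared \<mu> z * cfun_scale c x z) = cfun_scale c (\<lambda>z. 1 / cleared \<mu> z * x z)"
        by (simp add: fun_eq_iff cfun_scale_def)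
      then show "cfun_scale c x \<in> ?M" using xy Kscale by (metis mem_Collect_eq)
    qed
  qed
  have "x \<in> ?K" if x: "x \<in> hardy2" for x
  proof (rule hardy2_closure_closed[OF SH x])
    fix e :: real assume e: "e > 0"
    have Ex: "(\<lambda>z. cleared \<mu> z * x z) \<in> hardy2" by (rule multiplier(1)[OF cleared_holomorphic BE x])
    have "e / B > 0" using e B by simp
    then obtain s where s: "s \<in> cfun.span ?gen" "hardy2_norm (s - (\<lambda>z. cleared \<mu> z * x z)) < e / B"
      using cyc Ex unfolding cyclic_for_mult_def hardy2_dense_def by blast
    have sH: "s \<in> hardy2" using cyc s(1) unfolding cyclic_for_mult_def hardy2_dense_def by blast
    have dH: "s - (\<lambda>z. cleared \<mu> z * x z) \<in> hardy2" by (rule hardy2_diff(1)[OF sH Ex])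
    have "(\<lambda>z. 1 / cleared \<mu> z * s z) - x = (\<lambda>z. 1 / cleared \<mu> z * (s - (\<lambda>z. cleared \<mu> z * x z)) z)"
    proof
      fix z
      show "((\<lambda>z. 1 / cleared \<mu> z * s z) - x) z = 1 / cleared \<mu> z * (s - (\<lambda>z. cleared \<mu> z * x z)) z"
        using cleared_nonzero[OF \<mu>, of z] hardy2_outside[OF x, of z]
        by (cases "cmod z < 1") (auto simp: field_simps)
    qed
    then have "hardy2_norm ((\<lambda>z. 1 / cleared \<mu> z * s z) - x) \<le> B * hardy2_norm (s - (\<lambda>z. cleared \<mu> z * x z))"
      using multiplier(2)[OF B(2,3) dH] by (simp only:)
    also have "\<dots> < e" using s(2) B(1) by (simp add: pos_less_divide_eq mult.commute)
    finally have "hardy2_norm ((\<lambda>z. 1 / cleared \<mu> z * s z) - x) < e" .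
    moreover have "(\<lambda>z. 1 / cleared \<mu> z * s z) \<in> ?K" using span s(1) by auto
    ultimately show "\<exists>f\<in>?K. hardy2_norm (f - x) < e" by blast
  qed
  then show ?thesis using KH by blast
qed

theorem toeplitz_hypercyclic:
  assumes inside: "regular \<mu>" "cmod \<mu> < 1"
    and outside: "regular \<nu>" "cmod \<nu> > 1"
    and cyc: "\<And>\<mu>. regular \<mu> \<Longrightarrow>
      cyclic_for_mult (resolvent_fun \<Phi> \<mu>) ((\<lambda>j. on_disc (\<lambda>z. z ^ j)) ` {..<N})"
  shows "hypercyclic_on_hardy2 (toeplitz (boundary_fun \<Phi>))"
proof (rule hypercyclicity_criterion[OF toeplitz_operator])
  let ?T = "toeplitz (boundary_fun \<Phi>)"
  have nbhd: "\<exists>d>0. \<forall>\<nu>\<in>ball \<mu> d. \<nu> \<in> W \<and> regular \<nu>"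
    if "regular \<mu>" "\<mu> \<in> W" "open W" for \<mu> W
  proof -
    have "open (W \<inter> - closure (disc_values \<Phi>))" using that by (intro open_Int) auto
    moreover have "\<mu> \<in> W \<inter> - closure (disc_values \<Phi>)" using that by simp
    ultimately show ?thesis unfolding open_contains_ball by blast
  qed
  obtain d where d: "d > 0" "\<And>\<nu>. \<nu> \<in> ball \<mu> d \<Longrightarrow> \<nu> \<in> ball 0 1 \<and> regular \<nu>"
    using nbhd[OF inside(1) _ open_ball, of 0 1] inside(2) by auto
  show "hardy2_closure (stable_set ?T) = hardy2"
  proof (rule eigenvec_span_dense[OF stable_subspace[OF toeplitz_operator] inside(1) d(1) _ cyc[OF inside(1)]])
    fix \<nu> j assume "\<nu> \<in> ball \<mu> d" "j < N"
    then show "eigenvec \<nu> j \<in> stable_set ?T"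
      using d(2)[of \<nu>] by (intro eigenvector_stable[OF toeplitz_operator _ eigenvec_eigenvector] eigenvec_hardy2) auto
  qed
  have "open (- cball (0::complex) 1)" by auto
  then obtain d' where d': "d' > 0" "\<And>\<mu>. \<mu> \<in> ball \<nu> d' \<Longrightarrow> \<mu> \<in> - cball 0 1 \<and> regular \<mu>"
    using nbhd[OF outside(1), of "- cball 0 1"] outside(2) by auto
  show "hardy2_closure (unstable_set ?T) = hardy2"
  proof (rule eigenvec_span_dense[OF unstable_subspace[OF toeplitz_operator] outside(1) d'(1) _ cyc[OF outside(1)]])
    fix \<mu> j assume "\<mu> \<in> ball \<nu> d'" "j < N"
    then show "eigenvec \<mu> j \<in> unstable_set ?T"
      using d'(2)[of \<mu>] by (intro eigenvector_unstable[OF toeplitz_operator _ eigenvec_eigenvector] eigenvec_hardy2) auto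
  qed
qed

end

section \<open>Rational symbols\<close>

text \<open>
  Numerator and denominator of the rational function \<open>R(1/z)\<close>, with \<open>n\<close> the degree of \<open>P\<close>. The reversed
  polynomial in the numerator is \<open>z\<^sup>n P(1/z)\<close>.
\<close>

definition symbol_denominator :: "nat \<Rightarrow> nat \<Rightarrow> (nat \<Rightarrow> complex) \<Rightarrow> (nat \<Rightarrow> nat) \<Rightarrow> complex \<Rightarrow> complex" where
  "symbol_denominator n r \<eta> k z = z ^ n * (\<Prod>l=1..r. (1 - \<eta> l * z) ^ k l)"

definition symbol_numerator ::
    "complex poly \<Rightarrow> nat \<Rightarrow> (nat \<Rightarrow> complex) \<Rightarrow> (nat \<Rightarrow> nat) \<Rightarrow> (nat \<Rightarrow> nat \<Rightarrow> complex) \<Rightarrow> complex \<Rightarrow> complex" where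
  "symbol_numerator P r \<eta> k \<alpha> z =
     poly (reflect_poly P) z * (\<Prod>l=1..r. (1 - \<eta> l * z) ^ k l) +
     (\<Sum>l=1..r. \<Sum>j=1..k l. \<alpha> l j * z ^ j * z ^ degree P * (1 - \<eta> l * z) ^ (k l - j) *
        (\<Prod>m\<in>{1..r} - {l}. (1 - \<eta> m * z) ^ k m))"

lemma symbol_denominator_eq_0_iff:
  assumes "\<And>l. l \<in> {1..r} \<Longrightarrow> k l \<ge> 1"
  shows "symbol_denominator n r \<eta> k z = 0 \<longleftrightarrow> (z = 0 \<and> n \<ge> 1) \<or> (\<exists>l\<in>{1..r}. \<eta> l * z = 1)"
  using assms by (fastforce simp: symbol_denominator_def)

lemma rational_fun_inverse:
  assumes z: "z \<noteq> 0" and nz: "\<And>l. l \<in> {1..r} \<Longrightarrow> \<eta> l * z \<noteq> 1"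
  shows "symbol_numerator P r \<eta> k \<alpha> z = symbol_denominator (degree P) r \<eta> k z * rational_fun P r \<eta> k \<alpha> (1 / z)"
proof -
  let ?p = "\<lambda>l. (1 - \<eta> l * z) ^ k l"
  have t: "\<alpha> l j * z ^ j * z ^ degree P * (1 - \<eta> l * z) ^ (k l - j) * (\<Prod>m\<in>{1..r} - {l}. ?p m)
      = symbol_denominator (degree P) r \<eta> k z * (\<alpha> l j / (1 / z - \<eta> l) ^ j)"
    if l: "l \<in> {1..r}" and j: "j \<in> {1..k l}" for l j
  proof -
    have nl: "1 - \<eta> l * z \<noteq> 0" using nz[OF l] by auto
    have "(\<Prod>l=1..r. ?p l) = ?p l * (\<Prod>m\<in>{1..r} - {l}. ?p m)" by (rule prod.remove) (use l in auto)
    moreover have "?p l = (1 - \<eta> l * z) ^ (k l - j) * (1 - \<eta> l * z) ^ j" using j by (simp flip: power_add)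
    moreover have "1 / z - \<eta> l = (1 - \<eta> l * z) / z" using z by (simp add: field_simps)
    ultimately show ?thesis using nl z by (simp add: symbol_denominator_def power_divide)
  qed
  have "poly (reflect_poly P) z * (\<Prod>l=1..r. ?p l) = symbol_denominator (degree P) r \<eta> k z * poly P (1 / z)"
    using z by (simp add: poly_reflect_poly_nz symbol_denominator_def inverse_eq_divide mult_ac)
  moreover have "(\<Sum>l=1..r. \<Sum>j=1..k l. \<alpha> l j * z ^ j * z ^ degree P * (1 - \<eta> l * z) ^ (k l - j) *
        (\<Prod>m\<in>{1..r} - {l}. ?p m)) = (\<Sum>l=1..r. \<Sum>j=1..k l. symbol_denominator (degree P) r \<eta> k z * (\<alpha> l j / (1 / z - \<eta> l) ^ j))"
    by (intro sum.cong refl t)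
  ultimately show ?thesis
    by (simp only: symbol_numerator_def rational_fun_def distrib_left sum_distrib_left)
qed

lemma symbol_numerator_nonzero_at_0:
  assumes "degree P \<ge> 1"
  shows "symbol_numerator P r \<eta> k \<alpha> 0 \<noteq> 0"
proof -
  have "(\<Sum>l=1..r. \<Sum>j=1..k l. \<alpha> l j * 0 ^ j * 0 ^ degree P * (1 - \<eta> l * 0) ^ (k l - j) *
        (\<Prod>m\<in>{1..r} - {l}. (1 - \<eta> m * 0) ^ k m)) = 0"
    using assms by (intro sum.neutral ballI) simp
  then show ?thesis using assms by (auto simp: symbol_numerator_def)
qed

text \<open>
  At the pole \<open>1 / \<eta>\<^sub>l\<close> every summand vanishes except the one that comes from the principal part at
  \<open>\<eta>\<^sub>l\<close> with the highest order.
\<close>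

lemma symbol_numerator_nonzero_at_pole:
  assumes dist: "inj_on \<eta> {1..r}" and mult: "\<And>l. l \<in> {1..r} \<Longrightarrow> k l \<ge> 1"
    and lead: "\<And>l. l \<in> {1..r} \<Longrightarrow> \<alpha> l (k l) \<noteq> 0" and l: "l \<in> {1..r}" and z: "\<eta> l * z = 1"
  shows "symbol_numerator P r \<eta> k \<alpha> z \<noteq> 0"
proof -
  let ?p = "\<lambda>l. (1 - \<eta> l * z) ^ k l"
  let ?s = "\<lambda>m. \<Sum>j=1..k m. \<alpha> m j * z ^ j * z ^ degree P * (1 - \<eta> m * z) ^ (k m - j) * (\<Prod>i\<in>{1..r} - {m}. ?p i)"
  have z0: "z \<noteq> 0" using z by auto
  have pl: "?p l = 0" using z mult[OF l] by simp
  have full: "(\<Prod>l=1..r. ?p l) = 0" using pl l by (intro prod_zero) auto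
  have other: "?s m = 0" if "m \<in> {1..r} - {l}" for m
  proof -
    have "(\<Prod>i\<in>{1..r} - {m}. ?p i) = 0" using that pl l by (intro prod_zero bexI[of _ l]) auto
    then show ?thesis by (simp only: mult_zero_right sum.neutral_const)
  qed
  have "symbol_numerator P r \<eta> k \<alpha> z = (\<Sum>m=1..r. ?s m)"
    unfolding symbol_numerator_def full by simp
  also have "\<dots> = ?s l"
    using other l by (subst sum.remove[of _ l]) auto
  also have "\<dots> = \<alpha> l (k l) * z ^ k l * z ^ degree P * (\<Prod>i\<in>{1..r} - {l}. ?p i)"
  proof -
    have "?s l = (\<Sum>j=1..k l. if j = k l then \<alpha> l (k l) * z ^ k l * z ^ degree P * (\<Prod>i\<in>{1..r} - {l}. ?p i) else 0)"
      using z by (intro sum.cong refl) auto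
    then show ?thesis using mult[OF l] by simp
  qed
  also have "\<dots> \<noteq> 0"
  proof -
    have "?p i \<noteq> 0" if i: "i \<in> {1..r} - {l}" for i
    proof
      assume "?p i = 0"
      then have "\<eta> i * z = \<eta> l * z" using z by simp
      then have "\<eta> i = \<eta> l" using z0 by simp
      then show False using dist i l by (auto dest: inj_onD)
    qed
    then show ?thesis using lead[OF l] z0 by simp
  qed
  finally show ?thesis .
qed

text \<open>
  On the circle \<open>1 / w\<close> is the conjugate \<open>u\<close> of \<open>w\<close>. With \<open>N\<close> the number of zeros of the denominator,
  the quotient is \<open>u\<^sup>N\<^sup>-\<^sup>j\<close> divided by the product of the \<open>(u - \<eta>\<^sub>l)\<^sup>k\<close>, which is analytic in \<open>u\<close> on the closed
  disc since the \<open>\<eta>\<^sub>l\<close> lie outside; it vanishes at the origin because \<open>j < N\<close>.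
\<close>

lemma symbol_denominator_coanalytic:
  assumes out: "\<And>l. l \<in> {1..r} \<Longrightarrow> \<eta> l \<notin> cball 0 1" and j: "j < n + (\<Sum>l=1..r. k l)"
  shows "\<exists>C. C holomorphic_on ball 0 1 \<and> continuous_on (cball 0 1) C \<and> C 0 = 0 \<and>
        (\<forall>w. cmod w = 1 \<longrightarrow> w ^ j / symbol_denominator n r \<eta> k w = cnj (C w))"
proof -
  let ?N = "n + (\<Sum>l=1..r. k l)"
  define C where "C z = z ^ (?N - j) / (\<Prod>l=1..r. (z - cnj (\<eta> l)) ^ k l)" for z
  have nz: "(\<Prod>l=1..r. (z - cnj (\<eta> l)) ^ k l) \<noteq> 0" if "cmod z \<le> 1" for z
  proof -
    have "z \<noteq> cnj (\<eta> l)" if "l \<in> {1..r}" for l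
      using out[OF that] \<open>cmod z \<le> 1\<close> by auto
    then show ?thesis by auto
  qed
  have "w ^ j / symbol_denominator n r \<eta> k w = cnj (C w)" if w: "cmod w = 1" for w
  proof -
    have u: "w * cnj w = 1" using w complex_norm_square[of w] by simp
    then have w0: "w \<noteq> 0" by auto
    have "(\<Prod>l=1..r. (1 - \<eta> l * w) ^ k l) = (\<Prod>l=1..r. w ^ k l * (cnj w - \<eta> l) ^ k l)"
    proof (rule prod.cong[OF refl])
      fix l
      have "1 - \<eta> l * w = w * (cnj w - \<eta> l)" using u by (simp add: algebra_simps)
      then show "(1 - \<eta> l * w) ^ k l = w ^ k l * (cnj w - \<eta> l) ^ k l" by (simp add: power_mult_distrib)
    qed
    also have "\<dots> = w ^ (\<Sum>l=1..r. k l) * (\<Prod>l=1..r. (cnj w - \<eta> l) ^ k l)"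
      by (simp add: prod.distrib power_sum)
    finally have d: "symbol_denominator n r \<eta> k w = w ^ ?N * (\<Prod>l=1..r. (cnj w - \<eta> l) ^ k l)"
      by (simp add: symbol_denominator_def power_add)
    have "w ^ ?N * cnj w ^ (?N - j) = w ^ j * (w * cnj w) ^ (?N - j)"
      using j by (simp add: power_mult_distrib flip: power_add mult.assoc)
    then have e: "w ^ j = w ^ ?N * cnj w ^ (?N - j)" using u by simp
    show ?thesis unfolding d C_def using w0 by (subst e) simp
  qed
  moreover have "C holomorphic_on ball 0 1"
    unfolding C_def by (intro holomorphic_intros nz) auto
  moreover have "continuous_on (cball 0 1) C"
    unfolding C_def by (intro continuous_intros ballI nz) auto
  moreover have "C 0 = 0" using j by (simp add: C_def)
  ultimately show ?thesis by blast
qed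

theorem proposition1p2:
  fixes P :: "complex poly" and r N N1 N2 :: nat
    and \<eta> :: "nat \<Rightarrow> complex" and k :: "nat \<Rightarrow> nat" and \<alpha> :: "nat \<Rightarrow> nat \<Rightarrow> complex"
    and \<phi> \<Phi> :: "complex \<Rightarrow> complex"
  assumes poles_outside: "\<And>l. l \<in> {1..r} \<Longrightarrow> \<eta> l \<notin> cball 0 1"
    and poles_distinct: "inj_on \<eta> {1..r}"
    and multiplicity_pos: "\<And>l. l \<in> {1..r} \<Longrightarrow> k l \<ge> 1"
    and leading_nonzero: "\<And>l. l \<in> {1..r} \<Longrightarrow> \<alpha> l (k l) \<noteq> 0"
    and N1: "N1 = degree P"
    and N2: "N2 = (\<Sum>l=1..r. k l)"
    and N: "N = N1 + N2"
    and phi: "\<phi> \<in> hardy_inf"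
    and Phi: "\<Phi> = symbol_fun P r \<eta> k \<alpha> \<phi>"
    and inside: "ball 0 1 \<inter> (UNIV - closure (disc_values \<Phi>)) \<noteq> {}"
    and outside: "(UNIV - cball 0 1) \<inter> (UNIV - closure (disc_values \<Phi>)) \<noteq> {}"
    and cyclic: "\<And>\<mu>. \<mu> \<notin> closure (disc_values \<Phi>) \<Longrightarrow>
      cyclic_for_mult (resolvent_fun \<Phi> \<mu>) ((\<lambda>j. on_disc (\<lambda>z. z ^ j)) ` {..<N})"
  shows "hypercyclic_on_hardy2 (toeplitz (boundary_fun \<Phi>))"
proof -
  let ?Q = "symbol_denominator (degree P) r \<eta> k" and ?A = "symbol_numerator P r \<eta> k \<alpha>"
  have zero_iff: "?Q z = 0 \<longleftrightarrow> (z = 0 \<and> degree P \<ge> 1) \<or> (\<exists>l\<in>{1..r}. \<eta> l * z = 1)" for z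
    by (rule symbol_denominator_eq_0_iff) (rule multiplicity_pos)
  interpret coanalytic_perturbation ?A ?Q \<phi> \<Phi> N
  proof
    show "?A holomorphic_on UNIV"
      unfolding symbol_numerator_def by (intro holomorphic_intros)
    show "?Q holomorphic_on UNIV"
      unfolding symbol_denominator_def by (intro holomorphic_intros)
    show "?Q z \<noteq> 0" if z: "cmod z = 1" for z
    proof
      assume "?Q z = 0"
      then obtain l where l: "l \<in> {1..r}" "\<eta> l * z = 1" using zero_iff z by auto
      then have "cmod (\<eta> l) = 1" using z by (metis mult.right_neutral norm_mult norm_one)
      then show False using poles_outside[OF l(1)] by simp
    qed
    show "?A z \<noteq> 0" if "cmod z < 1" "?Q z = 0" for z
    proof -
      from that(2) consider "z = 0" "degree P \<ge> 1" | l where "l \<in> {1..r}" "\<eta> l * z = 1"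
        unfolding zero_iff by blast
      then show ?thesis
      proof cases
        case 1
        then show ?thesis using symbol_numerator_nonzero_at_0 by simp
      next
        case 2
        then show ?thesis
          by (intro symbol_numerator_nonzero_at_pole[where l = l] poles_distinct multiplicity_pos leading_nonzero)
      qed
    qed
    show "\<phi> \<in> hardy_inf" by (rule phi)
    show "\<Phi> z = ?A z / ?Q z + \<phi> z" if "cmod z < 1" "?Q z \<noteq> 0" for z
    proof (cases "z = 0")
      case False
      then have "?A z = ?Q z * rational_fun P r \<eta> k \<alpha> (1 / z)"
        using that(2) unfolding zero_iff by (intro rational_fun_inverse) auto
      then show ?thesis using that(2) False by (simp add: Phi symbol_fun_def)
    next
      \<comment> \<open>The denominator does not vanish at the origin only if \<open>P\<close> is constant; both sides then take the value of \<open>R\<close> at infinity.\<close>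
      case True
      then have "degree P = 0" using that(2) unfolding zero_iff by auto
      then show ?thesis using True
        by (simp add: Phi symbol_fun_def symbol_numerator_def symbol_denominator_def)
    qed
    show "\<exists>C. C holomorphic_on ball 0 1 \<and> continuous_on (cball 0 1) C \<and> C 0 = 0 \<and>
        (\<forall>w. cmod w = 1 \<longrightarrow> w ^ j / ?Q w = cnj (C w))" if "j < N" for j
      by (rule symbol_denominator_coanalytic[OF poles_outside]) (use that N N1 N2 in auto)
  qed
  obtain \<mu> where "\<mu> \<notin> closure (disc_values \<Phi>)" "cmod \<mu> < 1" using inside by auto
  moreover obtain \<nu> where "\<nu> \<notin> closure (disc_values \<Phi>)" "cmod \<nu> > 1"
    using outside by (auto simp: not_le)
  ultimately show ?thesis using cyclic by (rule toeplitz_hypercyclic)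
qed

end
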